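(* On the explicit rational 48-cell reference mesh of the context, with material coefficients $c_1=c_2=1$, potential $z_h$ given by $z_h(X_h(t))=4t$, deformations $$y_h^s(X)=(I_3+sE_{12})X,\qquad X\in\Omega_h,$$ ($E_{12}=e_1\otimes e_2$), and zero variations imposed on the face $t_1=0$: for all real $|s|\le1/4$ and arbitrary nonnegative cell bulk moduli $\kappa_e$, $$G_{z,h}(y_h^s)\succeq\tfrac1{16}A_{I,h}\succ0 .$$ The complete four-point stored-energy Hessian retains the exact boundary representation $K_h(y_h^s)=G_{z,h}(y_h^s)-R_\Gamma^TB_\Gamma[z_h]R_\Gamma$. The geometry has $\delta_h>1/2$.
   Context: $A:B=\operatorname{tr}(A^TB)$; $\operatorname{cof}A$ is the matrix of signed $2\times2$ minors; $\|\cdot\|_2$ is the spectral norm. Mesh: partition each of the eight cubes of the corner grid $\{0,1/2,1\}^3$ into the six Freudenthal tetrahedra (vertex paths from lowest to highest corner incrementing the coordinates in each possible order), giving 48 tetrahedra with vertex and edge-midpoint nodes $t=(i,j,k)/4$, $0\le i,j,k\le4$. $a_h:[0,1]^3\to\mathbb R^3$ is the continuous field, quadratic (total degree $\le2$) on each tetrahedron, with nodal values $(a_1,a_2,a_3)$ listed below under the key $ijk$, and zero at nodes with $i,j,k$ all even. The reference map is $X_h(t)=t+\frac{7}{3768}a_h(t)$; it is injective and orientation preserving; $\Omega_h=X_h((0,1)^3)$. Nodal values: 001:(-5,15,7); 003:(5,-2,-5); 010:(12,-10,-10); 011:(2,-4,2); 012:(-10,4,12); 013:(13,2,-4); 014:(8,9,-9);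 021:(-15,9,6); 023:(7,-10,10); 030:(4,6,16); 031:(-3,-11,-3); 032:(-9,1,-4); 033:(0,-8,-8); 034:(8,-8,10); 041:(9,-3,-8); 043:(14,-4,2); 100:(-1,11,7); 101:(13,4,1); 102:(-5,-2,13); 103:(-9,4,-7); 104:(8,-5,1); 110:(-16,3,-8); 111:(12,0,9); 112:(9,13,-12); 113:(6,-4,-16); 114:(2,2,15); 120:(7,-7,11); 121:(-13,-10,-6); 122:(-14,9,5); 123:(-14,-10,2); 124:(8,-5,11); 130:(11,3,6); 131:(-14,9,7); 132:(-14,-9,7); 133:(-11,-2,7); 134:(-6,-6,9); 140:(-7,-13,-4); 141:(9,-5,9); 142:(4,1,0); 143:(12,10,14); 144:(-1,-9,-12); 201:(-3,3,-1); 203:(3,-7,-1); 210:(6,-15,11); 211:(-3,-16,-3); 212:(-8,7,-16); 213:(-11,11,1); 214:(-1,-9,-12); 221:(-9,15,4); 223:(-13,16,-9); 230:(-3,-5,10); 231:(-8,-12,-1); 232:(0,6,-9); 233:(-9,-1,13); 234:(2,6,-11); 241:(-2,11,1); 243:(11,-5,-15); 300:(-4,-5,-8); 301:(8,-9,-7); 302:(-4,-15,-2); 303:(-14,12,-3); 304:(-6,-10,-10); 310:(2,15,-10); 311:(9,-3,3); 312:(-10,-10,-16); 313:(2,-13,-9); 314:(9,-15,-11); 320:(6,16,-12); 321:(-7,12,8); 322:(-5,-2,7); 323:(-3,-11,-6); 324:(5,15,14); 330:(-2,13,10); 331:(-8,-14,-8); 332:(-6,-10,-16); 333:(11,2,7);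 334:(3,11,-5); 340:(-2,9,2); 341:(15,1,11); 342:(0,12,8); 343:(7,12,-6); 344:(16,-10,-6); 401:(-14,14,8); 403:(8,-14,-3); 410:(-12,-12,5); 411:(11,-5,-14); 412:(7,16,-2); 413:(7,-14,12); 414:(11,-2,-13); 421:(-12,6,7); 423:(-7,10,-2); 430:(-7,-13,10); 431:(16,-13,7); 432:(13,-12,-10); 433:(11,-14,-11); 434:(3,1,12); 441:(-8,-8,1); 443:(-9,14,-14). Cell maps: $X_e=X_h\circ\tau_e$, with $\tau_e$ an orientation-preserving affine map of $\widehat T=\{\xi:\xi_i\ge0,\sum\xi_i\le1\}$ onto the $e$-th tetrahedron. For a field, subscript $e$ is pullback by $X_e$ and $J_{\cdot,e}$ its Jacobian in $\xi$; $F=J_{y,e}J_{X,e}^{-1}$. The corner interpolant of $X_e$ is $\overline X_e=\tau_e$ (corners are unmoved), $\overline J_{X,e}=D_\xi\overline X_e$, and $\delta_h=\max_{e,q}\|\overline J_{X,e}J_{X,e}(\xi_q)^{-1}-I_3\|_2$ over cells and the four points of $Q_4$. Quadrature: $Q_4$ on $\widehat T$ has weight $1/24$ at each of the four points $\xi_q$ with barycentric coordinates the permutations of $\bigl(\frac{5+3\sqrt5}{20},\frac{5-\sqrt5}{20},\frac{5-\sqrt5}{20},\frac{5-\sqrt5}{20}\bigr)$. Spaces and forms: $V_h$ is the space of continuous vector fields $u_h$ on $\overline\Omega_h$ with $u_h\circ X_e$ quadratic on every cell, vanishing on the image of the face $t_1=0$. With $W(F)=(J^{-2/3}F:F-3)+(J^{-4/3}\operatorname{cof}F:\operatorname{cof}F-3)$,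 $J=\det F>0$, $$E_h(y_h)=\sum_eQ_4[\det J_{X,e}W(F)]+\sum_e\frac{\kappa_e}{2V_e^Q}\bigl(Q_4[\det J_{y,e}-\det J_{X,e}]\bigr)^2,\quad V_e^Q=Q_4[\det J_{X,e}],$$ $K_h(y_h)=D^2E_h(y_h)$ along $V_h$. $\mathcal C_h^Q[z_h]$ is the Hessian on $V_h$ (with $z_h$ fixed) of $y_h\mapsto\sum_eQ_4[J_{z,e}:\operatorname{cof}J_{y,e}]$, and $G_{z,h}(y_h)=K_h(y_h)+\mathcal C_h^Q[z_h]$. $A_{I,h}$ is the form $A_{I,h}[u,v]=\sum_eQ_4\bigl[\det J_{X,e}\{2\nabla_Xu:\nabla_Xv+\frac23(\operatorname{tr}\nabla_Xu)(\operatorname{tr}\nabla_Xv)\}\bigr]$ on $V_h$. $R_\Gamma$ extracts the boundary trace coordinates of a variation, and $B_\Gamma[z_h]$ is the symmetric, deformation-independent matrix in trace coordinates such that $R_\Gamma^TB_\Gamma[z_h]R_\Gamma$ is the Hessian on $V_h$ of $y_h\mapsto\int_{\partial\Omega_h}z_h\cdot\{\operatorname{cof}(\nabla_Xy_h)n_X\}\,dS$, $n_X$ the outward unit normal. *)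

theory Defs
  imports "HOL-Analysis.Analysis"
begin

definition frob :: "real^3^3 \<Rightarrow> real^3^3 \<Rightarrow> real" where
  "frob A B = trace (transpose A ** B)"

text \<open>Indices of type \<^typ>\<open>3\<close> are taken modulo 3; the cyclic choice of the two
  remaining rows and columns produces the sign of the minor.\<close>
definition cof :: "real^3^3 \<Rightarrow> real^3^3" where
  "cof A = (\<chi> i j. A $ (i+1) $ (j+1) * A $ (i+2) $ (j+2) - A $ (i+1) $ (j+2) * A $ (i+2) $ (j+1))"

definition spectral_norm :: "real^3^3 \<Rightarrow> real" where
  "spectral_norm A = onorm ((*v) A)"

text \<open>A cell is given by the lowest corner of its cube and by the order in which the
  coordinates are incremented along the vertex path.\<close>
type_synonym cell = "(real^3) \<times> (3 \<Rightarrow> 3)"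

definition cells :: "cell set" where
  "cells = {(c, p). (\<forall>i. c $ i \<in> {0, 1/2}) \<and> bij p}"

definition tetrahedron :: "cell \<Rightarrow> (real^3) set" where
  "tetrahedron e = (case e of (c, p) \<Rightarrow>
     let d = (\<lambda>k. (1/2) *\<^sub>R axis (p k) 1)
     in convex hull {c, c + d 1, c + d 1 + d 2, c + d 1 + d 2 + d 3})"

definition ref_tet :: "(real^3) set" where
  "ref_tet = {\<xi>. (\<forall>i. 0 \<le> \<xi> $ i) \<and> (\<Sum>i\<in>UNIV. \<xi> $ i) \<le> 1}"

definition cell_chart :: "cell \<Rightarrow> (real^3 \<Rightarrow> real^3) \<Rightarrow> bool" where
  "cell_chart e \<tau> \<longleftrightarrow>
     (\<exists>A b. det A > 0 \<and> (\<forall>\<xi>. \<tau> \<xi> = A *v \<xi> + b)) \<and> \<tau> ` ref_tet = tetrahedron e"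

text \<open>Total degree at most 2, for each component.\<close>
definition quadratic_on :: "(real^3) set \<Rightarrow> (real^3 \<Rightarrow> real^3) \<Rightarrow> bool" where
  "quadratic_on S f \<longleftrightarrow>
     (\<exists>(c :: real^3) (L :: real^3^3) (Q :: 3 \<Rightarrow> real^3^3).
        \<forall>x\<in>S. f x = c + L *v x + (\<chi> i. x \<bullet> (Q i *v x)))"

definition node :: "nat \<Rightarrow> nat \<Rightarrow> nat \<Rightarrow> real^3" where
  "node i j k = vector [real i / 4, real j / 4, real k / 4]"

definition nodal_table :: "((nat \<times> nat \<times> nat) \<times> (int \<times> int \<times> int)) list" where
  "nodal_table = [
    ((0,0,1),(-5,15,7)), ((0,0,3),(5,-2,-5)), ((0,1,0),(12,-10,-10)), ((0,1,1),(2,-4,2)),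
    ((0,1,2),(-10,4,12)), ((0,1,3),(13,2,-4)), ((0,1,4),(8,9,-9)), ((0,2,1),(-15,9,6)),
    ((0,2,3),(7,-10,10)), ((0,3,0),(4,6,16)), ((0,3,1),(-3,-11,-3)), ((0,3,2),(-9,1,-4)),
    ((0,3,3),(0,-8,-8)), ((0,3,4),(8,-8,10)), ((0,4,1),(9,-3,-8)), ((0,4,3),(14,-4,2)),
    ((1,0,0),(-1,11,7)), ((1,0,1),(13,4,1)), ((1,0,2),(-5,-2,13)), ((1,0,3),(-9,4,-7)),
    ((1,0,4),(8,-5,1)), ((1,1,0),(-16,3,-8)), ((1,1,1),(12,0,9)), ((1,1,2),(9,13,-12)),
    ((1,1,3),(6,-4,-16)), ((1,1,4),(2,2,15)), ((1,2,0),(7,-7,11)), ((1,2,1),(-13,-10,-6)),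
    ((1,2,2),(-14,9,5)), ((1,2,3),(-14,-10,2)), ((1,2,4),(8,-5,11)), ((1,3,0),(11,3,6)),
    ((1,3,1),(-14,9,7)), ((1,3,2),(-14,-9,7)), ((1,3,3),(-11,-2,7)), ((1,3,4),(-6,-6,9)),
    ((1,4,0),(-7,-13,-4)), ((1,4,1),(9,-5,9)), ((1,4,2),(4,1,0)), ((1,4,3),(12,10,14)),
    ((1,4,4),(-1,-9,-12)), ((2,0,1),(-3,3,-1)), ((2,0,3),(3,-7,-1)), ((2,1,0),(6,-15,11)),
    ((2,1,1),(-3,-16,-3)), ((2,1,2),(-8,7,-16)), ((2,1,3),(-11,11,1)), ((2,1,4),(-1,-9,-12)),
    ((2,2,1),(-9,15,4)), ((2,2,3),(-13,16,-9)), ((2,3,0),(-3,-5,10)), ((2,3,1),(-8,-12,-1)),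
    ((2,3,2),(0,6,-9)), ((2,3,3),(-9,-1,13)), ((2,3,4),(2,6,-11)), ((2,4,1),(-2,11,1)),
    ((2,4,3),(11,-5,-15)), ((3,0,0),(-4,-5,-8)), ((3,0,1),(8,-9,-7)), ((3,0,2),(-4,-15,-2)),
    ((3,0,3),(-14,12,-3)), ((3,0,4),(-6,-10,-10)), ((3,1,0),(2,15,-10)), ((3,1,1),(9,-3,3)),
    ((3,1,2),(-10,-10,-16)), ((3,1,3),(2,-13,-9)), ((3,1,4),(9,-15,-11)), ((3,2,0),(6,16,-12)),
    ((3,2,1),(-7,12,8)), ((3,2,2),(-5,-2,7)), ((3,2,3),(-3,-11,-6)), ((3,2,4),(5,15,14)),
    ((3,3,0),(-2,13,10)), ((3,3,1),(-8,-14,-8)), ((3,3,2),(-6,-10,-16)), ((3,3,3),(11,2,7)),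
    ((3,3,4),(3,11,-5)), ((3,4,0),(-2,9,2)), ((3,4,1),(15,1,11)), ((3,4,2),(0,12,8)),
    ((3,4,3),(7,12,-6)), ((3,4,4),(16,-10,-6)), ((4,0,1),(-14,14,8)), ((4,0,3),(8,-14,-3)),
    ((4,1,0),(-12,-12,5)), ((4,1,1),(11,-5,-14)), ((4,1,2),(7,16,-2)), ((4,1,3),(7,-14,12)),
    ((4,1,4),(11,-2,-13)), ((4,2,1),(-12,6,7)), ((4,2,3),(-7,10,-2)), ((4,3,0),(-7,-13,10)),
    ((4,3,1),(16,-13,7)), ((4,3,2),(13,-12,-10)), ((4,3,3),(11,-14,-11)), ((4,3,4),(3,1,12)),
    ((4,4,1),(-8,-8,1)), ((4,4,3),(-9,14,-14))]"

definition nodal_value :: "nat \<Rightarrow> nat \<Rightarrow> nat \<Rightarrow> real^3" where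
  "nodal_value i j k = (case map_of nodal_table (i, j, k) of
     None \<Rightarrow> 0
   | Some (p, q, r) \<Rightarrow> vector [real_of_int p, real_of_int q, real_of_int r])"

text \<open>This determines \<open>a\<close> uniquely on the unit cube; the nodes missing from the table are
  those with \<open>i\<close>, \<open>j\<close>, \<open>k\<close> all even.\<close>
definition nodal_field :: "(real^3 \<Rightarrow> real^3) \<Rightarrow> bool" where
  "nodal_field a \<longleftrightarrow>
     continuous_on (cbox 0 1) a \<and>
     (\<forall>e\<in>cells. quadratic_on (tetrahedron e) a) \<and>
     (\<forall>i\<le>4. \<forall>j\<le>4. \<forall>k\<le>4. a (node i j k) = nodal_value i j k)"

definition ref_map :: "(real^3 \<Rightarrow> real^3) \<Rightarrow> real^3 \<Rightarrow> real^3" where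
  "ref_map a t = t + (7/3768) *\<^sub>R a t"

definition Omega :: "(real^3 \<Rightarrow> real^3) \<Rightarrow> (real^3) set" where
  "Omega a = ref_map a ` box 0 1"

definition cell_map :: "(real^3 \<Rightarrow> real^3) \<Rightarrow> (cell \<Rightarrow> real^3 \<Rightarrow> real^3) \<Rightarrow> cell \<Rightarrow> real^3 \<Rightarrow> real^3" where
  "cell_map a \<tau> e = ref_map a \<circ> \<tau> e"

text \<open>Derivative within the reference tetrahedron, so that on its faces it is the trace taken
  from inside the cell.\<close>
definition jac :: "(real^3 \<Rightarrow> real^3) \<Rightarrow> real^3 \<Rightarrow> real^3^3" where
  "jac f \<xi> = matrix (frechet_derivative f (at \<xi> within ref_tet))"

text \<open>The coordinates of a point of \<^const>\<open>ref_tet\<close> are its barycentric coordinates other than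
  the one belonging to the origin.\<close>
definition quad_points :: "(real^3) set" where
  "quad_points =
     (let \<alpha> = (5 + 3 * sqrt 5) / 20; \<beta> = (5 - sqrt 5) / 20
      in insert (\<chi> i. \<beta>) (range (\<lambda>k. \<chi> i. if i = k then \<alpha> else \<beta>)))"

definition Q4 :: "(real^3 \<Rightarrow> real) \<Rightarrow> real" where
  "Q4 g = (\<Sum>\<xi>\<in>quad_points. 1/24 * g \<xi>)"

text \<open>The corner interpolant of \<open>cell_map a \<tau> e\<close> is \<open>\<tau> e\<close>, because the
  displacement vanishes at the corners.\<close>
definition delta :: "(cell \<Rightarrow> real^3 \<Rightarrow> real^3) \<Rightarrow> (cell \<Rightarrow> real^3 \<Rightarrow> real^3) \<Rightarrow> real" where
  "delta \<tau> X = Max ((\<lambda>(e, \<xi>). spectral_norm (jac (\<tau> e) \<xi> ** matrix_inv (jac (X e) \<xi>) - mat 1))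
                     ` (cells \<times> quad_points))"

text \<open>Members are functions on the whole space of which only the values on the closed domain
  are constrained.\<close>
definition fe_space :: "(real^3 \<Rightarrow> real^3) \<Rightarrow> (cell \<Rightarrow> real^3 \<Rightarrow> real^3) \<Rightarrow> (real^3 \<Rightarrow> real^3) set" where
  "fe_space a \<tau> = {u. continuous_on (closure (Omega a)) u \<and>
     (\<forall>e\<in>cells. quadratic_on ref_tet (u \<circ> cell_map a \<tau> e))}"

definition Vh :: "(real^3 \<Rightarrow> real^3) \<Rightarrow> (cell \<Rightarrow> real^3 \<Rightarrow> real^3) \<Rightarrow> (real^3 \<Rightarrow> real^3) set" where
  "Vh a \<tau> = {u \<in> fe_space a \<tau>. \<forall>t\<in>cbox 0 1. t $ 1 = 0 \<longrightarrow> u (ref_map a t) = 0}"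

definition grad :: "(cell \<Rightarrow> real^3 \<Rightarrow> real^3) \<Rightarrow> (real^3 \<Rightarrow> real^3) \<Rightarrow> cell \<Rightarrow> real^3 \<Rightarrow> real^3^3" where
  "grad X y e \<xi> = jac (y \<circ> X e) \<xi> ** matrix_inv (jac (X e) \<xi>)"

text \<open>Second differential of a functional at \<open>y\<close> in the directions \<open>u\<close>, \<open>v\<close>.\<close>
definition hessian ::
  "((real^3 \<Rightarrow> real^3) \<Rightarrow> real) \<Rightarrow> (real^3 \<Rightarrow> real^3) \<Rightarrow> (real^3 \<Rightarrow> real^3) \<Rightarrow> (real^3 \<Rightarrow> real^3) \<Rightarrow> real" where
  "hessian \<Phi> y u v =
     deriv (\<lambda>p. deriv (\<lambda>q. \<Phi> (\<lambda>x. y x + p *\<^sub>R u x + q *\<^sub>R v x)) 0) 0"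

text \<open>The material coefficients are \<open>c\<^sub>1 = c\<^sub>2 = 1\<close>.\<close>
definition W :: "real^3^3 \<Rightarrow> real" where
  "W F = (det F powr (-2/3) * frob F F - 3) + (det F powr (-4/3) * frob (cof F) (cof F) - 3)"

definition VQ :: "(cell \<Rightarrow> real^3 \<Rightarrow> real^3) \<Rightarrow> cell \<Rightarrow> real" where
  "VQ X e = Q4 (\<lambda>\<xi>. det (jac (X e) \<xi>))"

definition energy ::
  "(cell \<Rightarrow> real^3 \<Rightarrow> real^3) \<Rightarrow> (cell \<Rightarrow> real) \<Rightarrow> (real^3 \<Rightarrow> real^3) \<Rightarrow> real" where
  "energy X \<kappa> y =
     (\<Sum>e\<in>cells. Q4 (\<lambda>\<xi>. det (jac (X e) \<xi>) * W (grad X y e \<xi>))) +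
     (\<Sum>e\<in>cells. \<kappa> e / (2 * VQ X e) *
        (Q4 (\<lambda>\<xi>. det (jac (y \<circ> X e) \<xi>) - det (jac (X e) \<xi>)))\<^sup>2)"

definition K_form where
  "K_form X \<kappa> y u v = hessian (energy X \<kappa>) y u v"

definition coupling ::
  "(cell \<Rightarrow> real^3 \<Rightarrow> real^3) \<Rightarrow> (real^3 \<Rightarrow> real^3) \<Rightarrow> (real^3 \<Rightarrow> real^3) \<Rightarrow> real" where
  "coupling X z y = (\<Sum>e\<in>cells. Q4 (\<lambda>\<xi>. frob (jac (z \<circ> X e) \<xi>) (cof (jac (y \<circ> X e) \<xi>))))"

text \<open>\<^const>\<open>coupling\<close> is a quadratic functional of \<open>y\<close>, so its Hessian may be taken at any
  base point; it is taken at \<open>y\<close>.\<close>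
definition G_form where
  "G_form X \<kappa> z y u v = K_form X \<kappa> y u v + hessian (coupling X z) y u v"

definition A_form ::
  "(cell \<Rightarrow> real^3 \<Rightarrow> real^3) \<Rightarrow> (real^3 \<Rightarrow> real^3) \<Rightarrow> (real^3 \<Rightarrow> real^3) \<Rightarrow> real" where
  "A_form X u v = (\<Sum>e\<in>cells. Q4 (\<lambda>\<xi>. det (jac (X e) \<xi>) *
     (2 * frob (grad X u e \<xi>) (grad X v e \<xi>) +
      2/3 * trace (grad X u e \<xi>) * trace (grad X v e \<xi>))))"

definition shear :: "real \<Rightarrow> real^3 \<Rightarrow> real^3" where
  "shear s x = (mat 1 + s *\<^sub>R (\<chi> i j. if i = 1 \<and> j = 2 then 1 else 0)) *v x"

definition ref_tri :: "(real^2) set" where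
  "ref_tri = {\<eta>. 0 \<le> \<eta> $ 1 \<and> 0 \<le> \<eta> $ 2 \<and> \<eta> $ 1 + \<eta> $ 2 \<le> 1}"

text \<open>Affine parametrizations of the four faces of \<^const>\<open>ref_tet\<close>, ordered so that the cross
  product of the two tangents points outwards.\<close>
definition ref_faces :: "(real^2 \<Rightarrow> real^3) set" where
  "ref_faces = {(\<lambda>\<eta>. vector [1 - \<eta> $ 1 - \<eta> $ 2, \<eta> $ 1, \<eta> $ 2]),
                (\<lambda>\<eta>. vector [0, \<eta> $ 2, \<eta> $ 1]),
                (\<lambda>\<eta>. vector [\<eta> $ 1, 0, \<eta> $ 2]),
                (\<lambda>\<eta>. vector [\<eta> $ 2, \<eta> $ 1, 0])}"

definition boundary_faces ::
  "(cell \<Rightarrow> real^3 \<Rightarrow> real^3) \<Rightarrow> (cell \<times> (real^2 \<Rightarrow> real^3)) set" where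
  "boundary_faces \<tau> = {(e, \<sigma>). e \<in> cells \<and> \<sigma> \<in> ref_faces \<and>
     \<tau> e ` \<sigma> ` ref_tri \<subseteq> frontier (cbox 0 1)}"

definition tangent_cross :: "(real^2 \<Rightarrow> real^3) \<Rightarrow> real^2 \<Rightarrow> real^3" where
  "tangent_cross P \<eta> = cross3 (frechet_derivative P (at \<eta>) (axis 1 1))
                              (frechet_derivative P (at \<eta>) (axis 2 1))"

text \<open>The unit normal of a parametrized patch; as the cell maps preserve orientation, it is the
  outward one for \<open>P = cell_map a \<tau> e \<circ> \<sigma>\<close> with \<open>(e, \<sigma>)\<close> in \<^const>\<open>boundary_faces\<close>.\<close>
definition unit_normal :: "(real^2 \<Rightarrow> real^3) \<Rightarrow> real^2 \<Rightarrow> real^3" where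
  "unit_normal P \<eta> = (1 / norm (tangent_cross P \<eta>)) *\<^sub>R tangent_cross P \<eta>"

text \<open>The surface integral of \<open>z \<bullet> (cof (\<nabla> y) n)\<close>: the patches over the boundary
  triangles cover the boundary of the domain, and the surface element is the norm of
  \<^const>\<open>tangent_cross\<close>.\<close>
definition boundary_functional ::
  "(cell \<Rightarrow> real^3 \<Rightarrow> real^3) \<Rightarrow> (cell \<Rightarrow> real^3 \<Rightarrow> real^3) \<Rightarrow> (real^3 \<Rightarrow> real^3) \<Rightarrow> (real^3 \<Rightarrow> real^3) \<Rightarrow> real" where
  "boundary_functional \<tau> X z y =
     (\<Sum>(e, \<sigma>)\<in>boundary_faces \<tau>.
        let P = X e \<circ> \<sigma> in
        integral ref_tri (\<lambda>\<eta>.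
          z (P \<eta>) \<bullet> (cof (grad X y e (\<sigma> \<eta>)) *v unit_normal P \<eta>) * norm (tangent_cross P \<eta>)))"

text \<open>Trace coordinates are the components at the boundary nodes off the face \<open>t\<^sub>1 = 0\<close>, on
  which variations vanish.\<close>
definition trace_index :: "((real^3) \<times> 3) set" where
  "trace_index = {t. (\<exists>i\<le>4. \<exists>j\<le>4. \<exists>k\<le>4. t = node i j k) \<and>
                     t \<in> frontier (cbox 0 1) \<and> t $ 1 \<noteq> 0} \<times> UNIV"

definition R_trace :: "(real^3 \<Rightarrow> real^3) \<Rightarrow> (real^3 \<Rightarrow> real^3) \<Rightarrow> (real^3) \<times> 3 \<Rightarrow> real" where
  "R_trace a u m = u (ref_map a (fst m)) $ snd m"

definition trace_form ::
  "(real^3 \<Rightarrow> real^3) \<Rightarrow> ((real^3) \<times> 3 \<Rightarrow> (real^3) \<times> 3 \<Rightarrow> real) \<Rightarrow>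
   (real^3 \<Rightarrow> real^3) \<Rightarrow> (real^3 \<Rightarrow> real^3) \<Rightarrow> real" where
  "trace_form a B u v =
     (\<Sum>m\<in>trace_index. \<Sum>n\<in>trace_index. R_trace a u m * B m n * R_trace a v n)"

definition boundary_matrix ::
  "(real^3 \<Rightarrow> real^3) \<Rightarrow> (cell \<Rightarrow> real^3 \<Rightarrow> real^3) \<Rightarrow> (real^3 \<Rightarrow> real^3) \<Rightarrow>
   ((real^3) \<times> 3 \<Rightarrow> (real^3) \<times> 3 \<Rightarrow> real) \<Rightarrow> bool" where
  "boundary_matrix a \<tau> z B \<longleftrightarrow>
     (\<forall>m\<in>trace_index. \<forall>n\<in>trace_index. B m n = B n m) \<and>
     (\<forall>y\<in>fe_space a \<tau>. \<forall>u\<in>Vh a \<tau>. \<forall>v\<in>Vh a \<tau>.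
        hessian (boundary_functional \<tau> (cell_map a \<tau>) z) y u v = trace_form a B u v)"

end

theory Submission
  imports Defs
begin

text \<open>
  Let \<open>F\<close> be the shear and let \<open>H = K F\<close> be the physical gradient of a variation at a quadrature point.
  The second variation of \<open>det J\<^sub>X W\<close> there, plus that of the coupling, is \<open>det J\<^sub>X\<close> times a quadratic form in
  \<open>K\<close> that involves the mesh only through \<open>8 P : cof H\<close>, where \<open>P = J\<^sub>\<tau> J\<^sub>X\<^sup>-\<^sup>1\<close>; the bulk terms only add squares,
  because \<open>det F = 1\<close> makes the volume residuals vanish. Since \<open>3 |cof H|\<^sup>2 \<le> |H|\<^sup>4\<close>, replacing \<open>P\<close> by a nearby
  matrix \<open>C\<close> changes the form by at most \<open>(8/\<surd>3) |P - C| |H|\<^sup>2\<close>. Four rational centres \<open>C\<close> suffice for all \<open>192\<close>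
  quadrature points, which is a finite check in \<open>\<int>[\<surd>5]\<close>. For a fixed centre the form depends on \<open>s\<close> quadratically,
  so that its Bernstein coefficients on \<open>[-1/4, 1/4]\<close>, three quadratic forms in \<open>K\<close>, can be written as sums of squares.

  The coupling is a null Lagrangian: the quadrature is exact for it, on each cell it is a sum of face terms that
  depend on nodal values only, and the terms of interior faces cancel in pairs. The remaining boundary terms are
  the boundary functional, and their polarization is the matrix in trace coordinates.
\<close>

text \<open>The obstacle is the distortion. For the centre \<open>mat 1\<close> the sums of squares
  reach the radius \<open>1151/500\<close>, which is Frobenius distance (sqrt 3 / 8) * 2.302 <
  0.499, and a last pivot of about 0.005 leaves almost no room for more. Since some quadrature point
  has spectral distance above 1/2, and hence Frobenius distance above 1/2, no ball around the
  identity obtained in this way can contain it; other centres are unavoidable for this argument.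
  Writing the variation as \<open>K ** F\<close> turns the varied gradient into
  \<open>(mat 1 + r *\<^sub>R K) ** F\<close>, so that its determinant involves \<open>K\<close>
  only through its invariants and the shear enters as a fixed right factor. A chart is specified
  only by its image, which leaves the order of the corners open. Gradients are therefore evaluated
  on differences of mesh vertices, and face terms are indexed by the opposite vertex. The boundary
  functional involves inverse gradients on whole faces and not only at quadrature points.
  Invertibility there comes from a separate bound at the vertices, because the gradient is affine on
  a cell.\<close>

section \<open>Identities for 3 by 3 matrices\<close>

lemma three_arith [simp]: "(4::3) = 1" "(5::3) = 2"
  by simp_all

lemma mat3_eq_iff: "A = B \<longleftrightarrow> (\<forall>i\<in>{1,2,3}. \<forall>j\<in>{1,2,3}. A$i$j = B$i$j)" for A B :: "'a^3^3"
  by (simp add: vec_eq_iff forall_3)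

lemma frob_expand: "frob A B = A$1$1 * B$1$1 + A$1$2 * B$1$2 + A$1$3 * B$1$3 + A$2$1 * B$2$1 + A$2$2 * B$2$2
    + A$2$3 * B$2$3 + A$3$1 * B$3$1 + A$3$2 * B$3$2 + A$3$3 * B$3$3"
  by (simp add: frob_def trace_def matrix_matrix_mult_def transpose_def sum_3)

lemma cof_nth:
  "cof A $ 1 $ 1 = A$2$2 * A$3$3 - A$2$3 * A$3$2"
  "cof A $ 1 $ 2 = A$2$3 * A$3$1 - A$2$1 * A$3$3"
  "cof A $ 1 $ 3 = A$2$1 * A$3$2 - A$2$2 * A$3$1"
  "cof A $ 2 $ 1 = A$3$2 * A$1$3 - A$3$3 * A$1$2"
  "cof A $ 2 $ 2 = A$3$3 * A$1$1 - A$3$1 * A$1$3"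
  "cof A $ 2 $ 3 = A$3$1 * A$1$2 - A$3$2 * A$1$1"
  "cof A $ 3 $ 1 = A$1$2 * A$2$3 - A$1$3 * A$2$2"
  "cof A $ 3 $ 2 = A$1$3 * A$2$1 - A$1$1 * A$2$3"
  "cof A $ 3 $ 3 = A$1$1 * A$2$2 - A$1$2 * A$2$1"
  by (simp_all add: cof_def)

lemma mult_nth: "(A ** B) $ i $ j = A$i$1 * B$1$j + A$i$2 * B$2$j + A$i$3 * B$3$j"
  for A :: "real^3^'n" and B :: "real^'m^3"
  by (simp add: matrix_matrix_mult_def sum_3)

lemma trace_3: "trace A = A$1$1 + A$2$2 + A$3$3" for A :: "real^3^3"
  by (simp add: trace_def sum_3)

lemma cof_mult: "cof (A ** B) = cof A ** cof B"
  by (simp add: mat3_eq_iff cof_nth mult_nth) algebra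

lemma cof_transpose_mult: "A ** transpose (cof A) = det A *\<^sub>R mat 1"
  by (simp add: mat3_eq_iff cof_nth mult_nth transpose_def mat_def det_3) algebra

lemma matrix_add_rdistrib: "(A + B) ** C = A ** C + B ** C" for A B :: "real^'n^'m" and C :: "real^'k^'n"
  by (simp add: vec_eq_iff matrix_matrix_mult_def distrib_right sum.distrib)

lemma scaleR_matrix_mult_left: "(k *\<^sub>R A) ** B = k *\<^sub>R (A ** B)" for A :: "real^'n^'m" and B :: "real^'k^'n"
  by (simp add: vec_eq_iff matrix_matrix_mult_def sum_distrib_left mult.assoc)

lemma scaleR_matrix_mult_right: "A ** (k *\<^sub>R B) = k *\<^sub>R (A ** B)" for A :: "real^'n^'m" and B :: "real^'k^'n"
  by (simp add: vec_eq_iff matrix_matrix_mult_def sum_distrib_left mult_ac)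

lemma matrix_inv_mult:
  fixes A :: "real^'n^'n"
  assumes "det A \<noteq> 0"
  shows "matrix_inv A ** A = mat 1" "A ** matrix_inv A = mat 1"
proof -
  have "\<exists>B. A ** B = mat 1 \<and> B ** A = mat 1"
    using assms by (simp add: invertible_det_nz[symmetric] invertible_def)
  then have "A ** matrix_inv A = mat 1 \<and> matrix_inv A ** A = mat 1"
    unfolding matrix_inv_def by (rule someI_ex)
  then show "matrix_inv A ** A = mat 1" "A ** matrix_inv A = mat 1" by simp_all
qed

subsection \<open>The stability form\<close>


definition shear_matrix :: "real \<Rightarrow> real^3^3" where
  "shear_matrix s = mat 1 + s *\<^sub>R (\<chi> i j. if i = 1 \<and> j = 2 then 1 else 0)"

lemma shear_matrix_nth:
  "shear_matrix s $ 1 $ 1 = 1" "shear_matrix s $ 1 $ 2 = s" "shear_matrix s $ 1 $ 3 = 0"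
  "shear_matrix s $ 2 $ 1 = 0" "shear_matrix s $ 2 $ 2 = 1" "shear_matrix s $ 2 $ 3 = 0"
  "shear_matrix s $ 3 $ 1 = 0" "shear_matrix s $ 3 $ 2 = 0" "shear_matrix s $ 3 $ 3 = 1"
  by (simp_all add: shear_matrix_def mat_def)

lemma mat_1_nth:
  "(mat 1 :: real^3^3) $ 1 $ 1 = 1" "(mat 1 :: real^3^3) $ 1 $ 2 = 0" "(mat 1 :: real^3^3) $ 1 $ 3 = 0"
  "(mat 1 :: real^3^3) $ 2 $ 1 = 0" "(mat 1 :: real^3^3) $ 2 $ 2 = 1" "(mat 1 :: real^3^3) $ 2 $ 3 = 0"
  "(mat 1 :: real^3^3) $ 3 $ 1 = 0" "(mat 1 :: real^3^3) $ 3 $ 2 = 0" "(mat 1 :: real^3^3) $ 3 $ 3 = 1"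
  by (simp_all add: mat_def)

lemma transpose_nth: "transpose A $ i $ j = A $ j $ i"
  by (simp add: transpose_def)

text \<open>Second derivative at r = 0 of \<open>W ((mat 1 + r *\<^sub>R K) ** F)\<close> when det F
  = 1. A factor det powr t contributes t (t - 1) (trace K)^2 + 2 t trace (cof K); t = -2/3 and t =
  -4/3 give 10/9, -4/3 and 28/9, -8/3. \<open>C\<close>, \<open>C1\<close>, \<open>C2\<close> are
  the coefficients of the varied cofactor matrix in r.\<close>

definition W_variation :: "real^3^3 \<Rightarrow> real^3^3 \<Rightarrow> real" where
  "W_variation F K =
     (let C = cof F; C1 = (trace K *\<^sub>R mat 1 - transpose K) ** C; C2 = cof K ** C in
        (10/9 * (trace K)\<^sup>2 - 4/3 * trace (cof K)) * frob F F - 8/3 * trace K * frob F (K ** F) +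
        2 * frob (K ** F) (K ** F) +
        (28/9 * (trace K)\<^sup>2 - 8/3 * trace (cof K)) * frob C C - 16/3 * trace K * frob C C1 +
        2 * (frob C1 C1 + 2 * frob C C2))"

definition W_coeff0 :: "real^3^3 \<Rightarrow> real" where
  "W_coeff0 K = 16/3 * (K$1$1)\<^sup>2 - 16/3 * K$1$1 * K$2$2 - 16/3 * K$1$1 * K$3$3 + 4 * (K$1$2)\<^sup>2 + 8 *
  K$1$2 * K$2$1 + 4 * (K$1$3)\<^sup>2 + 8 * K$1$3 * K$3$1 + 4 * (K$2$1)\<^sup>2 + 16/3 *
  (K$2$2)\<^sup>2 - 16/3 * K$2$2 * K$3$3 + 4 * (K$2$3)\<^sup>2 + 8 * K$2$3 * K$3$2 + 4 *
  (K$3$1)\<^sup>2 + 4 * (K$3$2)\<^sup>2 + 16/3 * (K$3$3)\<^sup>2"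

definition W_coeff1 :: "real^3^3 \<Rightarrow> real" where
  "W_coeff1 K = - 8 * K$1$1 * K$2$1 - 8 * K$1$2 * K$2$2 - 4 * K$1$3 * K$2$3 - 4 * K$1$3 * K$3$2 - 4 * K$2$3 *
  K$3$1 + 4 * K$3$1 * K$3$2"

definition W_coeff2 :: "real^3^3 \<Rightarrow> real" where
  "W_coeff2 K = 2/9 * (K$1$1)\<^sup>2 - 32/9 * K$1$1 * K$2$2 - 8/9 * K$1$1 * K$3$3 + 4 * K$1$2 * K$2$1 + 4 *
  (K$2$1)\<^sup>2 + 38/9 * (K$2$2)\<^sup>2 - 8/9 * K$2$2 * K$3$3 + 2 * (K$2$3)\<^sup>2 + 4 * K$2$3 *
  K$3$2 + 2 * (K$3$1)\<^sup>2 + 8/9 * (K$3$3)\<^sup>2"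

lemma W_variation_shear: "W_variation (shear_matrix s) K = W_coeff0 K + s * W_coeff1 K + s\<^sup>2 * W_coeff2 K"
  by (simp add: W_variation_def W_coeff0_def W_coeff1_def W_coeff2_def Let_def frob_expand cof_nth mult_nth trace_3
      shear_matrix_nth transpose_nth mat_1_nth) algebra

text \<open>Density, relative to det J_X, of \<open>G_form\<close> minus 1/16 of
  \<open>A_form\<close> without the bulk terms. The term \<open>R * frob H H\<close> is a reserve
  that pays for the distance between \<open>P\<close> and a centre. The factor 8 is 2 from
  differentiating the quadratic \<open>cof\<close> twice, times 4 from z = 4t.\<close>

definition stability_form :: "real^3^3 \<Rightarrow> real \<Rightarrow> real \<Rightarrow> real^3^3 \<Rightarrow> real" where
  "stability_form P R s K =
     (let H = K ** shear_matrix s in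
        W_variation (shear_matrix s) K + 8 * frob P (cof H) - 1/16 * (2 * frob H H + 2/3 * (trace H)\<^sup>2) - R * frob H H)"

lemma stability_form_eq:
  "stability_form P R s K =
     W_coeff0 K + s * W_coeff1 K + s\<^sup>2 * W_coeff2 K +
     8 * (frob P (cof K) - s * (P$1$1 * cof K $ 1 $ 2 + P$2$1 * cof K $ 2 $ 2 + P$3$1 * cof K $ 3 $ 2)) -
     1/24 * (trace K + s * K$2$1)\<^sup>2 -
     (1/8 + R) * (frob K K + 2 * s * (K$1$1 * K$1$2 + K$2$1 * K$2$2 + K$3$1 * K$3$2) +
       s\<^sup>2 * ((K$1$1)\<^sup>2 + (K$2$1)\<^sup>2 + (K$3$1)\<^sup>2))"
proof -
  have "frob P (cof (K ** shear_matrix s)) =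
      frob P (cof K) - s * (P$1$1 * cof K $ 1 $ 2 + P$2$1 * cof K $ 2 $ 2 + P$3$1 * cof K $ 3 $ 2)"
    unfolding cof_mult by (simp add: frob_expand mult_nth cof_nth[of "shear_matrix s"] shear_matrix_nth) algebra
  moreover have "trace (K ** shear_matrix s) = trace K + s * K$2$1"
    by (simp add: trace_3 mult_nth shear_matrix_nth)
  moreover have "frob (K ** shear_matrix s) (K ** shear_matrix s) =
      frob K K + 2 * s * (K$1$1 * K$1$2 + K$2$1 * K$2$2 + K$3$1 * K$3$2) +
       s\<^sup>2 * ((K$1$1)\<^sup>2 + (K$2$1)\<^sup>2 + (K$3$1)\<^sup>2)"
    by (simp add: frob_expand mult_nth shear_matrix_nth) algebra
  ultimately show ?thesis
    unfolding stability_form_def Let_def W_variation_shear by (simp add: algebra_simps)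
qed

lemmas stability_form_expand = stability_form_eq W_coeff0_def W_coeff1_def W_coeff2_def frob_expand cof_nth trace_3

text \<open>A quadratic f on [-1/4, 1/4] has the Bernstein coefficients f(-1/4), f(1/4) and 2 f(0) -
  (f(-1/4) + f(1/4)) / 2. The weights are nonnegative on the interval, so that three forms in
  \<open>K\<close> settle all \<open>s\<close>.\<close>

lemma stability_form_bernstein:
  "stability_form P R s K =
     4 * (1/4 - s)\<^sup>2 * stability_form P R (- 1/4) K + 4 * (1/4 + s)\<^sup>2 * stability_form P R (1/4) K +
     8 * (1/4 - s) * (1/4 + s) *
       (2 * stability_form P R 0 K - 1/2 * stability_form P R (- 1/4) K - 1/2 * stability_form P R (1/4) K)"
proof -
  obtain c0 c1 c2 where "stability_form P R s K = c0 + s * c1 + s\<^sup>2 * c2" for s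
  proof
    show "stability_form P R s K =
        (W_coeff0 K + 8 * frob P (cof K) - 1/24 * (trace K)\<^sup>2 - (1/8 + R) * frob K K) +
        s * (W_coeff1 K - 8 * (P$1$1 * cof K $ 1 $ 2 + P$2$1 * cof K $ 2 $ 2 + P$3$1 * cof K $ 3 $ 2) -
          1/12 * trace K * K$2$1 - (1/8 + R) * 2 * (K$1$1 * K$1$2 + K$2$1 * K$2$2 + K$3$1 * K$3$2)) +
        s\<^sup>2 * (W_coeff2 K - 1/24 * (K$2$1)\<^sup>2 -
          (1/8 + R) * ((K$1$1)\<^sup>2 + (K$2$1)\<^sup>2 + (K$3$1)\<^sup>2))" for s
      unfolding stability_form_eq by algebra
  qed
  note this [simp]
  show ?thesis
    by (simp add: power2_eq_square field_simps)
qed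

section \<open>Rational centres and their sums of squares\<close>

definition centre0 :: "real^3^3" where "centre0 = mat 1"
text \<open>Approximates \<open>P\<close> at the quadrature point examined in
  \<open>delta_lower_bound\<close>, which lies outside the balls of the other three centres. Its
  radius 3/50 is a Frobenius distance of only 0.013, hence entries in hundredths.\<close>

definition centre1 :: "real^3^3" where
  "centre1 = vector [vector [61/50, -27/100, -9/100], vector [-3/10, 137/100, 3/20], vector [1/100, 7/100, 103/100]]"
definition centre2 :: "real^3^3" where
  "centre2 = vector [vector [6/5, -1/10, -1/5], vector [-1/5, 11/10, 0], vector [0, 0, 1]]"
definition centre3 :: "real^3^3" where
  "centre3 = vector [vector [1, 0, 0], vector [0, 1, -1/5], vector [0, -1/5, 1]]"

lemmas square_simps = algebra_simps power2_eq_square add_divide_distrib diff_divide_distrib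

text \<open>The Bernstein coefficients in \<open>s\<close> on \<open>[-1/4, 1/4]\<close>; the squares come from exact \<open>L D L\<^sup>T\<close> factorizations.\<close>
lemma centre0_minus:
  "stability_form centre0 (1151/500) (- 1/4) K =
      24741/16000 * (K$3$1 + 1708/24741 * K$3$2 + 8000/8247 * K$2$3)\<^sup>2 +
      1573/1000 * (K$1$3 + 500/1573 * K$3$2 + 500/1573 * K$2$3)\<^sup>2 +
      1573/1000 * (K$1$2 + 2427/6292 * K$1$1 + 1000/1573 * K$2$2 + 125/1573 * K$2$1)\<^sup>2 +
      35290961/14157000 * (K$1$1 + 11252375/35290961 * K$2$2 + 17892875/35290961 * K$3$3 +
        13621875/35290961 * K$2$1)\<^sup>2 +
      6843165034/4864699125 * (K$3$2 - 5350576875/54745320272 * K$2$3)\<^sup>2 +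
      9878823066/4411370125 * (K$2$2 + 2556125/6649048 * K$3$3 + 19196539/186173344 * K$2$1)\<^sup>2 +
      925384411/474932000 * (K$3$3 - 20827444875/25910763508 * K$2$1)\<^sup>2 +
      10090956393181/2176504134672000 * (K$2$1)\<^sup>2 +
      3862625431231/54745320272000 * (K$2$3)\<^sup>2"
  by (simp add: stability_form_expand centre0_def mat_1_nth, simp add: square_simps)

lemma centre0_middle:
  "2 * stability_form centre0 (1151/500) 0 K - 1/2 * stability_form centre0 (1151/500) (- 1/4) K -
    1/2 * stability_form centre0 (1151/500) (1/4) K =
      7091/4800 * (K$2$1 - 600/7091 * K$1$2)\<^sup>2 +
      12641/4500 * (K$3$3 + 11875/25282 * K$1$1 + 11875/25282 * K$2$2)\<^sup>2 +
      96383879/40451200 * (K$1$1 + 31674600/96383879 * K$2$2)\<^sup>2 +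
      332274697459/192767758000 * (K$2$2)\<^sup>2 +
      5119/3200 * (K$3$1)\<^sup>2 +
      181/125 * (K$2$3 - 125/1448 * K$3$2)\<^sup>2 +
      1573/1000 * (K$1$3)\<^sup>2 +
      11079143/7091000 * (K$1$2)\<^sup>2 +
      2262079/1448000 * (K$3$2)\<^sup>2"
  by (simp add: stability_form_expand centre0_def mat_1_nth, simp add: square_simps)

lemma centre0_plus:
  "stability_form centre0 (1151/500) (1/4) K =
      24741/16000 * (K$3$1 - 8000/8247 * K$2$3 - 1708/24741 * K$3$2)\<^sup>2 +
      333901/1374500 * (K$2$3 - 687250/333901 * K$1$3 + 176875/2003406 * K$3$2)\<^sup>2 +
      181601273/333901000 * (K$1$3 - 65233250/77829117 * K$3$2)\<^sup>2 +
      1573/1000 * (K$1$2 - 2427/6292 * K$1$1 - 1000/1573 * K$2$2 + 125/1573 * K$2$1)\<^sup>2 +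
      13141/4500 * (K$3$3 + 11375/26282 * K$1$1 + 11375/26282 * K$2$2 + 35625/105128 * K$2$1)\<^sup>2 +
      80442842653/41341586000 * (K$1$1 + 10244829625/80442842653 * K$2$2 - 229941571875/321771370612 *
        K$2$1)\<^sup>2 +
      38496916882011/20110710663250 * (K$2$2 - 74749364611/181375344556 * K$2$1)\<^sup>2 +
      551803633033/466974702000 * (K$3$2)\<^sup>2 +
      10090956393181/2176504134672000 * (K$2$1)\<^sup>2"
  by (simp add: stability_form_expand centre0_def mat_1_nth, simp add: square_simps)

lemma centre1_minus:
  "stability_form centre1 (3/50) (- 1/4) K =
      763/200 * (K$1$2 + 240/763 * K$3$3 + 8/763 * K$2$3 + 1/763 * K$2$1 + 37/3052 * K$1$1 + 120/763 *
        K$3$1 + 200/763 * K$2$2)\<^sup>2 +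
      1642849/343350 * (K$3$3 - 4320/1642849 * K$2$3 - 720519/26285584 * K$2$1 + 3336457/6571396 * K$1$1
        - 64800/1642849 * K$3$1 + 2512417/6571396 * K$2$2)\<^sup>2 +
      763/200 * (K$1$3 - 20/109 * K$3$2 + 100/763 * K$2$3 + 58/763 * K$2$1 - 236/763 * K$3$1 - 8/763 *
        K$2$2)\<^sup>2 +
      80367/21800 * (K$3$2 - 14459/80367 * K$2$3 - 6688/80367 * K$2$1 - 4360/26789 * K$1$1 - 58447/321468
        * K$3$1 - 160/80367 * K$2$2)\<^sup>2 +
      99146945977439/26406169116600 * (K$2$3 - 2471623802360/99146945977439 * K$2$1 -
        10352382206928/99146945977439 * K$1$1 + 70480902104503/396587783909756 * K$3$1 -
        46277463200/99146945977439 * K$2$2)\<^sup>2 +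
      4261258401307368703/1066027963149424128 * (K$2$1 + 5422047414960975852/21306292006536843515 * K$1$1
        + 1188493734019759488/106531460032684217575 * K$3$1 + 261386715058521972/9684678184789474325 *
        K$2$2)\<^sup>2 +
      2963740034728522089653/852251680261473740600 * (K$1$1 +
        161012912890772779884/14818700173642610448265 * K$3$1 +
        1409619867591812515881/14818700173642610448265 * K$2$2)\<^sup>2 +
      763528368000919882151315299/237099202778281767172240000 * (K$3$1 +
        60860741138803348527214016/763528368000919882151315299 * K$2$2)\<^sup>2 +
      83105347301092739924291649677/19088209200022997053782882475 * (K$2$2)\<^sup>2"
  by (simp add: stability_form_expand centre1_def, simp add: square_simps)

lemma centre1_middle:
  "2 * stability_form centre1 (3/50) 0 K - 1/2 * stability_form centre1 (3/50) (- 1/4) K -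
    1/2 * stability_form centre1 (3/50) (1/4) K =
      369/100 * (K$2$3 - 67/246 * K$3$2 + 4/369 * K$1$2 - 28/369 * K$1$1 - 12/41 * K$3$1)\<^sup>2 +
      2273/450 * (K$3$3 + 540/2273 * K$1$2 + 5039/9092 * K$1$1 + 3959/9092 * K$2$2 + 486/2273 *
        K$2$1)\<^sup>2 +
      763/200 * (K$1$3 - 240/763 * K$3$2 - 296/763 * K$3$1 - 8/763 * K$2$2 + 8/109 * K$2$1)\<^sup>2 +
      39589551/12513200 * (K$3$2 + 408968/118768653 * K$1$2 - 25386536/118768653 * K$1$1 -
        3168664/13196517 * K$3$1 - 52480/13196517 * K$2$2 - 1134224/13196517 * K$2$1)\<^sup>2 +
      571687505999773/161976688961400 * (K$1$2 - 106856722598044/571687505999773 * K$1$1 +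
        99506036182536/571687505999773 * K$3$1 - 84629899931580/571687505999773 * K$2$2 -
        81092148637239/571687505999773 * K$2$1)\<^sup>2 +
      5970646373352360333/1829400019199273600 * (K$1$1 - 78971887344138752/1990215457784120111 * K$3$1 +
        372182555896112476/5970646373352360333 * K$2$2 - 1372529592266577376/5970646373352360333 *
        K$2$1)\<^sup>2 +
      16028944465369003581867/6368689464909184355200 * (K$3$1 +
        935083719527247905920/5342981488456334527289 * K$2$2 +
        213775672653543400576/5342981488456334527289 * K$2$1)\<^sup>2 +
      47669713139323570768185197/12823155572295202865493600 * (K$2$2 -
        6583237069515697663555496/47669713139323570768185197 * K$2$1)\<^sup>2 +
      170805101639113137477131257393/57203655767188284921822236400 * (K$2$1)\<^sup>2"
  by (simp add: stability_form_expand centre1_def, simp add: square_simps)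

lemma centre1_plus:
  "stability_form centre1 (3/50) (1/4) K =
      2323/450 * (K$3$3 + 540/2323 * K$1$2 + 5479/9292 * K$1$1 + 16485/37168 * K$2$1 + 3859/9292 *
        K$2$2)\<^sup>2 +
      1642849/464600 * (K$1$2 - 1400911/6571396 * K$1$1 + 18584/1642849 * K$2$3 + 278760/1642849 * K$3$1
        - 244952/1642849 * K$2$1 - 696140/1642849 * K$2$2)\<^sup>2 +
      763/200 * (K$1$3 - 340/763 * K$3$2 - 100/763 * K$2$3 - 356/763 * K$3$1 + 54/763 * K$2$1 - 8/763 *
        K$2$2)\<^sup>2 +
      466569/152600 * (K$3$2 - 30520/155523 * K$1$1 - 149213/466569 * K$2$3 - 207191/1866276 * K$3$1 -
        4064/51841 * K$2$1 - 2720/466569 * K$2$2)\<^sup>2 +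
      206834737955041/68133548007200 * (K$1$1 - 92666691288128/620504213865123 * K$2$3 +
        737030864000/36500247874419 * K$3$1 - 686757752591221/827338951820164 * K$2$1 -
        58562012590469/620504213865123 * K$2$2)\<^sup>2 +
      1300676471318049433/372302528319073800 * (K$2$3 - 4675340569702342721/5202705885272197732 * K$3$1 -
        153249589731692436/1300676471318049433 * K$2$1 - 13693421971086512/1300676471318049433 *
        K$2$2)\<^sup>2 +
      565840661214629124279/4162164708217758185600 * (K$3$1 - 541878409257016735568/565840661214629124279
        * K$2$1 + 2357178668910775981376/565840661214629124279 * K$2$2)\<^sup>2 +
      1184081132950881239700257/1810690115886813197692800 * (K$2$1 -
        1682708683465211081088032/1184081132950881239700257 * K$2$2)\<^sup>2 +
      12204051980019438107908877/88806084971316092977519275 * (K$2$2)\<^sup>2"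
  by (simp add: stability_form_expand centre1_def, simp add: square_simps)

lemma centre2_minus:
  "stability_form centre2 (11/10) (- 1/4) K =
      29/10 * (K$2$3 - 27/116 * K$3$2 + 5/29 * K$1$3 + 13/29 * K$3$1)\<^sup>2 +
      111/40 * (K$1$2 + 32/111 * K$3$3 + 40/111 * K$2$2 + 49/444 * K$1$1 + 5/111 * K$2$1)\<^sup>2 +
      12147/4640 * (K$3$2 - 284/4049 * K$1$3 + 505/12147 * K$3$1 - 3712/12147 * K$2$1)\<^sup>2 +
      433391/161960 * (K$1$3 - 67457/433391 * K$3$1 - 9088/433391 * K$2$1)\<^sup>2 +
      12959/3330 * (K$3$3 + 23651/51836 * K$2$2 + 18323/51836 * K$1$1 - 43989/207344 * K$2$1)\<^sup>2 +
      19656517/6220320 * (K$2$2 + 2752837/19656517 * K$1$1 + 4976256/19656517 * K$3$1 + 16131121/78626068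
        * K$2$1)\<^sup>2 +
      336319961/98282585 * (K$1$1 - 11011348/336319961 * K$3$1 + 470838813/1345279844 * K$2$1)\<^sup>2 +
      109990402887056131/55971088979616384 * (K$3$1 - 28095315368986112/549952014435280655 *
        K$2$1)\<^sup>2 +
      2071775485751951594831/1055907867715738857600 * (K$2$1)\<^sup>2"
  by (simp add: stability_form_expand centre2_def, simp add: square_simps)

lemma centre2_middle:
  "2 * stability_form centre2 (11/10) 0 K - 1/2 * stability_form centre2 (11/10) (- 1/4) K -
    1/2 * stability_form centre2 (11/10) (1/4) K =
      125/48 * (K$2$1 - 6/125 * K$1$2 - 192/625 * K$3$2 + 96/625 * K$3$3)\<^sup>2 +
      4757/1152 * (K$1$1 + 1616/4757 * K$2$2 + 9904/23785 * K$3$3)\<^sup>2 +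
      111/40 * (K$1$3 - 32/111 * K$3$2 - 16/111 * K$3$1)\<^sup>2 +
      2769/1000 * (K$1$2 - 64/4615 * K$3$2 + 4096/13845 * K$3$3)\<^sup>2 +
      53/20 * (K$2$3 - 37/106 * K$3$2 - 8/53 * K$3$1)\<^sup>2 +
      632917/190280 * (K$2$2 + 152224/632917 * K$3$1 + 292143/632917 * K$3$3)\<^sup>2 +
      21450701977/10860018000 * (K$3$2 - 2768630800/21450701977 * K$3$1 + 1457854464/21450701977 *
        K$3$3)\<^sup>2 +
      20707666691877632861/8688968923633221760 * (K$3$1 - 3057988138629475840/20707666691877632861 *
        K$3$3)\<^sup>2 +
      27602054811338057993329/12424600015126579716600 * (K$3$3)\<^sup>2"
  by (simp add: stability_form_expand centre2_def, simp add: square_simps)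

lemma centre2_plus:
  "stability_form centre2 (11/10) (1/4) K =
      111/40 * (K$1$3 - 20/111 * K$2$3 - 52/111 * K$3$2 - 8/37 * K$3$1)\<^sup>2 +
      3119/1110 * (K$2$3 - 4037/12476 * K$3$2 - 2451/3119 * K$3$1)\<^sup>2 +
      371/90 * (K$3$3 + 671/1484 * K$1$1 + 72/371 * K$1$2 + 743/1484 * K$2$2 + 327/848 * K$2$1)\<^sup>2 +
      750601/237440 * (K$1$1 - 158604/750601 * K$1$2 + 58732/750601 * K$2$2 - 410571/750601 *
        K$2$1)\<^sup>2 +
      934093/499040 * (K$3$2 - 400147/934093 * K$3$1 - 399232/934093 * K$2$1)\<^sup>2 +
      367672871/597819520 * (K$3$1 + 478255616/367672871 * K$2$2 - 204875264/367672871 * K$2$1)\<^sup>2 +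
      18604389/7506010 * (K$1$2 - 13493527/24805852 * K$2$2 - 65916703/297670224 * K$2$1)\<^sup>2 +
      3428922266528257/2280109705610273 * (K$2$2 - 9462634006777166/17144611332641285 * K$2$1)\<^sup>2 +
      3011990870938221719/10972551252890422400 * (K$2$1)\<^sup>2"
  by (simp add: stability_form_expand centre2_def, simp add: square_simps)

lemma centre3_minus:
  "stability_form centre3 2 (- 1/4) K =
      239/128 * (K$3$1 + 4/239 * K$3$2 + 192/239 * K$2$3 - 512/1195 * K$1$2)\<^sup>2 +
      448/239 * (K$3$2 + 191/3584 * K$2$3 + 239/896 * K$1$3 + 1/140 * K$1$2 + 239/560 * K$1$1)\<^sup>2 +
      22641/28672 * (K$2$3 + 4524/7547 * K$1$3 + 92032/113205 * K$1$2 + 36192/37735 * K$1$1)\<^sup>2 +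
      247/72 * (K$2$2 + 7/19 * K$3$3 + 72/247 * K$1$2 + 3/19 * K$2$1 + 85/247 * K$1$1)\<^sup>2 +
      88021/60376 * (K$1$3 - 117248/440105 * K$1$2 - 241504/440105 * K$2$1 - 201472/440105 *
        K$1$1)\<^sup>2 +
      419/152 * (K$3$3 - 56/419 * K$1$2 - 723/1676 * K$2$1 + 126/419 * K$1$1)\<^sup>2 +
      162832074367/287670232200 * (K$1$2 - 116492951601/162832074367 * K$2$1 - 576855807615/651328297468
        * K$1$1)\<^sup>2 +
      1035416070688319/1563187913923200 * (K$2$1 + 713957412740736/1035416070688319 * K$1$1)\<^sup>2 +
      6728298834363548/25885401767207975 * (K$1$1)\<^sup>2"
  by (simp add: stability_form_expand centre3_def, simp add: square_simps)

lemma centre3_middle: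
  "2 * stability_form centre3 2 0 K - 1/2 * stability_form centre3 2 (- 1/4) K -
    1/2 * stability_form centre3 2 (1/4) K =
      241/128 * (K$3$1 - 512/1205 * K$1$2)\<^sup>2 +
      7/4 * (K$2$3 - 1/14 * K$3$2 + 16/35 * K$1$1)\<^sup>2 +
      209/72 * (K$2$2 + 5/11 * K$3$3 + 101/209 * K$1$1)\<^sup>2 +
      221/88 * (K$3$3 + 60/221 * K$1$1)\<^sup>2 +
      209/112 * (K$3$2 + 96/209 * K$1$1)\<^sup>2 +
      15/8 * (K$1$3 - 32/75 * K$2$1)\<^sup>2 +
      17029/12000 * (K$2$1 - 1500/17029 * K$1$2)\<^sup>2 +
      12938039/7779200 * (K$1$1)\<^sup>2 +
      1250955239/820797800 * (K$1$2)\<^sup>2"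
  by (simp add: stability_form_expand centre3_def, simp add: square_simps)

lemma centre3_plus:
  "stability_form centre3 2 (1/4) K =
      247/72 * (K$2$2 - 72/247 * K$1$2 + 7/19 * K$3$3 + 85/247 * K$1$1 - 3/19 * K$2$1)\<^sup>2 +
      15/8 * (K$3$2 - 4/15 * K$1$3 + 1/15 * K$2$3 + 32/75 * K$1$1 - 1/60 * K$3$1)\<^sup>2 +
      3129/1976 * (K$1$2 + 104/447 * K$3$3 - 493/4172 * K$1$1 - 7904/15645 * K$3$1 - 65/3129 *
        K$2$1)\<^sup>2 +
      209/120 * (K$1$3 - 56/209 * K$2$3 + 128/1045 * K$1$1 - 1/209 * K$3$1 - 96/209 * K$2$1)\<^sup>2 +
      9551/3576 * (K$3$3 + 3120/9551 * K$1$1 + 3328/47755 * K$3$1 + 17119/38204 * K$2$1)\<^sup>2 +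
      3121/1672 * (K$2$3 + 1344/3121 * K$1$1 - 10033/12484 * K$3$1 - 1792/15605 * K$2$1)\<^sup>2 +
      1690921588/1043303485 * (K$1$1 + 263448609/845460794 * K$3$1 - 5365486489/8454607940 *
        K$2$1)\<^sup>2 +
      117006984347/1352737270400 * (K$3$1 + 60037536832/117006984347 * K$2$1)\<^sup>2 +
      1682074708590887/5616335248656000 * (K$2$1)\<^sup>2"
  by (simp add: stability_form_expand centre3_def, simp add: square_simps)

lemma stability_form_nonneg:
  assumes "\<bar>s\<bar> \<le> 1/4" "0 \<le> stability_form P R (- 1/4) K" "0 \<le> stability_form P R (1/4) K"
    "0 \<le> 2 * stability_form P R 0 K - 1/2 * stability_form P R (- 1/4) K - 1/2 * stability_form P R (1/4) K"
  shows "0 \<le> stability_form P R s K"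
proof -
  have s: "0 \<le> 1/4 - s" "0 \<le> 1/4 + s" using assms(1) by auto
  then have "0 \<le> 8 * (1/4 - s) * (1/4 + s)" by simp
  from mult_nonneg_nonneg[OF this assms(4)] mult_nonneg_nonneg[OF _ assms(2), of "4 * (1/4 - s)\<^sup>2"]
    mult_nonneg_nonneg[OF _ assms(3), of "4 * (1/4 + s)\<^sup>2"]
  show ?thesis
    unfolding stability_form_bernstein[of P R s K] by simp
qed

lemma centre_stable:
  assumes "\<bar>s\<bar> \<le> 1/4"
  shows "0 \<le> stability_form centre0 (1151/500) s K" "0 \<le> stability_form centre1 (3/50) s K"
    "0 \<le> stability_form centre2 (11/10) s K" "0 \<le> stability_form centre3 2 s K"
proof -
  note nonneg = add_nonneg_nonneg mult_nonneg_nonneg zero_le_power2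
  show "0 \<le> stability_form centre0 (1151/500) s K"
  proof (rule stability_form_nonneg[OF assms])
    show "0 \<le> stability_form centre0 (1151/500) (- 1/4) K"
      unfolding centre0_minus by (intro nonneg) simp_all
    show "0 \<le> stability_form centre0 (1151/500) (1/4) K"
      unfolding centre0_plus by (intro nonneg) simp_all
    show "0 \<le> 2 * stability_form centre0 (1151/500) 0 K - 1/2 * stability_form centre0 (1151/500) (- 1/4) K -
        1/2 * stability_form centre0 (1151/500) (1/4) K"
      unfolding centre0_middle by (intro nonneg) simp_all
  qed
  show "0 \<le> stability_form centre1 (3/50) s K"
  proof (rule stability_form_nonneg[OF assms])
    show "0 \<le> stability_form centre1 (3/50) (- 1/4) K"
      unfolding centre1_minus by (intro nonneg) simp_all
    show "0 \<le> stability_form centre1 (3/50) (1/4) K"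
      unfolding centre1_plus by (intro nonneg) simp_all
    show "0 \<le> 2 * stability_form centre1 (3/50) 0 K - 1/2 * stability_form centre1 (3/50) (- 1/4) K -
        1/2 * stability_form centre1 (3/50) (1/4) K"
      unfolding centre1_middle by (intro nonneg) simp_all
  qed
  show "0 \<le> stability_form centre2 (11/10) s K"
  proof (rule stability_form_nonneg[OF assms])
    show "0 \<le> stability_form centre2 (11/10) (- 1/4) K"
      unfolding centre2_minus by (intro nonneg) simp_all
    show "0 \<le> stability_form centre2 (11/10) (1/4) K"
      unfolding centre2_plus by (intro nonneg) simp_all
    show "0 \<le> 2 * stability_form centre2 (11/10) 0 K - 1/2 * stability_form centre2 (11/10) (- 1/4) K -
        1/2 * stability_form centre2 (11/10) (1/4) K"
      unfolding centre2_middle by (intro nonneg) simp_all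
  qed
  show "0 \<le> stability_form centre3 2 s K"
  proof (rule stability_form_nonneg[OF assms])
    show "0 \<le> stability_form centre3 2 (- 1/4) K"
      unfolding centre3_minus by (intro nonneg) simp_all
    show "0 \<le> stability_form centre3 2 (1/4) K"
      unfolding centre3_plus by (intro nonneg) simp_all
    show "0 \<le> 2 * stability_form centre3 2 0 K - 1/2 * stability_form centre3 2 (- 1/4) K -
        1/2 * stability_form centre3 2 (1/4) K"
      unfolding centre3_middle by (intro nonneg) simp_all
  qed
qed

subsection \<open>Exact arithmetic with the square root of five\<close>


text \<open>A pair \<open>(a, b)\<close> of type \<open>q5\<close> stands for \<open>a + b \<surd>5\<close>. Centres are scaled by 100 and radii by 1000;
  gradients of the reference map are scaled by 9420, their common denominator.\<close>
type_synonym ivec = "int \<times> int \<times> int"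
type_synonym q5 = "int \<times> int"
type_synonym q5mat = "(q5 \<times> q5 \<times> q5) \<times> (q5 \<times> q5 \<times> q5) \<times> (q5 \<times> q5 \<times> q5)"

fun q5_diff :: "q5 \<Rightarrow> q5 \<Rightarrow> q5" where "q5_diff (a, b) (c, d) = (a - c, b - d)"
fun q5_add :: "q5 \<Rightarrow> q5 \<Rightarrow> q5" where "q5_add (a, b) (c, d) = (a + c, b + d)"
fun q5_mult :: "q5 \<Rightarrow> q5 \<Rightarrow> q5" where "q5_mult (a, b) (c, d) = (a * c + 5 * (b * d), a * d + b * c)"
fun q5_scale :: "int \<Rightarrow> q5 \<Rightarrow> q5" where "q5_scale k (a, b) = (k * a, k * b)"
text \<open>A sufficient test: sqrt 5 is replaced by a seven-digit lower or upper bound according to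
  the sign of its coefficient, so that the value can only decrease.\<close>

fun q5_pos :: "q5 \<Rightarrow> bool" where
  "q5_pos (a, b) = (if 0 \<le> b then 0 < 10000000 * a + 22360679 * b else 0 < 10000000 * a + 22360680 * b)"

definition q5_minor :: "q5 \<Rightarrow> q5 \<Rightarrow> q5 \<Rightarrow> q5 \<Rightarrow> q5" where
  "q5_minor a b c d = q5_diff (q5_mult a d) (q5_mult b c)"

fun q5_cof :: "q5mat \<Rightarrow> q5mat" where
  "q5_cof ((a, b, c), (d, e, f), (g, h, i)) =
     ((q5_minor e f h i, q5_minor f d i g, q5_minor d e g h),
      (q5_minor h i b c, q5_minor i g c a, q5_minor g h a b),
      (q5_minor b c e f, q5_minor c a f d, q5_minor a b d e))"

fun q5_row_mult :: "q5 \<times> q5 \<times> q5 \<Rightarrow> q5 \<times> q5 \<times> q5 \<Rightarrow> q5" where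
  "q5_row_mult (a, b, c) (d, e, f) = q5_add (q5_mult a d) (q5_add (q5_mult b e) (q5_mult c f))"

fun q5_dev :: "q5 \<Rightarrow> q5 \<Rightarrow> int \<Rightarrow> q5" where
  "q5_dev d x k = (let y = q5_diff (q5_scale 942000 x) (q5_scale k d) in q5_mult y y)"

text \<open>The inverse is the transposed cofactor matrix divided by the determinant
  \<open>D\<close>, so that entry (i, j) of the matrix meets entry (j, i) of the centre.\<close>

fun q5_dist :: "q5 \<Rightarrow> q5mat \<Rightarrow> ivec \<times> ivec \<times> ivec \<Rightarrow> q5" where
  "q5_dist D ((a, b, c), (d, e, f), (g, h, i)) ((k11, k12, k13), (k21, k22, k23), (k31, k32, k33)) =
     q5_add (q5_dev D a k11) (q5_add (q5_dev D d k12) (q5_add (q5_dev D g k13)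
     (q5_add (q5_dev D b k21) (q5_add (q5_dev D e k22) (q5_add (q5_dev D h k23)
     (q5_add (q5_dev D c k31) (q5_add (q5_dev D f k32) (q5_dev D i k33))))))))"

text \<open>With \<open>Y\<close> the cofactor matrix and \<open>D\<close> the determinant of 9420
  times the gradient, the difference tested is that of 64 |P - C|^2 < 3 (R/1000)^2, C = K/100, after
  multiplication by 10^6 D^2.\<close>

fun near_centre :: "q5 \<Rightarrow> q5mat \<Rightarrow> (ivec \<times> ivec \<times> ivec) \<times> int \<Rightarrow> bool" where
  "near_centre D Y (K, R) = q5_pos (q5_diff (q5_scale (3 * R\<^sup>2) (q5_mult D D)) (q5_scale 6400 (q5_dist D Y K)))"

definition centre_table :: "((ivec \<times> ivec \<times> ivec) \<times> int) list" where
  "centre_table =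
     [(((100, 0, 0), (0, 100, 0), (0, 0, 100)), 2302),
      (((122, -27, -9), (-30, 137, 15), (1, 7, 103)), 60),
      (((120, -10, -20), (-20, 110, 0), (0, 0, 100)), 1100),
      (((100, 0, 0), (0, 100, -20), (0, -20, 100)), 2000)]"

fun near_some_centre :: "q5 \<Rightarrow> q5mat \<Rightarrow> bool" where
  "near_some_centre D Y = (q5_pos D \<and> list_ex (near_centre D Y) centre_table)"

fun q5_good :: "q5mat \<Rightarrow> q5mat \<Rightarrow> bool" where
  "q5_good (r, X) Y = near_some_centre (q5_row_mult r (fst Y)) Y"

text \<open>A cell is coded by four times its lowest corner and by the steps \<open>q\<close> of the vertex path at
  which the three coordinates are incremented.\<close>
type_synonym code = "(nat \<times> nat \<times> nat) \<times> (nat \<times> nat \<times> nat)"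

definition step :: "nat \<Rightarrow> nat \<Rightarrow> nat" where "step q m = (if q \<le> m then 1 else 0)"

text \<open>A passed step moves a vertex by 1/2, that is by two quarter units; averaging two
  vertices leaves one unit for each endpoint beyond the step.\<close>

fun mid_node :: "code \<Rightarrow> nat \<Rightarrow> nat \<Rightarrow> nat \<times> nat \<times> nat" where
  "mid_node ((a, b, c), (p, q, r)) m n =
     (a + (step p m + step p n), b + (step q m + step q n), c + (step r m + step r n))"

definition table_value :: "nat \<times> nat \<times> nat \<Rightarrow> ivec" where
  "table_value t = (case map_of nodal_table t of None \<Rightarrow> (0, 0, 0) | Some v \<Rightarrow> v)"

fun ivec_diff :: "ivec \<Rightarrow> ivec \<Rightarrow> ivec" where "ivec_diff (a, b, c) (d, e, f) = (a - d, b - e, c - f)"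
fun ivec_add :: "ivec \<Rightarrow> ivec \<Rightarrow> ivec" where "ivec_add (a, b, c) (d, e, f) = (a + d, b + e, c + f)"
fun ivec_sq :: "ivec \<Rightarrow> int" where "ivec_sq (a, b, c) = a * a + (b * b + c * c)"

type_synonym mids = "ivec \<times> ivec \<times> ivec \<times> ivec \<times> ivec \<times> ivec"

definition cell_mids :: "code \<Rightarrow> mids" where
  "cell_mids e = (table_value (mid_node e 0 1), table_value (mid_node e 0 2), table_value (mid_node e 0 3),
     table_value (mid_node e 1 2), table_value (mid_node e 1 3), table_value (mid_node e 2 3))"

fun pick :: "mids \<Rightarrow> nat \<Rightarrow> nat \<Rightarrow> ivec" where
  "pick (a, b, c, d, e, f) m n =
     (if m = n then (0, 0, 0) else if m + n = 1 then a else if m + n = 2 then b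
      else if m + n = 3 then if m = 0 \<or> n = 0 then c else d else if m + n = 4 then e else f)"

text \<open>The edge from vertex k - 1 to vertex k of the path is parallel to an axis. For a
  quadratic field vanishing at the vertices, such differences are all that its partial derivative
  along that axis depends on.\<close>

definition edge_diff :: "mids \<Rightarrow> nat \<Rightarrow> nat \<Rightarrow> ivec" where
  "edge_diff M k m = ivec_diff (pick M k m) (pick M (k - 1) m)"

definition edge_sum :: "mids \<Rightarrow> nat \<Rightarrow> ivec" where
  "edge_sum M k = ivec_add (ivec_add (edge_diff M k 0) (edge_diff M k 1)) (ivec_add (edge_diff M k 2) (edge_diff M k 3))"

text \<open>A column of the gradient of the field at a quadrature point is 2 ((5 - sqrt 5)/5 S + (4
  sqrt 5/5) D) = (2/35) (35 S + sqrt 5 (28 D - 7 S)), with S an edge sum and D an edge difference.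
  Since (7/3768) (2/35) = 1/9420, the scaled gradient has coefficients that are integers.\<close>

fun q5_column :: "ivec \<Rightarrow> ivec \<Rightarrow> q5 \<times> q5 \<times> q5" where
  "q5_column (a, b, c) (d, e, f) =
     ((35 * a, 28 * d - 7 * a), (35 * b, 28 * e - 7 * b), (35 * c, 28 * f - 7 * c))"

fun q5_of_columns :: "q5 \<times> q5 \<times> q5 \<Rightarrow> q5 \<times> q5 \<times> q5 \<Rightarrow> q5 \<times> q5 \<times> q5 \<Rightarrow> q5mat" where
  "q5_of_columns (a, b, c) (d, e, f) (g, h, i) =
     ((q5_add (9420, 0) a, d, g), (b, q5_add (9420, 0) e, h), (c, f, q5_add (9420, 0) i))"

fun gradient_code :: "nat \<times> nat \<times> nat \<Rightarrow> nat \<Rightarrow> mids \<Rightarrow> q5mat" where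
  "gradient_code (p, q, r) m M =
     q5_of_columns (q5_column (edge_sum M p) (edge_diff M p m)) (q5_column (edge_sum M q) (edge_diff M q m))
       (q5_column (edge_sum M r) (edge_diff M r m))"

fun q5_check :: "q5mat \<Rightarrow> bool" where "q5_check Y = q5_good Y (q5_cof Y)"

definition corner_codes :: "(nat \<times> nat \<times> nat) list" where
  "corner_codes = [(0,0,0), (0,0,2), (0,2,0), (0,2,2), (2,0,0), (2,0,2), (2,2,0), (2,2,2)]"

definition path_codes :: "(nat \<times> nat \<times> nat) list" where
  "path_codes = [(1,2,3), (1,3,2), (2,1,3), (2,3,1), (3,1,2), (3,2,1)]"

text \<open>At a vertex the columns of the field gradient are 8 times these differences. The scaled
  gradient has Frobenius norm below 1 if the sum is below (3768/56)^2, which is about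
  4527.4.\<close>

definition vertex_ok :: "mids \<Rightarrow> nat \<Rightarrow> bool" where
  "vertex_ok M m \<longleftrightarrow> ivec_sq (edge_diff M 1 m) + (ivec_sq (edge_diff M 2 m) + ivec_sq (edge_diff M 3 m)) < 4527"

definition point_ok :: "nat \<times> nat \<times> nat \<Rightarrow> mids \<Rightarrow> nat \<Rightarrow> bool" where
  "point_ok p M m \<longleftrightarrow> vertex_ok M m \<and> q5_check (gradient_code p m M)"

definition mids_ok :: "nat \<times> nat \<times> nat \<Rightarrow> mids \<Rightarrow> bool" where
  "mids_ok p M \<longleftrightarrow> point_ok p M 0 \<and> point_ok p M 1 \<and> point_ok p M 2 \<and> point_ok p M 3"

definition cell_ok :: "code \<Rightarrow> bool" where
  "cell_ok e = mids_ok (snd e) (cell_mids e)"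

text \<open>The index m stands both for a vertex and for the quadrature point nearest to it, so that
  48 cells with four indices cover all 192 points. Only integers occur, which makes evaluation by
  rewriting feasible.\<close>

lemma cell_ok_all: "list_all cell_ok (List.product corner_codes path_codes)"
  by code_simp

subsection \<open>Quadratic fields\<close>


definition scalar_quadratic_on :: "(real^3) set \<Rightarrow> (real^3 \<Rightarrow> real) \<Rightarrow> bool" where
  "scalar_quadratic_on S g \<longleftrightarrow> (\<exists>c l Q. \<forall>x\<in>S. g x = c + l \<bullet> x + x \<bullet> (Q *v x))"

lemma quadratic_on_iff_components:
  "quadratic_on S f \<longleftrightarrow> (\<forall>i. scalar_quadratic_on S (\<lambda>x. f x $ i))"
proof
  assume "quadratic_on S f"
  then obtain c L Q where f: "\<And>x. x \<in> S \<Longrightarrow> f x = c + L *v x + (\<chi> i. x \<bullet> (Q i *v x))"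
    unfolding quadratic_on_def by blast
  show "\<forall>i. scalar_quadratic_on S (\<lambda>x. f x $ i)"
    unfolding scalar_quadratic_on_def
    by (intro allI exI ballI) (auto simp: f matrix_vector_mult_def inner_vec_def)
next
  assume "\<forall>i. scalar_quadratic_on S (\<lambda>x. f x $ i)"
  then obtain c l Q where f: "\<And>i x. x \<in> S \<Longrightarrow> f x $ i = c i + l i \<bullet> x + x \<bullet> (Q i *v x)"
    unfolding scalar_quadratic_on_def by metis
  show "quadratic_on S f"
    unfolding quadratic_on_def
    by (rule exI[of _ "\<chi> i. c i"], rule exI[of _ "\<chi> i j. l i $ j"], rule exI[of _ Q])
      (simp add: vec_eq_iff f matrix_vector_mult_def inner_vec_def)
qed

lemma scalar_quadratic_on_add:
  assumes "scalar_quadratic_on S f" "scalar_quadratic_on S g"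
  shows "scalar_quadratic_on S (\<lambda>x. f x + g x)"
proof -
  obtain c l Q c' l' Q' where "\<forall>x\<in>S. f x = c + l \<bullet> x + x \<bullet> (Q *v x)" "\<forall>x\<in>S. g x = c' + l' \<bullet> x + x \<bullet> (Q' *v x)"
    using assms unfolding scalar_quadratic_on_def by blast
  then show ?thesis
    unfolding scalar_quadratic_on_def
    by (intro exI[of _ "c + c'"] exI[of _ "l + l'"] exI[of _ "Q + Q'"])
      (simp add: inner_add_left inner_add_right matrix_vector_mult_add_rdistrib)
qed

lemma scalar_quadratic_on_cmult:
  assumes "scalar_quadratic_on S f"
  shows "scalar_quadratic_on S (\<lambda>x. k * f x)"
proof -
  obtain c l Q where "\<forall>x\<in>S. f x = c + l \<bullet> x + x \<bullet> (Q *v x)"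
    using assms unfolding scalar_quadratic_on_def by blast
  then show ?thesis
    unfolding scalar_quadratic_on_def
    by (intro exI[of _ "k * c"] exI[of _ "k *\<^sub>R l"] exI[of _ "k *\<^sub>R Q"])
      (simp add: scaleR_matrix_vector_assoc[symmetric] distrib_left)
qed

lemma scalar_quadratic_on_compose_affine:
  assumes "scalar_quadratic_on T g" "\<And>\<xi>. \<xi> \<in> S \<Longrightarrow> A *v \<xi> + b \<in> T"
  shows "scalar_quadratic_on S (\<lambda>\<xi>. g (A *v \<xi> + b))"
proof -
  obtain c l Q where g: "\<And>x. x \<in> T \<Longrightarrow> g x = c + l \<bullet> x + x \<bullet> (Q *v x)"
    using assms unfolding scalar_quadratic_on_def by blast
  have "g (A *v \<xi> + b) = (c + l \<bullet> b + b \<bullet> (Q *v b)) +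
     ((l + Q *v b + b v* Q) v* A) \<bullet> \<xi> + \<xi> \<bullet> ((transpose A ** (Q ** A)) *v \<xi>)" if "\<xi> \<in> S" for \<xi>
  proof -
    have "\<xi> \<bullet> ((transpose A ** (Q ** A)) *v \<xi>) = (A *v \<xi>) \<bullet> (Q *v (A *v \<xi>))"
      by (simp only: matrix_vector_mul_assoc[symmetric] dot_lmul_matrix[symmetric] vector_transpose_matrix)
    then show ?thesis
      using assms(2)[OF that]
      by (simp add: g inner_add_left inner_add_right matrix_vector_right_distrib dot_lmul_matrix)
        (simp add: inner_commute)
  qed
  then show ?thesis
    unfolding scalar_quadratic_on_def by blast
qed

lemma quadratic_on_add:
  "quadratic_on S f \<Longrightarrow> quadratic_on S g \<Longrightarrow> quadratic_on S (\<lambda>x. f x + g x)"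
  by (simp add: quadratic_on_iff_components scalar_quadratic_on_add)

lemma quadratic_on_scaleR: "quadratic_on S f \<Longrightarrow> quadratic_on S (\<lambda>x. k *\<^sub>R f x)"
  by (simp add: quadratic_on_iff_components scalar_quadratic_on_cmult)

lemma quadratic_on_matrix_mult: "quadratic_on S f \<Longrightarrow> quadratic_on S (\<lambda>x. (A :: real^3^3) *v f x)"
  by (simp add: quadratic_on_iff_components matrix_vector_mult_def sum_3
      scalar_quadratic_on_add scalar_quadratic_on_cmult)

lemma quadratic_on_affine: "quadratic_on S (\<lambda>x. A *v x + b)"
  unfolding quadratic_on_def
  by (intro exI[of _ b] exI[of _ A] exI[of _ "\<lambda>_. 0"]) (simp add: vec_eq_iff)

lemma quadratic_on_compose_affine:
  assumes "quadratic_on T f" "\<And>\<xi>. \<xi> \<in> S \<Longrightarrow> A *v \<xi> + b \<in> T"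
  shows "quadratic_on S (\<lambda>\<xi>. f (A *v \<xi> + b))"
  using assms unfolding quadratic_on_iff_components
  by (intro allI scalar_quadratic_on_compose_affine[where T = T]) auto

lemma quadratic_on_cong: "(\<And>x. x \<in> S \<Longrightarrow> f x = g x) \<Longrightarrow> quadratic_on S f \<longleftrightarrow> quadratic_on S g"
  unfolding quadratic_on_def by auto

subsection \<open>Nodal representation on the reference tetrahedron\<close>

abbreviation mid :: "real^3 \<Rightarrow> real^3 \<Rightarrow> real^3" where
  "mid x y \<equiv> (1/2) *\<^sub>R (x + y)"

lemma mid_self: "mid v v = v"
  by (simp flip: scaleR_2)

text \<open>Formal derivative, with respect to the barycentric coordinate of the corner
  \<open>v\<close>, of the quadratic interpolant with terms f(v) L_v (2 L_v - 1) and 4 f(mid v w)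
  L_v L_w. The diagonal term fits the same pattern because the midpoint of \<open>v\<close> with
  itself is \<open>v\<close>. A derivative in a coordinate of \<open>ref_tet\<close> is a difference
  of two slopes, as the coordinate of the origin decreases at the same rate.\<close>

definition slope :: "(real^3 \<Rightarrow> real^3) \<Rightarrow> real^3 \<Rightarrow> real^3 \<Rightarrow> real^3" where
  "slope f \<xi> v = 4 *\<^sub>R ((1 - \<xi>$1 - \<xi>$2 - \<xi>$3) *\<^sub>R f ((1/2) *\<^sub>R v) + \<xi>$1 *\<^sub>R f (mid v (axis 1 1)) +
     \<xi>$2 *\<^sub>R f (mid v (axis 2 1)) + \<xi>$3 *\<^sub>R f (mid v (axis 3 1))) - f v"

definition nodal_jac :: "(real^3 \<Rightarrow> real^3) \<Rightarrow> real^3 \<Rightarrow> real^3^3" where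
  "nodal_jac f \<xi> = (\<chi> i j. (slope f \<xi> (axis j 1) - slope f \<xi> 0) $ i)"

lemma ref_tet_iff: "\<xi> \<in> ref_tet \<longleftrightarrow> 0 \<le> \<xi>$1 \<and> 0 \<le> \<xi>$2 \<and> 0 \<le> \<xi>$3 \<and> \<xi>$1 + \<xi>$2 + \<xi>$3 \<le> 1"
  by (simp add: ref_tet_def forall_3 sum_3)

lemma nodes_in_ref_tet:
  "0 \<in> ref_tet" "axis j 1 \<in> ref_tet" "(1/2) *\<^sub>R axis j 1 \<in> ref_tet"
  "mid (axis i 1) (axis j 1) \<in> ref_tet"
  using exhaust_3[of i] exhaust_3[of j] by (auto simp: ref_tet_iff axis_def)

lemma scalar_form_3: "l \<bullet> x = l$1 * x$1 + l$2 * x$2 + l$3 * x$3" for x l :: "real^3"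
  by (simp add: inner_vec_def sum_3)

lemma axis_nth_3: "axis 1 (1::real) $ (1::3) = 1" "axis 1 (1::real) $ (2::3) = 0" "axis 1 (1::real) $ (3::3) = 0"
   "axis 2 (1::real) $ (1::3) = 0" "axis 2 (1::real) $ (2::3) = 1" "axis 2 (1::real) $ (3::3) = 0"
   "axis 3 (1::real) $ (1::3) = 0" "axis 3 (1::real) $ (2::3) = 0" "axis 3 (1::real) $ (3::3) = 1"
  by (simp_all add: axis_def)

lemma quadratic_at_nodes:
  fixes l :: "real^3" and Q :: "real^3^3"
  assumes f: "\<And>x. x \<in> ref_tet \<Longrightarrow> f x = c + l \<bullet> x + x \<bullet> (Q *v x)"
  shows "f 0 = c" "f (axis j 1) = c + l$j + Q$j$j" "f ((1/2) *\<^sub>R axis j 1) = c + l$j/2 + Q$j$j/4"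
    "f (mid (axis j 1) (axis k 1)) = c + (l$j + l$k)/2 + (Q$j$j + Q$j$k + Q$k$j + Q$k$k)/4"
  by (simp_all only: f nodes_in_ref_tet)
    (simp_all add: matrix_vector_right_distrib matrix_vector_mult_basis matrix_vector_mult_scaleR inner_add_left inner_add_right
      column_def inner_axis inner_axis' add_divide_distrib)

text \<open>Euler's identity for the interpolant: the quadratic part counts twice in the sum of the
  slopes weighted by barycentric coordinates, and the correction by vertex values accounts for the
  linear part.\<close>

lemma quadratic_nodal_value:
  assumes "quadratic_on ref_tet f" "\<xi> \<in> ref_tet"
  shows "f \<xi> = (1/2) *\<^sub>R ((1 - \<xi>$1 - \<xi>$2 - \<xi>$3) *\<^sub>R (slope f \<xi> 0 - f 0) + \<xi>$1 *\<^sub>R (slope f \<xi> (axis 1 1) - f (axis 1 1)) +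
    \<xi>$2 *\<^sub>R (slope f \<xi> (axis 2 1) - f (axis 2 1)) + \<xi>$3 *\<^sub>R (slope f \<xi> (axis 3 1) - f (axis 3 1)))"
proof -
  have "f \<xi> $ i = ((1/2) *\<^sub>R ((1 - \<xi>$1 - \<xi>$2 - \<xi>$3) *\<^sub>R (slope f \<xi> 0 - f 0) + \<xi>$1 *\<^sub>R (slope f \<xi> (axis 1 1) - f (axis 1 1)) +
    \<xi>$2 *\<^sub>R (slope f \<xi> (axis 2 1) - f (axis 2 1)) + \<xi>$3 *\<^sub>R (slope f \<xi> (axis 3 1) - f (axis 3 1)))) $ i" for i
  proof -
    obtain c l Q where f: "\<And>x. x \<in> ref_tet \<Longrightarrow> f x $ i = c + l \<bullet> x + x \<bullet> (Q *v x)"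
      using assms(1) unfolding quadratic_on_iff_components scalar_quadratic_on_def by meson
    show ?thesis
      by (simp add: slope_def f[OF assms(2)] quadratic_at_nodes[of "\<lambda>x. f x $ i", OF f] del: scaleR_right_distrib)
        (simp add: scalar_form_3 matrix_vector_mult_def sum_3 field_simps)
  qed
  then show ?thesis by (simp add: vec_eq_iff)
qed

lemma quadratic_has_derivative:
  assumes "quadratic_on ref_tet f" "\<xi> \<in> ref_tet"
  shows "(f has_derivative (\<lambda>h. nodal_jac f \<xi> *v h)) (at \<xi> within ref_tet)"
proof -
  have "((\<lambda>x. f x $ i) has_derivative (\<lambda>h. (nodal_jac f \<xi> *v h) $ i)) (at \<xi> within ref_tet)" for i
  proof -
    obtain c l Q where f: "\<And>x. x \<in> ref_tet \<Longrightarrow> f x $ i = c + l \<bullet> x + x \<bullet> (Q *v x)"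
      using assms(1) unfolding quadratic_on_iff_components scalar_quadratic_on_def by meson
    have "((\<lambda>x. c + l \<bullet> x + x \<bullet> (Q *v x)) has_derivative (\<lambda>h. l \<bullet> h + (\<xi> \<bullet> (Q *v h) + h \<bullet> (Q *v \<xi>)))) (at \<xi> within ref_tet)"
      by (auto intro!: derivative_eq_intros bounded_linear.has_derivative[OF matrix_vector_mul_bounded_linear])
    moreover have "l \<bullet> h + (\<xi> \<bullet> (Q *v h) + h \<bullet> (Q *v \<xi>)) = (nodal_jac f \<xi> *v h) $ i" for h
      by (simp add: nodal_jac_def matrix_vector_mult_def[of "\<chi> i j. _ i j"] sum_3 slope_def
            quadratic_at_nodes[of "\<lambda>x. f x $ i", OF f] del: scaleR_right_distrib)
        (simp add: scalar_form_3 matrix_vector_mult_def sum_3 field_simps)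
    ultimately have "((\<lambda>x. c + l \<bullet> x + x \<bullet> (Q *v x)) has_derivative (\<lambda>h. (nodal_jac f \<xi> *v h) $ i)) (at \<xi> within ref_tet)"
      by simp
    then show ?thesis
      by (rule has_derivative_transform[rotated 2]) (use f assms(2) in auto)
  qed
  then have "\<And>b. b \<in> Basis \<Longrightarrow> ((\<lambda>x. f x \<bullet> b) has_derivative (\<lambda>h. (nodal_jac f \<xi> *v h) \<bullet> b)) (at \<xi> within ref_tet)"
    by (auto simp: Basis_vec_def inner_axis)
  then show ?thesis
    by (subst has_derivative_componentwise_within) auto
qed

text \<open>The uniqueness criterion for derivatives within a set asks for a small admissible step
  along every axis. Below the slanted face a positive step is available, and for positive
  coordinates a negative one. Quadrature points and the relative interiors of all faces
  qualify.\<close>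

definition smooth_point :: "real^3 \<Rightarrow> bool" where
  "smooth_point \<xi> \<longleftrightarrow> \<xi> \<in> ref_tet \<and> (\<xi>$1 + \<xi>$2 + \<xi>$3 < 1 \<or> 0 < \<xi>$1 \<and> 0 < \<xi>$2 \<and> 0 < \<xi>$3)"

lemma derivative_within_ref_tet_unique:
  fixes f :: "real^3 \<Rightarrow> 'a::real_normed_vector"
  assumes "(f has_derivative D) (at \<xi> within ref_tet)" "(f has_derivative D') (at \<xi> within ref_tet)" "smooth_point \<xi>"
  shows "D = D'"
proof (rule frechet_derivative_unique_within[OF assms(1,2)])
  fix b :: "real^3" and e :: real
  assume b: "b \<in> Basis" and e: "0 < e"
  then obtain j where j: "b = axis j 1"
    by (auto simp: Basis_vec_def)
  from assms(3) consider "\<xi> \<in> ref_tet" "\<xi>$1 + \<xi>$2 + \<xi>$3 < 1" | "\<xi> \<in> ref_tet" "0 < \<xi>$1" "0 < \<xi>$2" "0 < \<xi>$3"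
    by (auto simp: smooth_point_def)
  then show "\<exists>d. 0 < \<bar>d\<bar> \<and> \<bar>d\<bar> < e \<and> \<xi> + d *\<^sub>R b \<in> ref_tet"
  proof cases
    case 1
    define d where "d = min (e/2) (1 - \<xi>$1 - \<xi>$2 - \<xi>$3)"
    have "0 < d" "d < e" "d \<le> 1 - \<xi>$1 - \<xi>$2 - \<xi>$3"
      using 1 e by (auto simp: d_def)
    then show ?thesis
      using 1 exhaust_3[of j] unfolding j by (intro exI[of _ d]) (auto simp: ref_tet_iff axis_def)
  next
    case 2
    define d where "d = min (e/2) (\<xi>$j)"
    have "0 < d" "d < e" "d \<le> \<xi>$j"
      using 2 e exhaust_3[of j] by (auto simp: d_def)
    then show ?thesis
      using 2 exhaust_3[of j] unfolding j by (intro exI[of _ "-d"]) (auto simp: ref_tet_iff axis_def)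
  qed
qed

lemma jac_eqI:
  assumes "(f has_derivative (\<lambda>h. A *v h)) (at \<xi> within ref_tet)" "smooth_point \<xi>"
  shows "jac f \<xi> = A"
proof -
  have "(f has_derivative frechet_derivative f (at \<xi> within ref_tet)) (at \<xi> within ref_tet)"
    using assms(1) frechet_derivative_works differentiable_def by blast
  then have "frechet_derivative f (at \<xi> within ref_tet) = (\<lambda>h. A *v h)"
    by (rule derivative_within_ref_tet_unique) (use assms in auto)
  then show ?thesis
    unfolding jac_def by (simp add: matrix_of_matrix_vector_mul)
qed

lemma jac_eq_nodal_jac: "quadratic_on ref_tet f \<Longrightarrow> smooth_point \<xi> \<Longrightarrow> jac f \<xi> = nodal_jac f \<xi>"
  by (rule jac_eqI[OF quadratic_has_derivative]) (auto simp: smooth_point_def)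

lemma jac_add_scale:
  assumes "quadratic_on ref_tet f" "quadratic_on ref_tet g" "smooth_point \<xi>"
  shows "jac (\<lambda>x. f x + p *\<^sub>R g x) \<xi> = jac f \<xi> + p *\<^sub>R jac g \<xi>"
proof -
  have "quadratic_on ref_tet (\<lambda>x. f x + p *\<^sub>R g x)"
    by (intro quadratic_on_add quadratic_on_scaleR assms)
  then show ?thesis
    by (simp add: jac_eq_nodal_jac assms)
      (simp add: nodal_jac_def slope_def vec_eq_iff algebra_simps)
qed

lemma jac_matrix_mult:
  assumes "quadratic_on ref_tet f" "smooth_point \<xi>"
  shows "jac (\<lambda>x. A *v f x) \<xi> = A ** jac f \<xi>"
proof -
  have \<xi>: "\<xi> \<in> ref_tet" using assms by (simp add: smooth_point_def)
  have "((\<lambda>x. A *v f x) has_derivative (\<lambda>h. A *v (nodal_jac f \<xi> *v h))) (at \<xi> within ref_tet)"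
    by (rule bounded_linear.has_derivative[OF matrix_vector_mul_bounded_linear quadratic_has_derivative[OF assms(1) \<xi>]])
  then show ?thesis
    using jac_eqI[of "\<lambda>x. A *v f x" "A ** jac f \<xi>" \<xi>] assms by (simp add: matrix_vector_mul_assoc jac_eq_nodal_jac)
qed

lemma jac_affine: "smooth_point \<xi> \<Longrightarrow> jac (\<lambda>x. A *v x + b) \<xi> = A"
  by (rule jac_eqI) (auto intro!: derivative_eq_intros bounded_linear.has_derivative[OF matrix_vector_mul_bounded_linear])

lemma smooth_point_quad_points: "\<xi> \<in> quad_points \<Longrightarrow> smooth_point \<xi>"
proof -
  have *: "sqrt 5 \<le> 3"
    by (rule real_le_lsqrt) auto
  have "2 < sqrt (5::real)"
    by (rule real_less_rsqrt) auto
  then show "\<xi> \<in> quad_points \<Longrightarrow> smooth_point \<xi>" using *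
    by (auto simp: quad_points_def smooth_point_def ref_tet_iff Let_def field_simps)
qed

section \<open>Perturbation of a centre in the Frobenius norm\<close>

lemma frob_eq_inner: "frob A B = A \<bullet> B"
  by (simp add: frob_expand inner_vec_def sum_3)

lemma frob_self: "frob A A = (norm A)\<^sup>2"
  by (simp add: frob_eq_inner power2_norm_eq_inner)

lemma frob_Cauchy_Schwarz: "(frob A B)\<^sup>2 \<le> frob A A * frob B B"
  using Cauchy_Schwarz_ineq by (simp add: frob_eq_inner)

text \<open>For the singular values this is \<open>3 (p q + q r + r p) \<le> (p + q + r)\<^sup>2\<close> with their squares \<open>p\<close>, \<open>q\<close>, \<open>r\<close>.\<close>
lemma frob_cof_le: "3 * frob (cof H) (cof H) \<le> (frob H H)\<^sup>2"
proof -
  define S where "S i j = H$1$i * H$1$j + H$2$i * H$2$j + H$3$i * H$3$j" for i j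
  have "2 * ((frob H H)\<^sup>2 - 3 * frob (cof H) (cof H)) =
      (S 1 1 - S 2 2)\<^sup>2 + (S 2 2 - S 3 3)\<^sup>2 + (S 3 3 - S 1 1)\<^sup>2 + 6 * ((S 1 2)\<^sup>2 + (S 2 3)\<^sup>2 + (S 1 3)\<^sup>2)"
    unfolding S_def frob_expand cof_nth by algebra
  moreover have "0 \<le> \<dots>" by simp
  ultimately have "0 \<le> 2 * ((frob H H)\<^sup>2 - 3 * frob (cof H) (cof H))" by (simp only:)
  then show ?thesis by simp
qed

lemma stable_near_centre:
  assumes "0 \<le> stability_form C R s K" "0 \<le> R" "64 * frob (P - C) (P - C) \<le> 3 * R\<^sup>2"
  shows "1/16 * (2 * frob (K ** shear_matrix s) (K ** shear_matrix s) + 2/3 * (trace (K ** shear_matrix s))\<^sup>2) \<le>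
    W_variation (shear_matrix s) K + 8 * frob P (cof (K ** shear_matrix s))"
proof -
  define H where "H = K ** shear_matrix s"
  have h: "0 \<le> frob H H" by (simp add: frob_self)
  have "(8 * frob (P - C) (cof H))\<^sup>2 \<le> 64 * (frob (P - C) (P - C) * frob (cof H) (cof H))"
    using frob_Cauchy_Schwarz[of "P - C" "cof H"] by (simp add: power_mult_distrib)
  also have "\<dots> \<le> (3 * R\<^sup>2) * frob (cof H) (cof H)"
    using mult_right_mono[OF assms(3), of "frob (cof H) (cof H)"] by (simp add: frob_self)
  also have "\<dots> \<le> R\<^sup>2 * (frob H H)\<^sup>2"
    using mult_left_mono[OF frob_cof_le[of H], of "R\<^sup>2"] by simp
  finally have "(8 * frob (P - C) (cof H))\<^sup>2 \<le> (R * frob H H)\<^sup>2"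
    by (simp add: power_mult_distrib)
  then have "\<bar>8 * frob (P - C) (cof H)\<bar> \<le> R * frob H H"
    using h assms(2) abs_le_square_iff[of "8 * frob (P - C) (cof H)" "R * frob H H"] by simp
  moreover have "frob (P - C) (cof H) = frob P (cof H) - frob C (cof H)"
    by (simp add: frob_eq_inner inner_diff_left)
  ultimately have "- (R * frob H H) \<le> 8 * frob P (cof H) - 8 * frob C (cof H)"
    by (simp add: abs_le_iff)
  then show ?thesis
    using assms(1) unfolding stability_form_def Let_def H_def[symmetric] by linarith
qed

subsection \<open>Second derivatives along lines\<close>

text \<open>Value and first two derivatives at 0. Differentiability is demanded near 0, since
  \<open>hessian\<close> nests two derivatives and the inner one must be known in a neighbourhood
  before it can be differentiated again.\<close>

definition jet2 :: "(real \<Rightarrow> real) \<Rightarrow> real \<Rightarrow> real \<Rightarrow> real \<Rightarrow> bool" where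
  "jet2 f a b c \<longleftrightarrow> f 0 = a \<and>
     (\<exists>f'. f' 0 = b \<and> (\<forall>\<^sub>F r in nhds 0. (f has_real_derivative f' r) (at r)) \<and> (f' has_real_derivative c) (at 0))"

lemma jet2_eq: "jet2 f a b c \<Longrightarrow> a = a' \<Longrightarrow> b = b' \<Longrightarrow> c = c' \<Longrightarrow> jet2 f a' b' c'"
  by simp

lemma jet2_const: "jet2 (\<lambda>_. k) k 0 0"
  unfolding jet2_def by (auto intro!: exI[of _ "\<lambda>_. 0"])

lemma jet2_add:
  assumes "jet2 f a b c" "jet2 g a' b' c'"
  shows "jet2 (\<lambda>r. f r + g r) (a + a') (b + b') (c + c')"
proof -
  obtain f' g' where *: "f' 0 = b" "\<forall>\<^sub>F r in nhds 0. (f has_real_derivative f' r) (at r)" "(f' has_real_derivative c) (at 0)"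
    "g' 0 = b'" "\<forall>\<^sub>F r in nhds 0. (g has_real_derivative g' r) (at r)" "(g' has_real_derivative c') (at 0)"
    using assms unfolding jet2_def by blast
  have "\<forall>\<^sub>F r in nhds 0. ((\<lambda>r. f r + g r) has_real_derivative f' r + g' r) (at r)"
    using *(2,5) by eventually_elim (auto intro: derivative_eq_intros)
  moreover have "((\<lambda>r. f' r + g' r) has_real_derivative c + c') (at 0)"
    using * by (auto intro: derivative_eq_intros)
  ultimately show ?thesis
    using * assms unfolding jet2_def by (auto intro!: exI[of _ "\<lambda>r. f' r + g' r"])
qed

lemma jet2_mult:
  assumes "jet2 f a b c" "jet2 g a' b' c'"
  shows "jet2 (\<lambda>r. f r * g r) (a * a') (b * a' + a * b') (c * a' + 2 * b * b' + a * c')"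
proof -
  obtain f' g' where *: "f' 0 = b" "\<forall>\<^sub>F r in nhds 0. (f has_real_derivative f' r) (at r)" "(f' has_real_derivative c) (at 0)"
    "g' 0 = b'" "\<forall>\<^sub>F r in nhds 0. (g has_real_derivative g' r) (at r)" "(g' has_real_derivative c') (at 0)"
    using assms unfolding jet2_def by blast
  have 0: "f 0 = a" "g 0 = a'" using assms by (auto simp: jet2_def)
  have "\<forall>\<^sub>F r in nhds 0. ((\<lambda>r. f r * g r) has_real_derivative f' r * g r + f r * g' r) (at r)"
    using *(2,5) by eventually_elim (auto intro: derivative_eq_intros)
  moreover have "(f has_real_derivative b) (at 0)" "(g has_real_derivative b') (at 0)"
    using eventually_nhds_x_imp_x[OF *(2)] eventually_nhds_x_imp_x[OF *(5)] * by auto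
  then have "((\<lambda>r. f' r * g r + f r * g' r) has_real_derivative c * a' + 2 * b * b' + a * c') (at 0)"
    using * 0 by (auto intro!: derivative_eq_intros)
  ultimately show ?thesis
    using * 0 unfolding jet2_def by (auto intro!: exI[of _ "\<lambda>r. f' r * g r + f r * g' r"])
qed

lemma jet2_cmult: "jet2 f a b c \<Longrightarrow> jet2 (\<lambda>r. k * f r) (k * a) (k * b) (k * c)"
  using jet2_mult[OF jet2_const] by (rule jet2_eq) auto

lemma jet2_sum:
  assumes "finite S" "\<And>i. i \<in> S \<Longrightarrow> jet2 (f i) (a i) (b i) (c i)"
  shows "jet2 (\<lambda>r. \<Sum>i\<in>S. f i r) (sum a S) (sum b S) (sum c S)"
  using assms by (induction S rule: finite_induct) (auto intro: jet2_const jet2_add)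

lemma jet2_power2:
  assumes "jet2 f 0 b c"
  shows "jet2 (\<lambda>r. (f r)\<^sup>2) 0 0 (2 * b\<^sup>2)"
  using jet2_mult[OF assms assms] by (simp add: power2_eq_square mult.assoc)

lemma jet2_quartic:
  "jet2 (\<lambda>r. c0 + r * c1 + r^2 * c2 + r^3 * c3 + r^4 * c4) c0 c1 (2 * c2)"
  unfolding jet2_def
  by (intro conjI exI[of _ "\<lambda>r. c1 + 2 * r * c2 + 3 * r^2 * c3 + 4 * r^3 * c4"] always_eventually allI)
    (auto intro!: derivative_eq_intros)

lemma jet2_powr:
  assumes "jet2 f 1 b c"
  shows "jet2 (\<lambda>r. f r powr t) 1 (t * b) (t * (t - 1) * b\<^sup>2 + t * c)"
proof -
  obtain f' where *: "f' 0 = b" "\<forall>\<^sub>F r in nhds 0. (f has_real_derivative f' r) (at r)" "(f' has_real_derivative c) (at 0)"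
    using assms unfolding jet2_def by blast
  have 0: "f 0 = 1" using assms by (auto simp: jet2_def)
  have d: "(f has_real_derivative b) (at 0)"
    using eventually_nhds_x_imp_x[OF *(2)] * by auto
  then have "isCont f 0" by (rule DERIV_isCont)
  then have "(f \<longlongrightarrow> f 0) (nhds 0)"
    by (simp add: isCont_def tendsto_at_iff_tendsto_nhds)
  then have "\<forall>\<^sub>F r in nhds 0. 0 < f r"
    by (rule order_tendstoD) (simp add: 0)
  with *(2) have "\<forall>\<^sub>F r in nhds 0. ((\<lambda>r. f r powr t) has_real_derivative t * f r powr (t - 1) * f' r) (at r)"
    by eventually_elim (auto intro!: derivative_eq_intros)
  moreover have "((\<lambda>r. t * f r powr (t - 1) * f' r) has_real_derivative t * (t - 1) * b\<^sup>2 + t * c) (at 0)"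
    using 0 * d by (auto intro!: derivative_eq_intros simp: power2_eq_square)
  ultimately show ?thesis
    using * 0 unfolding jet2_def by (auto intro!: exI[of _ "\<lambda>r. t * f r powr (t - 1) * f' r"])
qed

text \<open>For equal directions the two parameters enter only through p + q, which reduces the
  mixed derivative to a second derivative along one line.\<close>

lemma hessian_eq_jet2:
  assumes "jet2 (\<lambda>r. \<Phi> (\<lambda>x. y x + r *\<^sub>R u x)) a b c"
  shows "hessian \<Phi> y u u = c"
proof -
  define f where "f r = \<Phi> (\<lambda>x. y x + r *\<^sub>R u x)" for r
  obtain f' where *: "\<forall>\<^sub>F r in nhds 0. (f has_real_derivative f' r) (at r)" "(f' has_real_derivative c) (at 0)"
    using assms unfolding jet2_def f_def[symmetric] by blast
  have "\<Phi> (\<lambda>x. y x + p *\<^sub>R u x + q *\<^sub>R u x) = f (p + q)" for p q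
    by (simp add: f_def scaleR_left_distrib add.assoc)
  then have "hessian \<Phi> y u u = deriv (\<lambda>p. deriv (\<lambda>q. f (p + q)) 0) 0"
    by (simp add: hessian_def)
  also have "\<forall>\<^sub>F p in nhds 0. deriv (\<lambda>q. f (p + q)) 0 = f' p"
    using *(1)
  proof eventually_elim
    case (elim p)
    then have "((\<lambda>q. f (p + q)) has_real_derivative f' p) (at 0)"
      using DERIV_shift[of f "f' p" 0 p] by (simp add: add.commute)
    then show ?case by (rule DERIV_imp_deriv)
  qed
  then have "deriv (\<lambda>p. deriv (\<lambda>q. f (p + q)) 0) 0 = deriv f' 0"
    by (rule deriv_cong_ev) simp
  also have "\<dots> = c" using *(2) by (rule DERIV_imp_deriv)
  finally show ?thesis .
qed

section \<open>Second variation of the stored energy\<close>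

lemma det_add_scale:
  "det (A + r *\<^sub>R B) = det A + r * frob (cof A) B + r^2 * frob A (cof B) + r^3 * det B"
  for A B :: "real^3^3"
  by (simp add: det_3 frob_expand cof_nth) algebra

definition cof_polar :: "real^3^3 \<Rightarrow> real^3^3 \<Rightarrow> real^3^3" where
  "cof_polar A B = cof (A + B) - cof A - cof B"

lemma cof_add_scale: "cof (A + r *\<^sub>R B) = cof A + r *\<^sub>R cof_polar A B + r\<^sup>2 *\<^sub>R cof B"
  by (simp add: mat3_eq_iff cof_nth cof_polar_def) algebra

lemma cof_polar_mat_1: "cof_polar (mat 1) K = trace K *\<^sub>R mat 1 - transpose K"
  by (simp add: mat3_eq_iff cof_nth cof_polar_def mat_1_nth transpose_nth trace_3) algebra

lemma frob_add_scale_self: "frob (A + r *\<^sub>R B) (A + r *\<^sub>R B) = frob A A + r * (2 * frob A B) + r^2 * frob B B"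
  by (simp add: frob_expand) algebra

lemma frob_quadratic_self:
  "frob (A + r *\<^sub>R B + r\<^sup>2 *\<^sub>R C) (A + r *\<^sub>R B + r\<^sup>2 *\<^sub>R C) =
     frob A A + r * (2 * frob A B) + r^2 * (frob B B + 2 * frob A C) + r^3 * (2 * frob B C) + r^4 * frob C C"
  by (simp add: frob_expand) algebra

lemma frob_mat_1_left: "frob (mat 1) A = trace A"
  by (simp add: frob_expand mat_1_nth trace_3)

lemma cof_mat_1: "cof (mat 1) = mat 1"
  by (simp add: mat3_eq_iff cof_nth mat_1_nth)

lemma W_jet2:
  assumes "det F = 1"
  obtains a b where "jet2 (\<lambda>r. W (F + r *\<^sub>R (K ** F))) a b (W_variation F K)"
proof -
  define C C1 C2 where "C = cof F" and "C1 = (trace K *\<^sub>R mat 1 - transpose K) ** C" and "C2 = cof K ** C"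
  \<comment> \<open>Along this factorization the determinant is that of
    \<open>mat 1 + r *\<^sub>R K\<close>, whose coefficients are the invariants of \<open>K\<close>;
    the base gradient contributes the factor 1 only.\<close>
  have line: "F + r *\<^sub>R (K ** F) = (mat 1 + r *\<^sub>R K) ** F" for r
    by (simp add: matrix_add_rdistrib scaleR_matrix_mult_left)
  have det: "det (F + r *\<^sub>R (K ** F)) = 1 + r * trace K + r^2 * trace (cof K) + r^3 * det K + r^4 * 0" for r
    unfolding line by (simp add: det_mul assms det_add_scale frob_mat_1_left cof_mat_1)
  have cof: "cof (F + r *\<^sub>R (K ** F)) = C + r *\<^sub>R C1 + r\<^sup>2 *\<^sub>R C2" for r
    unfolding line cof_mult cof_add_scale cof_polar_mat_1 cof_mat_1
    by (simp add: matrix_add_rdistrib scaleR_matrix_mult_left C_def C1_def C2_def)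
  have d: "jet2 (\<lambda>r. det (F + r *\<^sub>R (K ** F))) 1 (trace K) (2 * trace (cof K))"
    unfolding det by (rule jet2_quartic)
  have f: "jet2 (\<lambda>r. frob (F + r *\<^sub>R (K ** F)) (F + r *\<^sub>R (K ** F)))
      (frob F F) (2 * frob F (K ** F)) (2 * frob (K ** F) (K ** F))"
    using jet2_quartic[of "frob F F" "2 * frob F (K ** F)" "frob (K ** F) (K ** F)" 0 0]
    unfolding frob_add_scale_self by simp
  have g: "jet2 (\<lambda>r. frob (cof (F + r *\<^sub>R (K ** F))) (cof (F + r *\<^sub>R (K ** F))))
      (frob C C) (2 * frob C C1) (2 * (frob C1 C1 + 2 * frob C C2))"
    unfolding cof frob_quadratic_self by (rule jet2_quartic)
  note j = jet2_add[OF jet2_add[OF jet2_mult[OF jet2_powr[OF d] f] jet2_const]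
    jet2_add[OF jet2_mult[OF jet2_powr[OF d] g] jet2_const]]
  show ?thesis
    unfolding W_def diff_conv_add_uminus
    by (rule that[unfolded W_def diff_conv_add_uminus, OF jet2_eq[OF j refl refl]])
      (unfold W_variation_def Let_def C_def[symmetric] C1_def[symmetric] C2_def[symmetric], simp add: field_simps power2_eq_square)
qed

subsection \<open>Charts of the cells\<close>


definition ref_corners :: "(real^3) set" where
  "ref_corners = {0, axis 1 1, axis 2 1, axis 3 1}"

text \<open>Indexes the quadrature points by the corners nearest to them: all barycentric
  coordinates are (5 - sqrt 5)/20, and the one of \<open>w\<close> is raised by (5 + 3 sqrt 5)/20 -
  (5 - sqrt 5)/20 = sqrt 5/5. For w = 0 the raised coordinate is the one not displayed.\<close>

definition quad_point :: "real^3 \<Rightarrow> real^3" where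
  "quad_point w = (\<chi> i. (5 - sqrt 5) / 20) + (sqrt 5 / 5) *\<^sub>R w"

lemma quad_points_eq: "quad_points = quad_point ` ref_corners"
proof -
  have "range (\<lambda>k. \<chi> i. if i = k then (5 + 3 * sqrt 5) / 20 else (5 - sqrt 5) / 20) = quad_point ` range (\<lambda>k::3. axis k 1)"
    unfolding image_image
    by (intro image_cong refl) (simp add: quad_point_def vec_eq_iff axis_def field_simps)
  moreover have "range (\<lambda>k::3. axis k 1) = {axis 1 1, axis 2 1, axis 3 (1::real)}"
    by (simp add: UNIV_3)
  ultimately show ?thesis
    unfolding quad_points_def ref_corners_def Let_def by (simp add: quad_point_def)
qed

lemma inj_quad_point: "inj quad_point"
  by (auto simp: inj_def quad_point_def)

lemma axis_distinct:
  "axis 1 1 \<noteq> (axis 2 1 :: real^3)" "axis 1 1 \<noteq> (axis 3 1 :: real^3)" "axis 2 1 \<noteq> (axis 3 1 :: real^3)"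
  "axis i 1 \<noteq> (0 :: real^3)" "(0 :: real^3) \<noteq> axis i 1"
  by (auto simp: axis_eq_axis)

lemma sum_ref_corners:
  "(\<Sum>w\<in>ref_corners. f w) = f 0 + f (axis 1 1) + f (axis 2 1) + f (axis 3 1)"
  for f :: "real^3 \<Rightarrow> 'a::comm_monoid_add"
  by (simp add: ref_corners_def axis_distinct axis_distinct(1-3)[symmetric] add.assoc)

lemma finite_ref_corners: "finite ref_corners"
  by (simp add: ref_corners_def)

lemma card_ref_corners: "card ref_corners = 4"
  by (simp add: ref_corners_def axis_distinct axis_distinct(1-3)[symmetric])

lemma Q4_eq: "Q4 g = (\<Sum>w\<in>ref_corners. 1/24 * g (quad_point w))"
  unfolding Q4_def quad_points_eq
  by (subst sum.reindex) (auto intro: inj_on_subset[OF inj_quad_point])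

lemma smooth_quad_point: "w \<in> ref_corners \<Longrightarrow> smooth_point (quad_point w)"
  by (rule smooth_point_quad_points) (simp add: quad_points_eq)

lemma slope_quad_point:
  assumes "w \<in> ref_corners"
  shows "slope f (quad_point w) v = ((5 - sqrt 5) / 5) *\<^sub>R (\<Sum>l\<in>ref_corners. f (mid v l)) +
    (4 * sqrt 5 / 5) *\<^sub>R f (mid v w) - f v"
proof -
  have "(slope f (quad_point w) v) $ i = (((5 - sqrt 5) / 5) *\<^sub>R (\<Sum>l\<in>ref_corners. f (mid v l)) +
    (4 * sqrt 5 / 5) *\<^sub>R f (mid v w) - f v) $ i" for i
    using assms unfolding slope_def sum_ref_corners
    by (auto simp: ref_corners_def quad_point_def axis_nth_3 field_simps simp del: scaleR_right_distrib)
  then show ?thesis by (simp add: vec_eq_iff)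
qed

definition vert :: "cell \<Rightarrow> nat \<Rightarrow> real^3" where
  "vert e m = fst e + (\<Sum>k<m. (1/2) *\<^sub>R axis (snd e (of_nat (Suc k))) 1)"

lemma vert_simps:
  "vert e 0 = fst e" "vert e (Suc 0) = fst e + (1/2) *\<^sub>R axis (snd e 1) 1"
  "vert e 2 = fst e + (1/2) *\<^sub>R axis (snd e 1) 1 + (1/2) *\<^sub>R axis (snd e 2) 1"
  "vert e 3 = fst e + (1/2) *\<^sub>R axis (snd e 1) 1 + (1/2) *\<^sub>R axis (snd e 2) 1 + (1/2) *\<^sub>R axis (snd e 3) 1"
  by (simp_all add: vert_def numeral_2_eq_2 numeral_3_eq_3)

lemma vert_nat_simps: "vert e 1 = fst e + (1/2) *\<^sub>R axis (snd e 1) 1"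
  using vert_simps(2) by simp

definition verts :: "cell \<Rightarrow> (real^3) set" where
  "verts e = {vert e 0, vert e 1, vert e 2, vert e 3}"

lemma tetrahedron_eq: "tetrahedron e = convex hull verts e"
  by (cases e) (simp add: tetrahedron_def verts_def vert_simps Let_def)

lemma ref_tet_eq: "ref_tet = convex hull ref_corners"
proof -
  have "ref_corners = insert 0 Basis"
    by (auto simp: ref_corners_def Basis_vec_def) (metis exhaust_3)
  moreover have "sum (\<lambda>i. x \<bullet> i) Basis = x$1 + x$2 + x$3" for x :: "real^3"
  proof -
    have B: "(Basis :: (real^3) set) = {axis 1 1, axis 2 1, axis 3 1}"
      by (auto simp: Basis_vec_def) (metis exhaust_3)
    show ?thesis
      unfolding B by (simp add: axis_distinct axis_distinct(1-3)[symmetric] inner_axis add.assoc)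
  qed
  ultimately show ?thesis
    using std_simplex[where 'a = "real^3"] by (auto simp: ref_tet_iff Basis_vec_def inner_axis forall_3)
qed

lemma extreme_ref_corner: "w \<in> ref_corners \<Longrightarrow> w extreme_point_of ref_tet"
proof -
  have "ref_corners = insert 0 Basis"
    by (auto simp: ref_corners_def Basis_vec_def) (metis exhaust_3)
  moreover have "\<not> affine_dependent (insert 0 (Basis :: (real^3) set))"
    using independent_Basis affine_dependent_iff_dependent[of 0 "Basis :: (real^3) set"] by auto
  ultimately show "w \<in> ref_corners \<Longrightarrow> w extreme_point_of ref_tet"
    by (simp add: ref_tet_eq extreme_point_of_convex_hull_affine_independent)
qed

locale chart =
  fixes e :: cell and \<tau> :: "real^3 \<Rightarrow> real^3" and M :: "real^3^3" and b :: "real^3"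
  assumes cell: "e \<in> cells" and det_pos: "0 < det M" and chart_eq: "\<And>\<xi>. \<tau> \<xi> = M *v \<xi> + b"
    and image: "\<tau> ` ref_tet = tetrahedron e"
begin

lemma inj_chart: "inj \<tau>"
proof -
  have "inj ((*v) M)" using det_pos by (simp add: inj_matrix_vector_mult invertible_det_nz)
  then show ?thesis by (auto simp: inj_def chart_eq)
qed

text \<open>The chart is specified by its image only. An injective affine map preserves open
  segments and hence extreme points, so that corners go to vertices, in an order that stays
  open.\<close>

lemma chart_corner: "w \<in> ref_corners \<Longrightarrow> \<tau> w \<in> verts e"
proof -
  assume "w \<in> ref_corners"
  then have "w extreme_point_of ref_tet" by (rule extreme_ref_corner)
  moreover have "\<tau> w \<notin> open_segment (\<tau> x) (\<tau> y)" if "w \<notin> open_segment x y" for x y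
  proof -
    have "open_segment (\<tau> x) (\<tau> y) = \<tau> ` open_segment x y"
      using open_segment_linear_image[of "(*v) M" x y] det_pos open_segment_translation[of b "M *v x" "M *v y"]
      by (simp add: inj_matrix_vector_mult invertible_det_nz chart_eq image_image add.commute)
    then show ?thesis using that inj_chart by (auto dest: injD)
  qed
  ultimately have "\<tau> w extreme_point_of (\<tau> ` ref_tet)"
    by (auto simp: extreme_point_of_def)
  then have "\<tau> w extreme_point_of (convex hull verts e)"
    by (simp add: image tetrahedron_eq)
  then show ?thesis by (rule extreme_point_of_convex_hull)
qed

lemma chart_corners: "\<tau> ` ref_corners = verts e" and card_verts: "card (verts e) = 4"
proof -
  have "card (\<tau> ` ref_corners) = 4"
    by (simp add: card_image inj_on_subset[OF inj_chart] card_ref_corners)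
  moreover have "card (verts e) \<le> 4"
    unfolding verts_def by (rule card_insert_le_m1[OF _ card_insert_le_m1[OF _ card_insert_le_m1]]) auto
  moreover have fin: "finite (verts e)" by (simp add: verts_def)
  moreover have sub: "\<tau> ` ref_corners \<subseteq> verts e" using chart_corner by auto
  ultimately show "\<tau> ` ref_corners = verts e" using card_mono[OF fin sub] by (simp add: card_subset_eq)
  then show "card (verts e) = 4" using \<open>card (\<tau> ` ref_corners) = 4\<close> by simp
qed

lemma sum_verts: "(\<Sum>v\<in>verts e. f v) = (\<Sum>w\<in>ref_corners. f (\<tau> w))"
  unfolding chart_corners[symmetric] by (simp add: sum.reindex inj_on_subset[OF inj_chart])

lemma chart_midpoint: "\<tau> (mid v w) = mid (\<tau> v) (\<tau> w)"
  by (simp add: chart_eq matrix_vector_right_distrib matrix_vector_mult_scaleR vec_eq_iff field_simps)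

lemma chart_in_tet: "\<xi> \<in> ref_tet \<Longrightarrow> \<tau> \<xi> \<in> tetrahedron e"
  using image by blast

end

lemma chart_exists: "e \<in> cells \<Longrightarrow> cell_chart e \<tau> \<Longrightarrow> \<exists>M b. chart e \<tau> M b"
  unfolding cell_chart_def chart_def by blast

subsection \<open>Gradients of the reference map\<close>


fun node_of :: "nat \<times> nat \<times> nat \<Rightarrow> real^3" where "node_of (i, j, k) = node i j k"

lemma node_nth: "node i j k $ 1 = real i / 4" "node i j k $ 2 = real j / 4" "node i j k $ 3 = real k / 4"
  by (simp_all add: node_def)

text \<open>The triple is the inverse of the path permutation: it tells for each axis the step at
  which that coordinate grows. Columns of gradients are indexed by axes, which makes the inverse the
  convenient encoding.\<close>

fun codes_cell :: "code \<Rightarrow> cell \<Rightarrow> bool" where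
  "codes_cell (c, (p, q, r)) e \<longleftrightarrow>
     (\<forall>m\<in>{0,1,2,3}. \<forall>n\<in>{0,1,2,3}. mid (vert e m) (vert e n) = node_of (mid_node (c, (p, q, r)) m n)) \<and>
     p \<in> {1,2,3} \<and> q \<in> {1,2,3} \<and> r \<in> {1,2,3} \<and>
     vert e p - vert e (p - 1) = (1/2) *\<^sub>R axis 1 1 \<and> vert e q - vert e (q - 1) = (1/2) *\<^sub>R axis 2 1 \<and>
     vert e r - vert e (r - 1) = (1/2) *\<^sub>R axis 3 1"

lemma bij_3_cases:
  fixes p :: "3 \<Rightarrow> 3"
  assumes "bij p"
  obtains "p 1 = 1" "p 2 = 2" "p 3 = 3" | "p 1 = 1" "p 2 = 3" "p 3 = 2" | "p 1 = 2" "p 2 = 1" "p 3 = 3"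
    | "p 1 = 2" "p 2 = 3" "p 3 = 1" | "p 1 = 3" "p 2 = 1" "p 3 = 2" | "p 1 = 3" "p 2 = 2" "p 3 = 1"
proof -
  have "p 1 \<noteq> p 2" "p 1 \<noteq> p 3" "p 2 \<noteq> p 3"
    using assms by (auto simp: bij_def inj_eq)
  then show ?thesis
    using that exhaust_3[of "p 1"] exhaust_3[of "p 2"] exhaust_3[of "p 3"] by metis
qed

lemma cells_cases:
  assumes "e \<in> cells"
  obtains c where "c \<in> set corner_codes" "fst e = node_of c" "bij (snd e)"
proof -
  have "\<exists>k\<in>{0, 2}. fst e $ i = real k / 4" for i
    using assms by (cases e) (auto simp: cells_def)
  then obtain k1 k2 k3 where k: "k1 \<in> {0, 2}" "fst e $ 1 = real k1 / 4" "k2 \<in> {0, 2}" "fst e $ 2 = real k2 / 4"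
     "k3 \<in> {0, 2}" "fst e $ 3 = real k3 / 4"
    by meson
  show ?thesis
  proof (rule that)
    show "(k1, k2, k3) \<in> set corner_codes" using k by (auto simp: corner_codes_def)
    show "fst e = node_of (k1, k2, k3)" using k by (simp add: vec_eq_iff forall_3 node_nth)
    show "bij (snd e)" using assms by (cases e) (auto simp: cells_def)
  qed
qed

lemma codes_cell_exists:
  assumes "e \<in> cells"
  obtains c p where "c \<in> set corner_codes" "p \<in> set path_codes" "codes_cell (c, p) e"
proof -
  obtain c where c: "c \<in> set corner_codes" "fst e = node_of c" "bij (snd e)"
    using cells_cases[OF assms] .
  obtain i j k where ijk: "c = (i, j, k)" by (cases c)
  have f: "fst e = node i j k" using c ijk by simp
  note simps = vert_simps vert_nat_simps step_def vec_eq_iff forall_3 node_nth axis_nth_3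
  from \<open>bij (snd e)\<close> show ?thesis
  proof (cases rule: bij_3_cases)
    case 1
    show ?thesis
      by (rule that[OF c(1), of "(1,2,3)"]) (simp add: path_codes_def, simp add: ijk f 1 simps field_simps)
  next
    case 2
    show ?thesis
      by (rule that[OF c(1), of "(1,3,2)"]) (simp add: path_codes_def, simp add: ijk f 2 simps field_simps)
  next
    case 3
    show ?thesis
      by (rule that[OF c(1), of "(2,1,3)"]) (simp add: path_codes_def, simp add: ijk f 3 simps field_simps)
  next
    case 4
    show ?thesis
      \<comment> \<open>The code is the inverse permutation; it differs from the path itself only
        for the two 3-cycles, here and in the next case.\<close>
      by (rule that[OF c(1), of "(3,1,2)"]) (simp add: path_codes_def, simp add: ijk f 4 simps field_simps)
  next
    case 5
    show ?thesis
      by (rule that[OF c(1), of "(2,3,1)"]) (simp add: path_codes_def, simp add: ijk f 5 simps field_simps)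
  next
    case 6
    show ?thesis
      by (rule that[OF c(1), of "(3,2,1)"]) (simp add: path_codes_def, simp add: ijk f 6 simps field_simps)
  qed
qed

fun vec_of :: "ivec \<Rightarrow> real^3" where "vec_of (a, b, c) = vector [of_int a, of_int b, of_int c]"

lemma vec_of_diff: "vec_of (ivec_diff x y) = vec_of x - vec_of y"
  by (cases x; cases y) (simp add: vec_eq_iff forall_3)

lemma vec_of_add: "vec_of (ivec_add x y) = vec_of x + vec_of y"
  by (cases x; cases y) (simp add: vec_eq_iff forall_3)

lemma ivec_sq: "of_int (ivec_sq x) = (norm (vec_of x))\<^sup>2"
  by (cases x) (simp add: power2_norm_eq_inner inner_vec_def sum_3)

lemma nodal_value_eq: "nodal_value i j k = vec_of (table_value (i, j, k))"
  by (auto simp: nodal_value_def table_value_def vec_eq_iff forall_3 split: option.split)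

lemma table_value_even:
  assumes "i \<in> {0,2,4}" "j \<in> {0,2,4}" "k \<in> {0,2,4}"
  shows "table_value (i, j, k) = (0, 0, 0)"
proof -
  have "list_all (\<lambda>((i, j, k), v). odd i \<or> odd j \<or> odd k) nodal_table"
    by (simp add: nodal_table_def)
  moreover have "even i" "even j" "even k" using assms by auto
  ultimately have "(i, j, k) \<notin> fst ` set nodal_table"
    by (fastforce simp: list_all_iff)
  then have "map_of nodal_table (i, j, k) = None"
    by (simp add: map_of_eq_None_iff)
  then show ?thesis by (simp add: table_value_def)
qed

lemma nodal_jac_corner:
  assumes "l \<in> ref_corners" "l' \<in> ref_corners"
  shows "nodal_jac f \<xi> *v (l - l') = slope f \<xi> l - slope f \<xi> l'"
proof -
  have *: "nodal_jac f \<xi> *v l = slope f \<xi> l - slope f \<xi> 0" if "l \<in> ref_corners" for l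
  proof -
    have "nodal_jac f \<xi> *v axis j 1 = slope f \<xi> (axis j 1) - slope f \<xi> 0" for j
      by (simp add: nodal_jac_def matrix_vector_mult_basis column_def vec_eq_iff)
    then show ?thesis using that unfolding ref_corners_def by (elim insertE emptyE) simp_all
  qed
  show ?thesis using assms by (simp add: matrix_vector_mult_diff_distrib *)
qed

locale mesh_cell = chart +
  fixes a :: "real^3 \<Rightarrow> real^3"
  assumes nodal: "nodal_field a"
begin

lemma mid_value:
  assumes "codes_cell (c, p) e" "c \<in> set corner_codes" "m \<in> {0,1,2,3}" "n \<in> {0,1,2,3}"
  shows "a (mid (vert e m) (vert e n)) = vec_of (pick (cell_mids (c, p)) m n)"
proof -
  obtain c1 c2 c3 p1 p2 p3 where cp: "c = (c1, c2, c3)" "p = (p1, p2, p3)" by (metis prod_cases3)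
  have cc: "c1 \<in> {0,2}" "c2 \<in> {0,2}" "c3 \<in> {0,2}"
    using assms(2) by (auto simp: cp corner_codes_def)
  have st: "step q k \<le> 1" for q k by (simp add: step_def)
  obtain i j k where ijk: "mid_node (c, p) m n = (i, j, k)" by (metis prod_cases3)
  have eq: "i = c1 + (step p1 m + step p1 n)" "j = c2 + (step p2 m + step p2 n)" "k = c3 + (step p3 m + step p3 n)"
    using ijk by (simp_all add: cp)
  have "c1 \<le> 2" "c2 \<le> 2" "c3 \<le> 2" using cc by auto
  then have le: "i \<le> 4" "j \<le> 4" "k \<le> 4"
    using st[of p1 m] st[of p1 n] st[of p2 m] st[of p2 n] st[of p3 m] st[of p3 n] unfolding eq by linarith+
  have "mid (vert e m) (vert e n) = node_of (mid_node (c, p) m n)"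
    using assms(1,3,4) unfolding cp codes_cell.simps by blast
  then have "mid (vert e m) (vert e n) = node i j k"
    by (simp only: ijk node_of.simps)
  then have *: "a (mid (vert e m) (vert e n)) = vec_of (table_value (mid_node (c, p) m n))"
    using nodal le unfolding nodal_field_def by (simp add: nodal_value_eq ijk)
  show ?thesis
  proof (cases "m = n")
    case True
    have "i \<in> {0,2,4}" "j \<in> {0,2,4}" "k \<in> {0,2,4}"
      using cc unfolding eq True by (auto simp: step_def)
    then have "table_value (mid_node (c, p) m n) = (0, 0, 0)"
      by (simp only: ijk table_value_even)
    then show ?thesis using * True by (simp add: cell_mids_def)
  next
    case False
    then have "table_value (mid_node (c, p) m n) = pick (cell_mids (c, p)) m n"
      using assms(3,4) by (auto simp: cell_mids_def cp add.commute)
    then show ?thesis using * by simp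
  qed
qed

lemma vert_value:
  assumes "v \<in> verts e"
  shows "a v = 0"
proof -
  obtain c p where cp: "c \<in> set corner_codes" "codes_cell (c, p) e"
    using codes_cell_exists[OF cell] by blast
  obtain n where n: "n \<in> {0,1,2,3}" "v = vert e n"
    using assms by (auto simp: verts_def)
  have "a v = vec_of (pick (cell_mids (c, p)) n n)"
    using mid_value[OF cp(2,1) n(1) n(1)] by (simp only: n(2) mid_self)
  then show ?thesis
    by (simp add: cell_mids_def vec_eq_iff forall_3)
qed

lemma quadratic_chart: "quadratic_on ref_tet \<tau>"
  using quadratic_on_affine[of ref_tet M b] by (simp add: chart_eq[abs_def])

lemma quadratic_field: "quadratic_on ref_tet (\<lambda>\<xi>. a (\<tau> \<xi>))"
  unfolding chart_eq
  by (rule quadratic_on_compose_affine[where T = "tetrahedron e"])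
    (use nodal cell chart_in_tet chart_eq in \<open>auto simp: nodal_field_def\<close>)

lemma quadratic_ref_map: "quadratic_on ref_tet (ref_map a \<circ> \<tau>)"
  unfolding o_def ref_map_def by (intro quadratic_on_add quadratic_on_scaleR quadratic_chart quadratic_field)

text \<open>Gradient of the nodal field with respect to t, the chart being divided out. The gradient
  of the reference map is the identity plus 7/3768 times \<open>E\<close>, and its inverse at a
  quadrature point is the matrix \<open>P\<close> of the stability form.\<close>

definition E :: "real^3 \<Rightarrow> real^3^3" where
  "E \<xi> = nodal_jac (\<lambda>\<xi>. a (\<tau> \<xi>)) \<xi> ** matrix_inv M"

lemma M_inverse: "matrix_inv M ** M = mat 1" "M ** matrix_inv M = mat 1"
  using det_pos by (simp_all add: matrix_inv_mult)

lemma jac_ref_map: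
  assumes "smooth_point \<xi>"
  shows "jac (ref_map a \<circ> \<tau>) \<xi> = (mat 1 + (7/3768) *\<^sub>R E \<xi>) ** M"
proof -
  have "jac (ref_map a \<circ> \<tau>) \<xi> = jac \<tau> \<xi> + (7/3768) *\<^sub>R jac (\<lambda>\<xi>. a (\<tau> \<xi>)) \<xi>"
    unfolding o_def ref_map_def by (rule jac_add_scale[OF quadratic_chart quadratic_field assms])
  moreover have "jac \<tau> \<xi> = M"
    using jac_affine[OF assms, of M b] by (simp add: chart_eq[abs_def])
  ultimately show ?thesis
    by (simp add: jac_eq_nodal_jac[OF quadratic_field assms] matrix_add_rdistrib E_def scaleR_matrix_mult_left
        matrix_mul_assoc[symmetric] M_inverse)
qed

definition corner_slope :: "real^3 \<Rightarrow> real^3 \<Rightarrow> real^3" where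
  "corner_slope z v = ((5 - sqrt 5) / 5) *\<^sub>R (\<Sum>y\<in>verts e. a (mid v y)) + (4 * sqrt 5 / 5) *\<^sub>R a (mid v z)"

lemma E_corner:
  assumes "l \<in> ref_corners" "l' \<in> ref_corners"
  shows "E \<xi> *v (\<tau> l - \<tau> l') = slope (\<lambda>\<xi>. a (\<tau> \<xi>)) \<xi> l - slope (\<lambda>\<xi>. a (\<tau> \<xi>)) \<xi> l'"
proof -
  have "\<tau> l - \<tau> l' = M *v (l - l')"
    by (simp add: chart_eq matrix_vector_mult_diff_distrib)
  then have "E \<xi> *v (\<tau> l - \<tau> l') = nodal_jac (\<lambda>\<xi>. a (\<tau> \<xi>)) \<xi> *v (l - l')"
    by (simp add: E_def matrix_vector_mul_assoc matrix_mul_assoc[symmetric] M_inverse)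
  then show ?thesis by (simp add: nodal_jac_corner[OF assms])
qed

text \<open>The right-hand side mentions vertices of the mesh only. Of the unknown order of the
  corners nothing remains except which vertex corresponds to \<open>w\<close>.\<close>

lemma E_quad_point:
  assumes "w \<in> ref_corners" "v \<in> verts e" "v' \<in> verts e"
  shows "E (quad_point w) *v (v - v') = corner_slope (\<tau> w) v - corner_slope (\<tau> w) v'"
proof -
  have "slope (\<lambda>\<xi>. a (\<tau> \<xi>)) (quad_point w) l = corner_slope (\<tau> w) (\<tau> l)" if "l \<in> ref_corners" for l
    unfolding slope_quad_point[OF assms(1)] corner_slope_def chart_midpoint sum_verts
    using vert_value chart_corner that by simp
  moreover obtain l l' where "l \<in> ref_corners" "l' \<in> ref_corners" "v = \<tau> l" "v' = \<tau> l'"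
    using assms(2,3) unfolding chart_corners[symmetric] by auto
  ultimately show ?thesis by (simp add: E_corner)
qed

lemma distinct_verts: "distinct [vert e 0, vert e 1, vert e 2, vert e 3]"
  using card_verts card_distinct[of "[vert e 0, vert e 1, vert e 2, vert e 3]"] by (simp add: verts_def)

lemma sum_verts_nat: "(\<Sum>v\<in>verts e. f v) = f (vert e 0) + (f (vert e 1) + (f (vert e 2) + f (vert e 3)))"
  for f :: "real^3 \<Rightarrow> 'b::comm_monoid_add"
  using distinct_verts by (simp add: verts_def)

lemma E_column:
  assumes "codes_cell (c, p) e" "c \<in> set corner_codes" "w \<in> ref_corners" "m \<in> {0,1,2,3}" "\<tau> w = vert e m"
    "k \<in> {1,2,3}" "vert e k - vert e (k - 1) = (1/2) *\<^sub>R axis j 1"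
  shows "E (quad_point w) *v axis j 1 = 2 *\<^sub>R (((5 - sqrt 5) / 5) *\<^sub>R vec_of (edge_sum (cell_mids (c, p)) k) +
     (4 * sqrt 5 / 5) *\<^sub>R vec_of (edge_diff (cell_mids (c, p)) k m))"
proof -
  have k: "k \<in> {0,1,2,3}" "k - 1 \<in> {0,1,2,3}" using assms(6) by auto
  then have v: "vert e k \<in> verts e" "vert e (k - 1) \<in> verts e" by (auto simp: verts_def)
  have "E (quad_point w) *v ((1/2) *\<^sub>R axis j 1) = corner_slope (vert e m) (vert e k) - corner_slope (vert e m) (vert e (k - 1))"
    using E_quad_point[OF assms(3) v] unfolding assms(5) assms(7) .
  then have "E (quad_point w) *v axis j 1 = 2 *\<^sub>R (corner_slope (vert e m) (vert e k) - corner_slope (vert e m) (vert e (k - 1)))"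
    by (simp add: matrix_vector_mult_scaleR) (metis scaleR_half_double scaleR_2 scaleR_scaleR mult.commute)
  moreover have "corner_slope (vert e m) (vert e n) = ((5 - sqrt 5) / 5) *\<^sub>R (vec_of (pick (cell_mids (c, p)) n 0) +
      (vec_of (pick (cell_mids (c, p)) n 1) + (vec_of (pick (cell_mids (c, p)) n 2) + vec_of (pick (cell_mids (c, p)) n 3)))) +
      (4 * sqrt 5 / 5) *\<^sub>R vec_of (pick (cell_mids (c, p)) n m)" if "n \<in> {0,1,2,3}" for n
    unfolding corner_slope_def sum_verts_nat
    using that assms(4) by (simp only: mid_value[OF assms(1,2)] insert_iff simp_thms)
  note sl = this
  ultimately show ?thesis
    unfolding edge_sum_def edge_diff_def sl[OF k(1)] sl[OF k(2)]
    by (simp add: vec_of_diff vec_of_add scaleR_right_diff_distrib scaleR_right_distrib)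
qed

end

section \<open>From integer pairs to real matrices\<close>

fun q5_real :: "q5 \<Rightarrow> real" where "q5_real (a, b) = of_int a + of_int b * sqrt 5"

lemma q5_real_diff: "q5_real (q5_diff x y) = q5_real x - q5_real y"
  by (cases x; cases y) (simp add: algebra_simps)

lemma q5_real_add: "q5_real (q5_add x y) = q5_real x + q5_real y"
  by (cases x; cases y) (simp add: algebra_simps)

lemma q5_real_scale: "q5_real (q5_scale k x) = of_int k * q5_real x"
  by (cases x) (simp add: algebra_simps)

lemma q5_real_mult: "q5_real (q5_mult x y) = q5_real x * q5_real y"
  by (cases x; cases y) (simp add: algebra_simps)

lemma q5_real_minor: "q5_real (q5_minor a b c d) = q5_real a * q5_real d - q5_real b * q5_real c"
  by (simp add: q5_minor_def q5_real_diff q5_real_mult)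

lemma sqrt_5_bounds: "22360679 < 10000000 * sqrt 5" "10000000 * sqrt 5 < 22360680"
proof -
  have "22360679 / 10000000 < sqrt (5::real)"
    by (rule real_less_rsqrt) (simp add: power2_eq_square)
  moreover have "sqrt 5 < 22360680 / (10000000::real)"
    by (rule real_less_lsqrt) (simp_all add: power2_eq_square)
  ultimately show "22360679 < 10000000 * sqrt 5" "10000000 * sqrt 5 < 22360680" by auto
qed

lemma q5_real_pos: "q5_pos x \<Longrightarrow> 0 < q5_real x"
proof (cases x)
  case (Pair a b)
  assume "q5_pos x"
  have 1: "real_of_int b * 22360679 \<le> real_of_int b * (10000000 * sqrt 5)" if "0 \<le> b"
    using that sqrt_5_bounds by (intro mult_left_mono) auto
  have 2: "real_of_int b * 22360680 \<le> real_of_int b * (10000000 * sqrt 5)" if "\<not> 0 \<le> b"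
    using that sqrt_5_bounds by (intro mult_left_mono_neg) auto
  have 3: "0 < 10000000 * real_of_int a + 22360679 * real_of_int b" if "0 \<le> b"
    using \<open>q5_pos x\<close> that by (simp add: Pair; linarith)
  have 4: "0 < 10000000 * real_of_int a + 22360680 * real_of_int b" if "\<not> 0 \<le> b"
    using \<open>q5_pos x\<close> that by (simp add: Pair; linarith)
  have "0 < 10000000 * real_of_int a + real_of_int b * (10000000 * sqrt 5)"
  proof (cases "0 \<le> b")
    case True
    then show ?thesis using 1 3 by linarith
  next
    case False
    then show ?thesis using 2 4 by linarith
  qed
  then show ?thesis by (simp add: Pair)
qed

fun q5_mat :: "q5mat \<Rightarrow> real^3^3" where
  "q5_mat ((a, b, c), (d, e, f), (g, h, i)) =
     vector [vector [q5_real a, q5_real b, q5_real c], vector [q5_real d, q5_real e, q5_real f],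
       vector [q5_real g, q5_real h, q5_real i]]"

fun int_mat :: "ivec \<times> ivec \<times> ivec \<Rightarrow> real^3^3" where "int_mat (a, b, c) = vector [vec_of a, vec_of b, vec_of c]"

lemma q5_mat_cases:
  fixes Y :: q5mat
  obtains a b c d e f g h i where "Y = ((a, b, c), (d, e, f), (g, h, i))"
  by (metis prod_cases3)

lemma q5_mat_cof: "q5_mat (q5_cof Y) = cof (q5_mat Y)"
  by (cases Y rule: q5_mat_cases) (simp add: mat3_eq_iff cof_nth q5_real_minor)

lemma q5_mat_det: "q5_real (q5_row_mult (fst Y) (fst (q5_cof Y))) = det (q5_mat Y)"
  by (cases Y rule: q5_mat_cases) (simp add: det_3 q5_real_minor q5_real_add q5_real_mult algebra_simps)

lemma q5_real_dev: "q5_real (q5_dev D x k) = (942000 * q5_real x - of_int k * q5_real D)\<^sup>2"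
  by (simp add: q5_dev.simps Let_def q5_real_mult q5_real_diff q5_real_scale power2_eq_square)

lemma q5_real_dist:
  "q5_real (q5_dist D Y K) = frob (942000 *\<^sub>R transpose (q5_mat Y) - q5_real D *\<^sub>R int_mat K)
     (942000 *\<^sub>R transpose (q5_mat Y) - q5_real D *\<^sub>R int_mat K)"
proof (cases Y rule: q5_mat_cases)
  case (1 a b c d e f g h i)
  obtain k11 k12 k13 k21 k22 k23 k31 k32 k33 where K: "K = ((k11, k12, k13), (k21, k22, k23), (k31, k32, k33))"
    by (metis prod_cases3)
  show ?thesis
    unfolding 1 K frob_expand
    by (simp add: transpose_nth q5_real_add q5_real_dev power2_eq_square mult.commute del: q5_dev.simps)
qed

lemma near_centre_bound:
  assumes "near_centre D (q5_cof Y) (K, R)" "0 < q5_real D" "q5_real D = det (q5_mat Y)"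
    "X = (1/9420) *\<^sub>R q5_mat Y" "P ** X = mat 1"
  shows "64 * frob (P - (1/100) *\<^sub>R int_mat K) (P - (1/100) *\<^sub>R int_mat K) \<le> 3 * (of_int R / 1000)\<^sup>2"
proof -
  define d where "d = q5_real D"
  define T where "T = 942000 *\<^sub>R transpose (cof (q5_mat Y)) - d *\<^sub>R int_mat K"
  have "0 < q5_real (q5_diff (q5_scale (3 * R\<^sup>2) (q5_mult D D)) (q5_scale 6400 (q5_dist D (q5_cof Y) K)))"
    using assms(1) by (intro q5_real_pos) simp
  then have ineq: "6400 * frob T T \<le> 3 * (of_int R)\<^sup>2 * (d * d)"
    by (simp add: q5_real_diff q5_real_scale q5_real_mult q5_real_dist q5_mat_cof T_def d_def)
  \<comment> \<open>The inserted factor is the identity by the adjugate formula; regrouping it with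
    the left inverse \<open>P\<close> identifies \<open>P\<close> as a scaled adjugate.\<close>
  have "P = P ** ((1/9420) *\<^sub>R (q5_mat Y ** ((9420 / d) *\<^sub>R transpose (cof (q5_mat Y)))))"
    using assms(2,3) by (simp add: scaleR_matrix_mult_right cof_transpose_mult d_def)
  also have "\<dots> = (P ** X) ** ((9420 / d) *\<^sub>R transpose (cof (q5_mat Y)))"
    by (simp only: assms(4) scaleR_matrix_mult_left[symmetric] matrix_mul_assoc)
  finally have P: "P = (9420 / d) *\<^sub>R transpose (cof (q5_mat Y))"
    by (simp add: assms(5))
  have "P - (1/100) *\<^sub>R int_mat K = (1 / (100 * d)) *\<^sub>R T"
    using assms(2) unfolding P T_def by (simp add: scaleR_diff_right d_def)
  then have "64 * frob (P - (1/100) *\<^sub>R int_mat K) (P - (1/100) *\<^sub>R int_mat K) = 6400 * frob T T / (1000000 * (d * d))"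
    by (simp add: frob_eq_inner)
  also have "\<dots> \<le> 3 * (of_int R)\<^sup>2 * (d * d) / (1000000 * (d * d))"
    using ineq by (rule divide_right_mono) simp
  also have "\<dots> = 3 * (of_int R / 1000)\<^sup>2"
    using assms(2) by (simp add: d_def power2_eq_square)
  finally show ?thesis .
qed

definition stable_centre :: "real^3^3 \<Rightarrow> real \<Rightarrow> bool" where
  "stable_centre C R \<longleftrightarrow> 0 \<le> R \<and> (\<forall>s K. \<bar>s\<bar> \<le> 1/4 \<longrightarrow> 0 \<le> stability_form C R s K)"

lemma centre_table_stable: "list_all (\<lambda>(K, R). stable_centre ((1/100) *\<^sub>R int_mat K) (of_int R / 1000)) centre_table"
proof -
  have "(1/100) *\<^sub>R int_mat ((100, 0, 0), (0, 100, 0), (0, 0, 100)) = centre0"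
    "(1/100) *\<^sub>R int_mat ((122, -27, -9), (-30, 137, 15), (1, 7, 103)) = centre1"
    "(1/100) *\<^sub>R int_mat ((120, -10, -20), (-20, 110, 0), (0, 0, 100)) = centre2"
    "(1/100) *\<^sub>R int_mat ((100, 0, 0), (0, 100, -20), (0, -20, 100)) = centre3"
    by (simp_all add: mat3_eq_iff centre0_def centre1_def centre2_def centre3_def mat_1_nth)
  then show ?thesis
    by (simp add: centre_table_def stable_centre_def centre_stable del: int_mat.simps)
qed

context mesh_cell
begin

definition X :: "real^3 \<Rightarrow> real^3^3" where
  "X w = mat 1 + (7/3768) *\<^sub>R E (quad_point w)"


lemma X_eq_code:
  assumes "codes_cell (c, p) e" "c \<in> set corner_codes" "w \<in> ref_corners" "m \<in> {0,1,2,3}" "\<tau> w = vert e m"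
  shows "X w = (1/9420) *\<^sub>R q5_mat (gradient_code p m (cell_mids (c, p)))"
proof -
  obtain p1 p2 p3 where p: "p = (p1, p2, p3)" by (metis prod_cases3)
  define col where "col k = (35::real) *\<^sub>R vec_of (edge_sum (cell_mids (c, p)) k) +
    sqrt 5 *\<^sub>R ((28::real) *\<^sub>R vec_of (edge_diff (cell_mids (c, p)) k m) - (7::real) *\<^sub>R vec_of (edge_sum (cell_mids (c, p)) k))" for k
  have E: "E (quad_point w) $ i $ j = (2 / 35) * col k $ i"
    if "k \<in> {1,2,3}" "vert e k - vert e (k - 1) = (1/2) *\<^sub>R axis j 1" for i j k
  proof -
    have "E (quad_point w) $ i $ j = (E (quad_point w) *v axis j 1) $ i"
      by (simp add: matrix_vector_mult_basis column_def)
    then show ?thesis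
      unfolding E_column[OF assms that] col_def by (simp add: field_simps)
  qed
  have pk: "p1 \<in> {1,2,3}" "p2 \<in> {1,2,3}" "p3 \<in> {1,2,3}"
    "vert e p1 - vert e (p1 - 1) = (1/2) *\<^sub>R axis 1 1"
    "vert e p2 - vert e (p2 - 1) = (1/2) *\<^sub>R axis 2 1"
    "vert e p3 - vert e (p3 - 1) = (1/2) *\<^sub>R axis 3 1"
    using assms(1) unfolding p codes_cell.simps by blast+
  have code: "\<exists>x y z. q5_column (edge_sum (cell_mids (c, p)) k) (edge_diff (cell_mids (c, p)) k m) = (x, y, z) \<and>
      col k $ 1 = q5_real x \<and> col k $ 2 = q5_real y \<and> col k $ 3 = q5_real z" for k
    by (cases "edge_sum (cell_mids (c, p)) k"; cases "edge_diff (cell_mids (c, p)) k m") (simp add: col_def algebra_simps)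
  obtain x1 y1 z1 x2 y2 z2 x3 y3 z3 where
    "q5_column (edge_sum (cell_mids (c, p)) p1) (edge_diff (cell_mids (c, p)) p1 m) = (x1, y1, z1)"
    "col p1 $ 1 = q5_real x1" "col p1 $ 2 = q5_real y1" "col p1 $ 3 = q5_real z1"
    "q5_column (edge_sum (cell_mids (c, p)) p2) (edge_diff (cell_mids (c, p)) p2 m) = (x2, y2, z2)"
    "col p2 $ 1 = q5_real x2" "col p2 $ 2 = q5_real y2" "col p2 $ 3 = q5_real z2"
    "q5_column (edge_sum (cell_mids (c, p)) p3) (edge_diff (cell_mids (c, p)) p3 m) = (x3, y3, z3)"
    "col p3 $ 1 = q5_real x3" "col p3 $ 2 = q5_real y3" "col p3 $ 3 = q5_real z3"
    using code by meson
  then show ?thesis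
    by (simp add: mat3_eq_iff X_def mat_1_nth p q5_real_add E[OF pk(1,4)] E[OF pk(2,5)] E[OF pk(3,6)])
qed

lemma X_stable:
  assumes "w \<in> ref_corners"
  shows "0 < det (X w)"
    and "\<exists>C R. stable_centre C R \<and> 64 * frob (matrix_inv (X w) - C) (matrix_inv (X w) - C) \<le> 3 * R\<^sup>2"
proof -
  obtain c p where cp: "c \<in> set corner_codes" "p \<in> set path_codes" "codes_cell (c, p) e"
    using codes_cell_exists[OF cell] .
  obtain m where m: "m \<in> {0,1,2,3}" "\<tau> w = vert e m"
    using chart_corner[OF assms] by (auto simp: verts_def)
  define Y where "Y = gradient_code p m (cell_mids (c, p))"
  have X: "X w = (1/9420) *\<^sub>R q5_mat Y"
    unfolding Y_def by (rule X_eq_code[OF cp(3,1) assms m])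
  have "cell_ok (c, p)"
    using cell_ok_all cp(1,2) by (auto simp: list_all_iff)
  then have "q5_check Y"
    using m(1) by (auto simp: cell_ok_def mids_ok_def point_ok_def Y_def)
  define D where "D = q5_row_mult (fst Y) (fst (q5_cof Y))"
  have D: "q5_real D = det (q5_mat Y)" unfolding D_def by (rule q5_mat_det)
  have chk: "q5_pos D" "list_ex (near_centre D (q5_cof Y)) centre_table"
    using \<open>q5_check Y\<close> by (cases Y; auto simp: D_def)+
  have pos: "0 < q5_real D" by (rule q5_real_pos[OF chk(1)])
  have "det (X w) = (1/9420)^3 * det (q5_mat Y)"
    unfolding X by (simp add: det_3 power3_eq_cube algebra_simps)
  then show dX: "0 < det (X w)" using pos D by simp
  obtain K R where KR: "(K, R) \<in> set centre_table" "near_centre D (q5_cof Y) (K, R)"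
    using chk(2) by (auto simp: list_ex_iff)
  have "64 * frob (matrix_inv (X w) - (1/100) *\<^sub>R int_mat K) (matrix_inv (X w) - (1/100) *\<^sub>R int_mat K) \<le> 3 * (of_int R / 1000)\<^sup>2"
    by (rule near_centre_bound[OF KR(2) pos D X]) (use dX in \<open>simp add: matrix_inv_mult\<close>)
  moreover have "stable_centre ((1/100) *\<^sub>R int_mat K) (of_int R / 1000)"
    using centre_table_stable KR(1) by (auto simp: list_all_iff)
  ultimately show "\<exists>C R. stable_centre C R \<and> 64 * frob (matrix_inv (X w) - C) (matrix_inv (X w) - C) \<le> 3 * R\<^sup>2"
    by blast
qed

end

subsection \<open>Invertibility of the cell maps\<close>


lemma norm_matrix_vector_le: "norm (A *v x) \<le> norm A * norm x" for A :: "real^'n^'m"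
proof (rule power2_le_imp_le)
  have "(norm (A *v x))\<^sup>2 = (\<Sum>i\<in>UNIV. (A$i \<bullet> x)\<^sup>2)"
    unfolding power2_norm_eq_inner inner_vec_def[of "A *v x"]
    by (simp add: matrix_vector_mult_def inner_vec_def power2_eq_square)
  also have "\<dots> \<le> (\<Sum>i\<in>UNIV. (norm (A$i))\<^sup>2 * (norm x)\<^sup>2)"
    by (rule sum_mono) (metis Cauchy_Schwarz_ineq power2_norm_eq_inner)
  also have "\<dots> = (norm A * norm x)\<^sup>2"
    by (simp add: power2_norm_eq_inner inner_vec_def[of A] sum_distrib_right power_mult_distrib)
  finally show "(norm (A *v x))\<^sup>2 \<le> (norm A * norm x)\<^sup>2" .
qed simp

lemma det_mat_1_add_nonzero:
  fixes A :: "real^'n^'n"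
  assumes "norm A < 1"
  shows "det (mat 1 + A) \<noteq> 0"
proof -
  have "x = 0" if "(mat 1 + A) *v x = 0" for x
  proof (rule ccontr)
    assume "x \<noteq> 0"
    have "norm x = norm (A *v x)"
      using that by (simp add: matrix_vector_mult_add_rdistrib eq_neg_iff_add_eq_0[symmetric]) (metis norm_minus_cancel)
    also have "\<dots> \<le> norm A * norm x" by (rule norm_matrix_vector_le)
    also have "\<dots> < norm x" using assms \<open>x \<noteq> 0\<close> by simp
    finally show False by simp
  qed
  then show ?thesis
    by (simp add: invertible_det_nz[symmetric] invertible_left_inverse matrix_left_invertible_ker)
qed

lemma norm_mat3: "(norm A)\<^sup>2 = (norm (A *v axis 1 1))\<^sup>2 + (norm (A *v axis 2 1))\<^sup>2 + (norm (A *v axis 3 1))\<^sup>2"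
  for A :: "real^3^3"
  by (simp add: power2_norm_eq_inner matrix_vector_mult_basis column_def inner_vec_def sum_3)

definition bary :: "real^3 \<Rightarrow> real^3 \<Rightarrow> real" where
  "bary \<xi> l = (if l = 0 then 1 - \<xi>$1 - \<xi>$2 - \<xi>$3 else l \<bullet> \<xi>)"

lemma bary_simps: "bary \<xi> 0 = 1 - \<xi>$1 - \<xi>$2 - \<xi>$3" "bary \<xi> (axis j 1) = \<xi>$j"
  by (auto simp: bary_def axis_distinct inner_axis')

lemma bary_sum: "(\<Sum>l\<in>ref_corners. bary \<xi> l) = 1"
  by (simp add: sum_ref_corners bary_simps)

lemma bary_nonneg: "\<xi> \<in> ref_tet \<Longrightarrow> l \<in> ref_corners \<Longrightarrow> 0 \<le> bary \<xi> l"
  by (auto simp: ref_corners_def bary_simps ref_tet_iff)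

lemma slope_corner: "l \<in> ref_corners \<Longrightarrow> slope f l v = 4 *\<^sub>R f (mid v l) - f v"
  by (auto simp: ref_corners_def slope_def axis_nth_3 simp del: scaleR_right_distrib)

lemma slope_eq_sum: "slope f \<xi> v = 4 *\<^sub>R (\<Sum>l\<in>ref_corners. bary \<xi> l *\<^sub>R f (mid v l)) - f v"
  by (simp add: slope_def sum_ref_corners bary_simps del: scaleR_right_distrib)

lemma slope_bary: "slope f \<xi> v = (\<Sum>l\<in>ref_corners. bary \<xi> l *\<^sub>R slope f l v)"
proof -
  have "(\<Sum>l\<in>ref_corners. bary \<xi> l *\<^sub>R slope f l v) =
      (\<Sum>l\<in>ref_corners. 4 *\<^sub>R (bary \<xi> l *\<^sub>R f (mid v l)) - bary \<xi> l *\<^sub>R f v)"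
    by (intro sum.cong refl) (simp only: slope_corner scaleR_diff_right scaleR_left_commute)
  also have "\<dots> = 4 *\<^sub>R (\<Sum>l\<in>ref_corners. bary \<xi> l *\<^sub>R f (mid v l)) - f v"
    by (simp only: sum_subtractf scaleR_sum_right[symmetric] scaleR_sum_left[symmetric] bary_sum scaleR_one)
  finally show ?thesis by (simp only: slope_eq_sum)
qed

lemma nodal_jac_bary: "nodal_jac f \<xi> = (\<Sum>l\<in>ref_corners. bary \<xi> l *\<^sub>R nodal_jac f l)"
  by (simp add: vec_eq_iff nodal_jac_def slope_bary[of f \<xi>] right_diff_distrib sum_subtractf)

lemma quadratic_nodal_sum:
  assumes "quadratic_on ref_tet f" "\<xi> \<in> ref_tet"
  shows "f \<xi> = (1/2) *\<^sub>R (\<Sum>l\<in>ref_corners. bary \<xi> l *\<^sub>R (slope f \<xi> l - f l))"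
  unfolding sum_ref_corners bary_simps by (rule quadratic_nodal_value[OF assms])

text \<open>The gradient of a quadratic is affine and the four quadrature points are affinely
  independent, so it vanishes throughout. The proof solves the corresponding linear system for the
  nodal values.\<close>

lemma quadratic_constant:
  assumes "quadratic_on ref_tet f" "\<And>w. w \<in> ref_corners \<Longrightarrow> nodal_jac f (quad_point w) = 0" "\<xi> \<in> ref_tet"
  shows "f \<xi> = f 0"
proof -
  define d where "d l w = f (mid l w) - f ((1/2) *\<^sub>R w)" for l w
  have eq: "((5 - sqrt 5) / 5) *\<^sub>R (\<Sum>y\<in>ref_corners. d l y) + (4 * sqrt 5 / 5) *\<^sub>R d l w = f l - f 0"
    if "l \<in> ref_corners" "w \<in> ref_corners" for l w
  proof -
    have "slope f (quad_point w) l - slope f (quad_point w) 0 = nodal_jac f (quad_point w) *v (l - 0)"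
      by (rule nodal_jac_corner[symmetric]) (use that in \<open>auto simp: ref_corners_def\<close>)
    then have "slope f (quad_point w) l = slope f (quad_point w) 0"
      using assms(2)[OF that(2)] by simp
    then show ?thesis
      unfolding slope_quad_point[OF that(2)] d_def
      by (simp add: sum_subtractf scaleR_diff_right algebra_simps)
  qed
  have mem: "0 \<in> ref_corners" "axis j 1 \<in> ref_corners" for j
    using exhaust_3[of j] by (auto simp: ref_corners_def)
  \<comment> \<open>Only the last term on the left of \<open>eq\<close> depends on \<open>w\<close>,
    so comparing the equations for \<open>w\<close> and for 0 isolates it.\<close>
  have d0: "d l w = d l 0" if "l \<in> ref_corners" "w \<in> ref_corners" for l w
  proof -
    show ?thesis
      using trans[OF eq[OF that] eq[OF that(1) mem(1), symmetric]] by simp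
  qed
  have "d l 0 = 0" if l: "l \<in> ref_corners" for l
  proof -
    have "(\<Sum>y\<in>ref_corners. d l y) = 4 *\<^sub>R d l 0"
      using d0[OF l] by (simp add: card_ref_corners sum_constant_scaleR del: sum_constant)
    then have "f l - f 0 = ((5 - sqrt 5) / 5 * 4 + 4 * sqrt 5 / 5) *\<^sub>R d l 0"
      using eq[OF l mem(1)] by (simp only: scaleR_left_distrib scaleR_scaleR)
    also have "(5 - sqrt 5) / 5 * 4 + 4 * sqrt 5 / 5 = 4" by (simp add: field_simps)
    finally have "f l - f 0 = 4 *\<^sub>R d l 0" .
    \<comment> \<open>By the definition of \<open>d\<close> the middle terms cancel. As
      \<open>d l l = d l 0\<close>, the difference is both twice and four times
      \<open>d l 0\<close>, which must vanish.\<close>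
    moreover have "f l - f 0 = d l l + d l 0"
      by (simp add: d_def mid_self)
    ultimately have "d l 0 + d l 0 = 4 *\<^sub>R d l 0"
      using d0[OF l l] by simp
    then show ?thesis by (simp add: scaleR_2[symmetric])
  qed
  then have d: "f (mid l w) = f ((1/2) *\<^sub>R w)" if "l \<in> ref_corners" "w \<in> ref_corners" for l w
    using d0[OF that] that unfolding d_def by simp
  have h0: "f ((1/2) *\<^sub>R l) = f 0" if "l \<in> ref_corners" for l
    using d[OF that mem(1)] by simp
  have *: "f (mid l w) = f 0" if "l \<in> ref_corners" "w \<in> ref_corners" for l w
    using d[OF that] h0[OF that(2)] by simp
  have c: "f l = f 0" if "l \<in> ref_corners" for l
    using *[OF that that] by (simp add: mid_self)
  have slope: "slope f \<xi> l = 4 *\<^sub>R f 0 - f 0" if "l \<in> ref_corners" for l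
  proof -
    have "(\<Sum>y\<in>ref_corners. bary \<xi> y *\<^sub>R f (mid l y)) = (\<Sum>y\<in>ref_corners. bary \<xi> y *\<^sub>R f 0)"
      by (rule sum.cong) (simp_all only: *[OF that])
    also have "\<dots> = f 0" by (simp only: scaleR_sum_left[symmetric] bary_sum scaleR_one)
    finally show ?thesis unfolding slope_eq_sum by (simp only: c[OF that])
  qed
  have "f \<xi> = (1/2) *\<^sub>R (\<Sum>l\<in>ref_corners. bary \<xi> l *\<^sub>R (2 *\<^sub>R f 0))"
    unfolding quadratic_nodal_sum[OF assms(1,3)]
    by (intro arg_cong[of _ _ "(*\<^sub>R) (1/2)"] sum.cong refl) (simp add: slope c, simp add: vec_eq_iff)
  then show ?thesis
    by (simp add: scaleR_sum_left[symmetric] sum_distrib_right[symmetric] bary_sum)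
qed

context mesh_cell
begin

lemma norm_E_corner:
  assumes "w \<in> ref_corners"
  shows "norm ((7/3768) *\<^sub>R E w) < 1"
proof -
  obtain c p where cp: "c \<in> set corner_codes" "p \<in> set path_codes" "codes_cell (c, p) e"
    using codes_cell_exists[OF cell] .
  obtain m where m: "m \<in> {0,1,2,3}" "\<tau> w = vert e m"
    using chart_corner[OF assms] by (auto simp: verts_def)
  obtain p1 p2 p3 where p: "p = (p1, p2, p3)" by (metis prod_cases3)
  have col: "E w *v axis j 1 = 8 *\<^sub>R vec_of (edge_diff (cell_mids (c, p)) k m)"
    if k: "k \<in> {1,2,3}" "vert e k - vert e (k - 1) = (1/2) *\<^sub>R axis j 1" for k j
  proof -
    have kk: "k \<in> {0,1,2,3}" "k - 1 \<in> {0,1,2,3}" using k by auto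
    have "vert e k \<in> verts e" "vert e (k - 1) \<in> verts e" using kk by (auto simp: verts_def)
    then obtain l l' where l: "l \<in> ref_corners" "l' \<in> ref_corners" "vert e k = \<tau> l" "vert e (k - 1) = \<tau> l'"
      unfolding chart_corners[symmetric] by auto
    have "E w *v (vert e k - vert e (k - 1)) =
        4 *\<^sub>R (a (mid (vert e k) (vert e m)) - a (mid (vert e (k - 1)) (vert e m)))"
      unfolding l(3,4) E_corner[OF l(1,2)] slope_corner[OF assms] chart_midpoint m(2)
      using vert_value chart_corner l(1,2) by (simp add: scaleR_diff_right)
    then have "E w *v ((1/2) *\<^sub>R axis j 1) = 4 *\<^sub>R vec_of (edge_diff (cell_mids (c, p)) k m)"
      unfolding k(2) mid_value[OF cp(3,1) kk(1) m(1)] mid_value[OF cp(3,1) kk(2) m(1)] edge_diff_def vec_of_diff .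
    then have "2 *\<^sub>R (E w *v ((1/2) *\<^sub>R axis j 1)) = 8 *\<^sub>R vec_of (edge_diff (cell_mids (c, p)) k m)"
      by simp
    then show ?thesis by (simp add: matrix_vector_mult_scaleR)
  qed
  have pk: "p1 \<in> {1,2,3}" "p2 \<in> {1,2,3}" "p3 \<in> {1,2,3}"
    "vert e p1 - vert e (p1 - 1) = (1/2) *\<^sub>R axis 1 1"
    "vert e p2 - vert e (p2 - 1) = (1/2) *\<^sub>R axis 2 1"
    "vert e p3 - vert e (p3 - 1) = (1/2) *\<^sub>R axis 3 1"
    using cp(3) unfolding p codes_cell.simps by blast+
  define s where "s k = ivec_sq (edge_diff (cell_mids (c, p)) k m)" for k
  have "cell_ok (c, p)"
    using cell_ok_all cp(1,2) by (auto simp: list_all_iff)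
  then have "vertex_ok (cell_mids (c, p)) m"
    using m(1) by (auto simp: cell_ok_def mids_ok_def point_ok_def)
  then have "s 1 + (s 2 + s 3) < 4527" by (simp add: vertex_ok_def s_def)
  moreover have "s p1 + s p2 + s p3 = s 1 + (s 2 + s 3)"
    using cp(2) by (auto simp: p path_codes_def)
  ultimately have lt: "real_of_int (s p1 + s p2 + s p3) < 4527" by simp
  have "(norm (E w))\<^sup>2 = 64 * real_of_int (s p1 + s p2 + s p3)"
    unfolding norm_mat3 col[OF pk(1,4)] col[OF pk(2,5)] col[OF pk(3,6)] s_def
    by (simp add: ivec_sq power_mult_distrib)
  then have "(norm ((7/3768) *\<^sub>R E w))\<^sup>2 < 1\<^sup>2"
    using lt by (simp add: power_mult_distrib power2_eq_square)
  then show ?thesis by (rule power2_less_imp_less) simp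
qed

lemma E_bary: "E \<xi> = (\<Sum>l\<in>ref_corners. bary \<xi> l *\<^sub>R E l)"
  unfolding E_def nodal_jac_bary[of _ \<xi>]
  by (simp add: sum_ref_corners matrix_add_rdistrib scaleR_matrix_mult_left)

text \<open>\<open>E\<close> is affine on the cell and the norm is convex, so that the strict bound
  at the four corners holds everywhere; the identity plus a matrix of norm below 1 has trivial
  kernel. This serves the inverse gradients in the integrals over boundary faces.\<close>

lemma jac_ref_map_nonzero:
  assumes "smooth_point \<xi>"
  shows "det (jac (ref_map a \<circ> \<tau>) \<xi>) \<noteq> 0"
proof -
  have \<xi>: "\<xi> \<in> ref_tet" using assms by (simp add: smooth_point_def)
  have "norm ((7/3768) *\<^sub>R E \<xi>) \<le> (\<Sum>l\<in>ref_corners. norm (bary \<xi> l *\<^sub>R ((7/3768) *\<^sub>R E l)))"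
    unfolding E_bary[of \<xi>] scaleR_sum_right by (rule order_trans[OF norm_sum]) (simp add: mult.commute)
  also have "\<dots> = (\<Sum>l\<in>ref_corners. bary \<xi> l * norm ((7/3768) *\<^sub>R E l))"
    using bary_nonneg[OF \<xi>] by (intro sum.cong refl) simp
  also have "\<dots> < (\<Sum>l\<in>ref_corners. bary \<xi> l * 1)"
  proof (rule sum_strict_mono_ex1)
    show "\<forall>l\<in>ref_corners. bary \<xi> l * norm ((7/3768) *\<^sub>R E l) \<le> bary \<xi> l * 1"
      by (intro ballI mult_left_mono less_imp_le[OF norm_E_corner] bary_nonneg[OF \<xi>])
    have "\<exists>l\<in>ref_corners. bary \<xi> l \<noteq> 0"
      using bary_sum[of \<xi>] by (rule_tac ccontr) simp
    then show "\<exists>l\<in>ref_corners. bary \<xi> l * norm ((7/3768) *\<^sub>R E l) < bary \<xi> l * 1"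
      using norm_E_corner bary_nonneg[OF \<xi>] by (metis mult_strict_left_mono less_eq_real_def)
  qed (rule finite_ref_corners)
  also have "\<dots> = 1" by (simp add: bary_sum)
  finally have "det (mat 1 + (7/3768) *\<^sub>R E \<xi>) \<noteq> 0" by (rule det_mat_1_add_nonzero)
  then show ?thesis
    unfolding jac_ref_map[OF assms] det_mul using det_pos by simp
qed

end

subsection \<open>The tetrahedra cover the cube\<close>

lemma vert_in_cube:
  assumes "e \<in> cells" "v \<in> verts e"
  shows "v \<in> cbox 0 1"
proof -
  have *: "fst e $ i \<in> {0, 1/2}" for i
    using assms(1) unfolding cells_def by auto
  have c: "0 \<le> fst e $ i" "fst e $ i \<le> 1/2" for i
    using *[of i] by auto
  have "bij (snd e)" using assms(1) by (cases e) (auto simp: cells_def)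
  then have ne: "snd e 1 \<noteq> snd e 2" "snd e 1 \<noteq> snd e 3" "snd e 2 \<noteq> snd e 3"
    by (auto simp: bij_def inj_eq)
  have "0 \<le> v $ i \<and> v $ i \<le> 1" for i
    using assms(2) c[of i] ne unfolding verts_def by (auto simp: vert_simps vert_nat_simps axis_def)
  then show ?thesis by (simp add: mem_box_cart)
qed

lemma tetrahedron_subset_cube: "e \<in> cells \<Longrightarrow> tetrahedron e \<subseteq> cbox 0 1"
  unfolding tetrahedron_eq by (intro hull_minimal subsetI) (auto intro: vert_in_cube)

lemma vert_in_tetrahedron: "v \<in> verts e \<Longrightarrow> v \<in> tetrahedron e"
  unfolding tetrahedron_eq by (rule hull_inc)

definition path :: "3 \<Rightarrow> 3 \<Rightarrow> 3 \<Rightarrow> 3 \<Rightarrow> 3" where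
  "path i j k = (\<lambda>n. if n = 1 then i else if n = 2 then j else k)"

lemma path_simps: "path i j k 1 = i" "path i j k 2 = j" "path i j k 3 = k"
  by (simp_all add: path_def)

lemma bij_path:
  assumes "i \<noteq> j" "i \<noteq> k" "j \<noteq> k"
  shows "bij (path i j k)"
proof -
  have "inj (path i j k)"
    using assms by (auto simp: inj_def forall_3 path_simps)
  then show ?thesis by (simp add: bij_def finite_UNIV_inj_surj)
qed

text \<open>Sorting the coordinates relative to the lowest corner of the cube selects the path. With
  sorted values r i, r j, r k, rescaled to [0, 1], the barycentric coordinates are the successive
  differences 1 - r i, r i - r j, r j - r k and r k.\<close>

lemma cube_subset_tetrahedra:
  assumes "t \<in> cbox 0 (1 :: real^3)"
  obtains e where "e \<in> cells" "t \<in> tetrahedron e"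
proof -
  define c :: "real^3" where "c = (\<chi> i. if t$i \<le> 1/2 then 0 else 1/2)"
  define r where "r i = 2 * (t$i - c$i)" for i
  have t: "0 \<le> t$i" "t$i \<le> 1" for i using assms by (auto simp: mem_box_cart)
  have r: "0 \<le> r i" "r i \<le> 1" for i using t[of i] by (auto simp: r_def c_def)
  have "\<exists>i j k. i \<noteq> j \<and> i \<noteq> k \<and> j \<noteq> k \<and> r j \<le> r i \<and> r k \<le> r j"
  proof -
    consider "r 2 \<le> r 1" "r 3 \<le> r 2" | "r 3 \<le> r 1" "r 2 \<le> r 3" | "r 1 \<le> r 2" "r 3 \<le> r 1"
      | "r 3 \<le> r 2" "r 1 \<le> r 3" | "r 1 \<le> r 3" "r 2 \<le> r 1" | "r 2 \<le> r 3" "r 1 \<le> r 2"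
      by linarith
    then show ?thesis
    proof cases
      case 1 then show ?thesis by (intro exI[of _ 1] exI[of _ 2] exI[of _ 3]) simp
    next
      case 2 then show ?thesis by (intro exI[of _ 1] exI[of _ 3] exI[of _ 2]) simp
    next
      case 3 then show ?thesis by (intro exI[of _ 2] exI[of _ 1] exI[of _ 3]) simp
    next
      case 4 then show ?thesis by (intro exI[of _ 2] exI[of _ 3] exI[of _ 1]) simp
    next
      case 5 then show ?thesis by (intro exI[of _ 3] exI[of _ 1] exI[of _ 2]) simp
    next
      case 6 then show ?thesis by (intro exI[of _ 3] exI[of _ 2] exI[of _ 1]) simp
    qed
  qed
  then obtain i j k where ijk: "i \<noteq> j" "i \<noteq> k" "j \<noteq> k" "r j \<le> r i" "r k \<le> r j" by blast
  define e where "e = (c, path i j k)"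
  have e: "e \<in> cells" using bij_path[OF ijk(1-3)] by (simp add: e_def cells_def c_def)
  have all: "P l" if "P i" "P j" "P k" for P l
  proof -
    have "{i, j, k} = UNIV"
      using ijk(1-3) by (intro card_subset_eq) auto
    then have "l \<in> {i, j, k}" by simp
    then show ?thesis using that by blast
  qed
  have "t = (1 - r i) *\<^sub>R vert e 0 + (r i - r j) *\<^sub>R vert e 1 + (r j - r k) *\<^sub>R vert e 2 + r k *\<^sub>R vert e 3"
    unfolding vec_eq_iff
    by (rule allI, rule all)
      (simp_all add: e_def vert_simps vert_nat_simps path_simps axis_def r_def ijk(1-3) ijk(1-3)[symmetric],
        simp_all add: field_simps)
  also have "\<dots> = (\<Sum>n\<in>{0,1,2,3::nat}. (if n = 0 then 1 - r i else if n = 1 then r i - r j else if n = 2 then r j - r k else r k) *\<^sub>R vert e n)"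
    by (simp add: add.assoc)
  also have "\<dots> \<in> convex hull verts e"
    by (rule convex_sum) (use r ijk in \<open>auto simp: verts_def intro: hull_inc\<close>)
  finally show ?thesis using that e by (simp add: tetrahedron_eq)
qed

subsection \<open>The lower bound\<close>


lemma jac_cong:
  assumes "quadratic_on ref_tet g" "\<And>x. x \<in> ref_tet \<Longrightarrow> f x = g x" "smooth_point \<xi>"
  shows "jac f \<xi> = jac g \<xi>"
proof -
  have "quadratic_on ref_tet f"
    using quadratic_on_cong[of ref_tet f g] assms(1,2) by blast
  moreover have "nodal_jac f \<xi> = nodal_jac g \<xi>"
    by (simp add: nodal_jac_def slope_def assms(2) nodes_in_ref_tet del: scaleR_right_distrib)
  ultimately show ?thesis using assms by (simp add: jac_eq_nodal_jac)
qed

lemma shear_eq: "shear s x = shear_matrix s *v x"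
  by (simp add: shear_def shear_matrix_def)

lemma finite_cells: "finite cells"
proof -
  have "cells \<subseteq> {c. \<forall>i. c $ i \<in> {0, 1/2}} \<times> UNIV"
    by (auto simp: cells_def)
  moreover have "finite {c::real^3. \<forall>i. c $ i \<in> {0, 1/2}}"
  proof (rule finite_subset)
    show "{c::real^3. \<forall>i. c $ i \<in> {0, 1/2}} \<subseteq> (\<lambda>(x, y, z). vector [x, y, z]) ` ({0, 1/2} \<times> {0, 1/2} \<times> {0, 1/2})"
    proof
      fix c :: "real^3" assume "c \<in> {c. \<forall>i. c $ i \<in> {0, 1/2}}"
      then have "c = vector [c$1, c$2, c$3]" "c$1 \<in> {0, 1/2}" "c$2 \<in> {0, 1/2}" "c$3 \<in> {0, 1/2}"
        by (auto simp: vec_eq_iff forall_3)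
      then show "c \<in> (\<lambda>(x, y, z). vector [x, y, z]) ` ({0, 1/2} \<times> {0, 1/2} \<times> {0, 1/2})"
        by (intro image_eqI[of _ _ "(c$1, c$2, c$3)"]) auto
    qed
  qed simp
  ultimately show ?thesis by (auto intro: finite_subset)
qed

context mesh_cell
begin

lemma jac_quad_point:
  assumes "w \<in> ref_corners"
  shows "jac (ref_map a \<circ> \<tau>) (quad_point w) = X w ** M"
    and "0 < det (jac (ref_map a \<circ> \<tau>) (quad_point w))"
    and "jac \<tau> (quad_point w) ** matrix_inv (jac (ref_map a \<circ> \<tau>) (quad_point w)) = matrix_inv (X w)"
proof -
  note sm = smooth_quad_point[OF assms]
  show J: "jac (ref_map a \<circ> \<tau>) (quad_point w) = X w ** M"
    unfolding jac_ref_map[OF sm] X_def ..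
  have dX: "0 < det (X w)" by (rule X_stable[OF assms])
  show pos: "0 < det (jac (ref_map a \<circ> \<tau>) (quad_point w))"
    unfolding J det_mul using dX det_pos by simp
  have "M ** matrix_inv (X w ** M) = (matrix_inv (X w) ** (X w ** M)) ** matrix_inv (X w ** M)"
    using dX by (simp add: matrix_mul_assoc matrix_inv_mult)
  also have "\<dots> = matrix_inv (X w) ** ((X w ** M) ** matrix_inv (X w ** M))"
    by (simp only: matrix_mul_assoc)
  also have "\<dots> = matrix_inv (X w)"
    using pos by (simp add: J matrix_inv_mult)
  finally show "jac \<tau> (quad_point w) ** matrix_inv (jac (ref_map a \<circ> \<tau>) (quad_point w)) = matrix_inv (X w)"
    unfolding J using jac_affine[OF sm, of M b] by (simp add: chart_eq[abs_def])
qed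

end

section \<open>Second variations on the whole mesh\<close>

locale mesh =
  fixes a z :: "real^3 \<Rightarrow> real^3" and \<tau> :: "cell \<Rightarrow> real^3 \<Rightarrow> real^3"
  assumes nodal: "nodal_field a"
    and charts: "\<And>e. e \<in> cells \<Longrightarrow> cell_chart e (\<tau> e)"
    and potential: "\<And>t. t \<in> cbox 0 1 \<Longrightarrow> z (ref_map a t) = 4 *\<^sub>R t"
begin

lemma mesh_cell_exists:
  assumes "e \<in> cells"
  obtains M b where "mesh_cell e (\<tau> e) M b a"
  using chart_exists[OF assms charts[OF assms]] nodal by (auto simp: mesh_cell_def mesh_cell_axioms_def)

abbreviation "cmap \<equiv> cell_map a \<tau>"
abbreviation "JX e \<xi> \<equiv> jac (cmap e) \<xi>"
abbreviation "Jq e w \<equiv> JX e (quad_point w)"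
abbreviation "Jp u e \<xi> \<equiv> jac (u \<circ> cmap e) \<xi>"

lemma quadratic_fe: "u \<in> fe_space a \<tau> \<Longrightarrow> e \<in> cells \<Longrightarrow> quadratic_on ref_tet (u \<circ> cmap e)"
  by (simp add: fe_space_def)

lemma Vh_fe: "u \<in> Vh a \<tau> \<Longrightarrow> u \<in> fe_space a \<tau>"
  by (simp add: Vh_def)

lemma quadratic_cell_map: "e \<in> cells \<Longrightarrow> quadratic_on ref_tet (cmap e)"
  unfolding cell_map_def by (metis mesh_cell_exists mesh_cell.quadratic_ref_map)

lemma jac_potential:
  assumes "e \<in> cells" "smooth_point \<xi>"
  shows "jac (z \<circ> cmap e) \<xi> = 4 *\<^sub>R jac (\<tau> e) \<xi>"
proof -
  obtain M b where mc: "mesh_cell e (\<tau> e) M b a" using mesh_cell_exists[OF assms(1)] .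
  interpret mesh_cell e "\<tau> e" M b a by fact
  have "jac (z \<circ> cmap e) \<xi> = jac (\<lambda>x. (4 *\<^sub>R M) *v x + 4 *\<^sub>R b) \<xi>"
  proof (rule jac_cong[OF quadratic_on_affine _ assms(2)])
    fix x :: "real^3" assume "x \<in> ref_tet"
    then have "\<tau> e x \<in> cbox 0 1" using chart_in_tet tetrahedron_subset_cube[OF assms(1)] by blast
    then show "(z \<circ> cmap e) x = (4 *\<^sub>R M) *v x + 4 *\<^sub>R b"
      by (simp add: cell_map_def potential) (simp add: chart_eq scaleR_matrix_vector_assoc[symmetric] scaleR_right_distrib)
  qed
  then show ?thesis
    using jac_affine[OF assms(2), of "4 *\<^sub>R M" "4 *\<^sub>R b"] jac_affine[OF assms(2), of M b] by (simp add: chart_eq[abs_def])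
qed

lemma jac_line:
  assumes "e \<in> cells" "quadratic_on ref_tet (u \<circ> cmap e)" "smooth_point \<xi>"
  shows "Jp (\<lambda>x. shear s x + r *\<^sub>R u x) e \<xi> = shear_matrix s ** JX e \<xi> + r *\<^sub>R Jp u e \<xi>"
proof -
  have "(\<lambda>x. shear s x + r *\<^sub>R u x) \<circ> cmap e =
      (\<lambda>\<xi>. shear_matrix s *v cmap e \<xi> + r *\<^sub>R (u \<circ> cmap e) \<xi>)"
    by (auto simp: shear_eq)
  then show ?thesis
    using jac_add_scale[OF quadratic_on_matrix_mult[OF quadratic_cell_map[OF assms(1)]] assms(2,3), of "shear_matrix s" r]
      jac_matrix_mult[OF quadratic_cell_map[OF assms(1)] assms(3), of "shear_matrix s"] by simp
qed

lemma JX_det_nonzero: "e \<in> cells \<Longrightarrow> smooth_point \<xi> \<Longrightarrow> det (JX e \<xi>) \<noteq> 0"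
  unfolding cell_map_def by (metis mesh_cell_exists mesh_cell.jac_ref_map_nonzero)

lemma JX_quad_point:
  assumes "e \<in> cells" "w \<in> ref_corners"
  shows "0 < det (Jq e w)"
    and "\<exists>C R. stable_centre C R \<and> 64 * frob (jac (\<tau> e) (quad_point w) ** matrix_inv (Jq e w) - C)
      (jac (\<tau> e) (quad_point w) ** matrix_inv (Jq e w) - C) \<le> 3 * R\<^sup>2"
proof -
  obtain M b where mc: "mesh_cell e (\<tau> e) M b a" using mesh_cell_exists[OF assms(1)] .
  interpret mesh_cell e "\<tau> e" M b a by fact
  show "0 < det (Jq e w)"
    unfolding cell_map_def by (rule jac_quad_point[OF assms(2)])
  show "\<exists>C R. stable_centre C R \<and> 64 * frob (jac (\<tau> e) (quad_point w) ** matrix_inv (Jq e w) - C)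
      (jac (\<tau> e) (quad_point w) ** matrix_inv (Jq e w) - C) \<le> 3 * R\<^sup>2"
    unfolding cell_map_def jac_quad_point(3)[OF assms(2)] by (rule X_stable(2)[OF assms(2)])
qed

definition H :: "(real^3 \<Rightarrow> real^3) \<Rightarrow> cell \<Rightarrow> real^3 \<Rightarrow> real^3^3" where
  "H u e w = grad cmap u e (quad_point w)"

lemma Jp_eq: "e \<in> cells \<Longrightarrow> w \<in> ref_corners \<Longrightarrow> Jp u e (quad_point w) = H u e w ** Jq e w"
  using JX_det_nonzero[OF _ smooth_quad_point]
  by (simp add: H_def grad_def matrix_mul_assoc[symmetric] matrix_inv_mult)

text \<open>Moving \<open>cof J\<close> to the other factor of the Frobenius product gives
  \<open>T ** transpose (cof J)\<close>, which the adjugate formula turns into det J times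
  \<open>P\<close>. The coupling thus carries the same positive weight det J as the elastic terms,
  and the centre estimate can be applied under that weight.\<close>

lemma pointwise_stability:
  assumes "e \<in> cells" "w \<in> ref_corners" "\<bar>s\<bar> \<le> 1/4" "H u e w = K ** shear_matrix s"
  shows "1/16 * (det (Jq e w) * (2 * frob (H u e w) (H u e w) + 2/3 * trace (H u e w) * trace (H u e w))) \<le>
    det (Jq e w) * W_variation (shear_matrix s) K +
    2 * frob (jac (z \<circ> cmap e) (quad_point w)) (cof (Jp u e (quad_point w)))"
proof -
  define J where "J = Jq e w"
  define T where "T = jac (\<tau> e) (quad_point w)"
  define P where "P = T ** matrix_inv J"
  have J: "0 < det J" unfolding J_def by (rule JX_quad_point(1)[OF assms(1,2)])
  obtain C R where CR: "stable_centre C R" "64 * frob (P - C) (P - C) \<le> 3 * R\<^sup>2"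
    using JX_quad_point(2)[OF assms(1,2)] by (auto simp: P_def T_def J_def)
  have ineq: "1/16 * (2 * frob (H u e w) (H u e w) + 2/3 * (trace (H u e w))\<^sup>2) \<le>
      W_variation (shear_matrix s) K + 8 * frob P (cof (H u e w))"
    unfolding assms(4) by (rule stable_near_centre[OF _ _ CR(2)]) (use CR(1) assms(3) in \<open>auto simp: stable_centre_def\<close>)
  have "T ** transpose (cof J) = T ** (matrix_inv J ** J) ** transpose (cof J)"
    using J by (simp add: matrix_inv_mult)
  also have "\<dots> = det J *\<^sub>R P"
    unfolding P_def by (simp add: matrix_mul_assoc[symmetric] cof_transpose_mult scaleR_matrix_mult_right)
  finally have TP: "T ** transpose (cof J) = det J *\<^sub>R P" .
  have "frob T (cof (H u e w) ** cof J) = frob (T ** transpose (cof J)) (cof (H u e w))"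
    by (simp add: frob_expand mult_nth transpose_nth algebra_simps)
  then have "2 * frob (4 *\<^sub>R T) (cof (H u e w ** J)) = det J * (8 * frob P (cof (H u e w)))"
    by (simp add: cof_mult TP frob_eq_inner)
  moreover have "jac (z \<circ> cmap e) (quad_point w) = 4 *\<^sub>R T"
    unfolding T_def by (rule jac_potential[OF assms(1) smooth_quad_point[OF assms(2)]])
  ultimately show ?thesis
    using mult_left_mono[OF ineq, of "det J"] J unfolding Jp_eq[OF assms(1,2)] J_def[symmetric]
    by (simp add: distrib_left power2_eq_square mult.assoc mult.left_commute)
qed

lemma energy_jet:
  assumes "u \<in> Vh a \<tau>" "\<And>e w. H u e w = K e w ** shear_matrix s"
  obtains x y b where "jet2 (\<lambda>r. energy cmap \<kappa> (\<lambda>x. shear s x + r *\<^sub>R u x)) x y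
     ((\<Sum>e\<in>cells. \<Sum>w\<in>ref_corners. 1/24 * (det (Jq e w) * W_variation (shear_matrix s) (K e w))) +
      (\<Sum>e\<in>cells. \<kappa> e / (2 * VQ cmap e) * (2 * (b e)\<^sup>2)))"
proof -
  let ?J = "\<lambda>e w. Jq e w" and ?U = "\<lambda>e w. Jp u e (quad_point w)" and ?S = "shear_matrix s"
  have detS: "det ?S = 1" by (simp add: det_3 shear_matrix_nth)
  have line: "Jp (\<lambda>x. shear s x + r *\<^sub>R u x) e (quad_point w) = ?S ** ?J e w + r *\<^sub>R ?U e w"
    if "e \<in> cells" "w \<in> ref_corners" for e w r
    by (rule jac_line[OF that(1) quadratic_fe[OF Vh_fe[OF assms(1)] that(1)] smooth_quad_point[OF that(2)]])
  have grad: "grad cmap (\<lambda>x. shear s x + r *\<^sub>R u x) e (quad_point w) = ?S + r *\<^sub>R (K e w ** ?S)"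
    if "e \<in> cells" "w \<in> ref_corners" for e w r
    using JX_det_nonzero[OF that(1) smooth_quad_point[OF that(2)]] assms(2)[of e w]
    unfolding grad_def line[OF that] H_def
    by (simp add: matrix_add_rdistrib scaleR_matrix_mult_left matrix_mul_assoc[symmetric] matrix_inv_mult)
  have "\<exists>x y. jet2 (\<lambda>r. W (?S + r *\<^sub>R (K e w ** ?S))) x y (W_variation ?S (K e w))" for e w
    using W_jet2[OF detS] by metis
  then obtain wx wy where W: "\<And>e w. jet2 (\<lambda>r. W (?S + r *\<^sub>R (K e w ** ?S))) (wx e w) (wy e w) (W_variation ?S (K e w))"
    by metis
  have "jet2 (\<lambda>r. det (?S ** ?J e w + r *\<^sub>R ?U e w)) (det (?J e w)) (frob (cof (?S ** ?J e w)) (?U e w))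
      (2 * frob (?S ** ?J e w) (cof (?U e w)))" for e w
    using jet2_quartic[of "det (?J e w)" _ _ "det (?U e w)" 0] by (simp add: det_add_scale det_mul detS)
  then have V0: "jet2 (\<lambda>r. 1/24 * (det (?S ** ?J e w + r *\<^sub>R ?U e w) + - det (?J e w))) (1/24 * (det (?J e w) + - det (?J e w)))
      (1/24 * (frob (cof (?S ** ?J e w)) (?U e w) + 0)) (1/24 * (2 * frob (?S ** ?J e w) (cof (?U e w)) + 0))" for e w
    by (intro jet2_cmult jet2_add jet2_const)
  define b where "b e = (\<Sum>w\<in>ref_corners. 1/24 * (frob (cof (?S ** ?J e w)) (?U e w) + 0))" for e
  \<comment> \<open>The shear has determinant 1, so that the volume residual is 0 at r = 0; the
    second derivative of its square then involves only \<open>b e\<close>.\<close>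
  have V: "jet2 (\<lambda>r. \<Sum>w\<in>ref_corners. 1/24 * (det (?S ** ?J e w + r *\<^sub>R ?U e w) + - det (?J e w))) 0 (b e)
      (\<Sum>w\<in>ref_corners. 1/24 * (2 * frob (?S ** ?J e w) (cof (?U e w)) + 0))" for e
    unfolding b_def by (rule jet2_eq[OF jet2_sum[OF finite_ref_corners V0]]) simp_all
  have "energy cmap \<kappa> (\<lambda>x. shear s x + r *\<^sub>R u x) =
    (\<Sum>e\<in>cells. \<Sum>w\<in>ref_corners. 1/24 * (det (?J e w) * W (?S + r *\<^sub>R (K e w ** ?S)))) +
    (\<Sum>e\<in>cells. \<kappa> e / (2 * VQ cmap e) * (\<Sum>w\<in>ref_corners. 1/24 * (det (?S ** ?J e w + r *\<^sub>R ?U e w) + - det (?J e w)))\<^sup>2)" for r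
    unfolding energy_def Q4_eq by (simp add: line grad cong: sum.cong)
  moreover have "jet2 (\<lambda>r. (\<Sum>e\<in>cells. \<Sum>w\<in>ref_corners. 1/24 * (det (?J e w) * W (?S + r *\<^sub>R (K e w ** ?S)))) +
    (\<Sum>e\<in>cells. \<kappa> e / (2 * VQ cmap e) * (\<Sum>w\<in>ref_corners. 1/24 * (det (?S ** ?J e w + r *\<^sub>R ?U e w) + - det (?J e w)))\<^sup>2))
    ((\<Sum>e\<in>cells. \<Sum>w\<in>ref_corners. 1/24 * (det (?J e w) * wx e w)) + (\<Sum>e\<in>cells. \<kappa> e / (2 * VQ cmap e) * 0))
    ((\<Sum>e\<in>cells. \<Sum>w\<in>ref_corners. 1/24 * (det (?J e w) * wy e w)) + (\<Sum>e\<in>cells. \<kappa> e / (2 * VQ cmap e) * 0))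
    ((\<Sum>e\<in>cells. \<Sum>w\<in>ref_corners. 1/24 * (det (?J e w) * W_variation ?S (K e w))) +
      (\<Sum>e\<in>cells. \<kappa> e / (2 * VQ cmap e) * (2 * (b e)\<^sup>2)))"
    by (intro jet2_add jet2_sum finite_cells finite_ref_corners jet2_cmult W jet2_power2[OF V])
  ultimately show ?thesis
    using that by simp
qed

lemma coupling_jet:
  assumes "u \<in> Vh a \<tau>"
  obtains x y where "jet2 (\<lambda>r. coupling cmap z (\<lambda>x. shear s x + r *\<^sub>R u x)) x y
    (\<Sum>e\<in>cells. \<Sum>w\<in>ref_corners. 1/24 * (2 * frob (jac (z \<circ> cmap e) (quad_point w)) (cof (Jp u e (quad_point w)))))"
proof -
  let ?Z = "\<lambda>e w. jac (z \<circ> cmap e) (quad_point w)"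
  let ?Y = "\<lambda>e w. shear_matrix s ** Jq e w" and ?U = "\<lambda>e w. Jp u e (quad_point w)"
  have line: "Jp (\<lambda>x. shear s x + r *\<^sub>R u x) e (quad_point w) = ?Y e w + r *\<^sub>R ?U e w"
    if "e \<in> cells" "w \<in> ref_corners" for e w r
    by (rule jac_line[OF that(1) quadratic_fe[OF Vh_fe[OF assms(1)] that(1)] smooth_quad_point[OF that(2)]])
  have "coupling cmap z (\<lambda>x. shear s x + r *\<^sub>R u x) =
    (\<Sum>e\<in>cells. \<Sum>w\<in>ref_corners. 1/24 * (frob (?Z e w) (cof (?Y e w)) + r * frob (?Z e w) (cof_polar (?Y e w) (?U e w)) +
      r^2 * frob (?Z e w) (cof (?U e w)) + r^3 * 0 + r^4 * 0))" for r
    unfolding coupling_def Q4_eq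
    by (simp add: line cof_add_scale cong: sum.cong) (simp add: frob_eq_inner inner_add_right)
  moreover have "jet2 (\<lambda>r. \<Sum>e\<in>cells. \<Sum>w\<in>ref_corners. 1/24 * (frob (?Z e w) (cof (?Y e w)) + r * frob (?Z e w) (cof_polar (?Y e w) (?U e w)) +
      r^2 * frob (?Z e w) (cof (?U e w)) + r^3 * 0 + r^4 * 0))
    (\<Sum>e\<in>cells. \<Sum>w\<in>ref_corners. 1/24 * frob (?Z e w) (cof (?Y e w)))
    (\<Sum>e\<in>cells. \<Sum>w\<in>ref_corners. 1/24 * frob (?Z e w) (cof_polar (?Y e w) (?U e w)))
    (\<Sum>e\<in>cells. \<Sum>w\<in>ref_corners. 1/24 * (2 * frob (?Z e w) (cof (?U e w))))"
    by (intro jet2_sum finite_cells finite_ref_corners jet2_cmult jet2_quartic)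
  ultimately show ?thesis using that by simp
qed

lemma A_form_eq:
  "A_form cmap u u = (\<Sum>e\<in>cells. \<Sum>w\<in>ref_corners. 1/24 * (det (Jq e w) *
     (2 * frob (H u e w) (H u e w) + 2/3 * trace (H u e w) * trace (H u e w))))"
  unfolding A_form_def Q4_eq H_def ..

lemma G_form_lower_bound:
  assumes "\<bar>s\<bar> \<le> 1/4" "\<And>e. e \<in> cells \<Longrightarrow> 0 \<le> \<kappa> e" "u \<in> Vh a \<tau>"
  shows "1/16 * A_form cmap u u \<le> G_form cmap \<kappa> z (shear s) u u"
proof -
  define K where "K e w = H u e w ** shear_matrix (- s)" for e w
  have inv: "shear_matrix (- s) ** shear_matrix s = mat 1"
    by (simp add: mat3_eq_iff mult_nth shear_matrix_nth mat_1_nth)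
  have K: "H u e w = K e w ** shear_matrix s" for e w
    by (simp add: K_def matrix_mul_assoc[symmetric] inv)
  obtain x y b where "jet2 (\<lambda>r. energy cmap \<kappa> (\<lambda>x. shear s x + r *\<^sub>R u x)) x y
     ((\<Sum>e\<in>cells. \<Sum>w\<in>ref_corners. 1/24 * (det (Jq e w) * W_variation (shear_matrix s) (K e w))) +
      (\<Sum>e\<in>cells. \<kappa> e / (2 * VQ cmap e) * (2 * (b e)\<^sup>2)))"
    using energy_jet[OF assms(3) K] .
  then have Kf: "K_form cmap \<kappa> (shear s) u u =
     (\<Sum>e\<in>cells. \<Sum>w\<in>ref_corners. 1/24 * (det (Jq e w) * W_variation (shear_matrix s) (K e w))) +
      (\<Sum>e\<in>cells. \<kappa> e / (2 * VQ cmap e) * (2 * (b e)\<^sup>2))"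
    unfolding K_form_def by (rule hessian_eq_jet2)
  obtain x y where "jet2 (\<lambda>r. coupling cmap z (\<lambda>x. shear s x + r *\<^sub>R u x)) x y
    (\<Sum>e\<in>cells. \<Sum>w\<in>ref_corners. 1/24 * (2 * frob (jac (z \<circ> cmap e) (quad_point w)) (cof (Jp u e (quad_point w)))))"
    using coupling_jet[OF assms(3)] .
  then have Cf: "hessian (coupling cmap z) (shear s) u u =
    (\<Sum>e\<in>cells. \<Sum>w\<in>ref_corners. 1/24 * (2 * frob (jac (z \<circ> cmap e) (quad_point w)) (cof (Jp u e (quad_point w)))))"
    by (rule hessian_eq_jet2)
  have "0 < VQ cmap e" if "e \<in> cells" for e
    unfolding VQ_def Q4_eq using JX_quad_point(1)[OF that] card_ref_corners finite_ref_corners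
    by (intro sum_pos) (auto simp: ref_corners_def)
  then have bulk: "0 \<le> (\<Sum>e\<in>cells. \<kappa> e / (2 * VQ cmap e) * (2 * (b e)\<^sup>2))"
    using assms(2) by (intro sum_nonneg mult_nonneg_nonneg divide_nonneg_nonneg) (auto intro: less_imp_le)
  have "1/16 * A_form cmap u u \<le>
    (\<Sum>e\<in>cells. \<Sum>w\<in>ref_corners. 1/24 * (det (Jq e w) * W_variation (shear_matrix s) (K e w) +
      2 * frob (jac (z \<circ> cmap e) (quad_point w)) (cof (Jp u e (quad_point w)))))"
    unfolding A_form_eq sum_distrib_left
  proof (intro sum_mono)
    fix e w assume "e \<in> cells" "w \<in> ref_corners"
    from pointwise_stability[OF this assms(1) K]
    show "1/16 * (1/24 * (det (Jq e w) * (2 * frob (H u e w) (H u e w) + 2/3 * trace (H u e w) * trace (H u e w))))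
      \<le> 1/24 * (det (Jq e w) * W_variation (shear_matrix s) (K e w) +
      2 * frob (jac (z \<circ> cmap e) (quad_point w)) (cof (Jp u e (quad_point w))))"
      by simp
  qed
  then show ?thesis
    using bulk unfolding G_form_def Kf Cf by (simp add: distrib_left sum.distrib)
qed

end

section \<open>Definiteness of the comparison form\<close>

context mesh
begin

lemma continuous_ref_map: "continuous_on (cbox 0 1) (ref_map a)"
  using nodal unfolding nodal_field_def ref_map_def by (auto intro!: continuous_intros)

lemma closure_Omega: "closure (Omega a) \<subseteq> ref_map a ` cbox 0 1"
proof (rule closure_minimal)
  show "Omega a \<subseteq> ref_map a ` cbox 0 1"
    unfolding Omega_def using box_subset_cbox by blast
  show "closed (ref_map a ` cbox 0 1)"
    by (intro compact_imp_closed compact_continuous_image continuous_ref_map compact_cbox)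
qed

lemma constant_on_cell:
  assumes "u \<in> fe_space a \<tau>" "e \<in> cells" "\<And>w. w \<in> ref_corners \<Longrightarrow> H u e w = 0" "t \<in> tetrahedron e" "t' \<in> tetrahedron e"
  shows "u (ref_map a t) = u (ref_map a t')"
proof -
  obtain M b where mc: "mesh_cell e (\<tau> e) M b a" using mesh_cell_exists[OF assms(2)] .
  interpret mesh_cell e "\<tau> e" M b a by fact
  let ?f = "u \<circ> cmap e"
  have q: "quadratic_on ref_tet ?f" by (rule quadratic_fe[OF assms(1,2)])
  have "nodal_jac ?f (quad_point w) = 0" if "w \<in> ref_corners" for w
    using Jp_eq[OF assms(2) that, of u] assms(3)[OF that] jac_eq_nodal_jac[OF q smooth_quad_point[OF that]] by simp
  then have "?f \<xi> = ?f 0" if "\<xi> \<in> ref_tet" for \<xi>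
    using quadratic_constant[OF q _ that] by blast
  then have "u (ref_map a t) = ?f 0" if "t \<in> tetrahedron e" for t
    using that unfolding image[symmetric] by (auto simp: cell_map_def)
  then show ?thesis using assms(4,5) by simp
qed

text \<open>If the form vanishes, every summand does, the gradient is zero at all quadrature points,
  and the field is constant on each cell. These constants are carried to the clamped face through
  shared corners: every cell contains the lowest corner of its cube.\<close>

lemma A_form_positive:
  assumes "u \<in> Vh a \<tau>" "x \<in> closure (Omega a)" "u x \<noteq> 0"
  shows "0 < A_form cmap u u"
proof (rule ccontr)
  define q where "q e w = 1/24 * (det (Jq e w) *
     (2 * frob (H u e w) (H u e w) + 2/3 * trace (H u e w) * trace (H u e w)))" for e w
  have q0: "0 \<le> q e w" if "e \<in> cells" "w \<in> ref_corners" for e w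
  proof -
    have "0 \<le> 2/3 * trace (H u e w) * trace (H u e w)" by (simp add: mult.assoc)
    then show ?thesis
      unfolding q_def
      by (intro mult_nonneg_nonneg[OF _ mult_nonneg_nonneg[OF less_imp_le[OF JX_quad_point(1)[OF that]] add_nonneg_nonneg]])
        (simp_all add: frob_self)
  qed
  assume "\<not> 0 < A_form cmap u u"
  then have "(\<Sum>e\<in>cells. \<Sum>w\<in>ref_corners. q e w) \<le> 0"
    unfolding A_form_eq q_def by simp
  then have "(\<Sum>e\<in>cells. \<Sum>w\<in>ref_corners. q e w) = 0"
    using q0 by (intro antisym sum_nonneg) auto
  then have "q e w = 0" if "e \<in> cells" "w \<in> ref_corners" for e w
    using that q0 by (simp add: sum_nonneg_eq_0_iff finite_cells finite_ref_corners sum_nonneg)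
  moreover have "H u e w = 0" if "q e w = 0" "e \<in> cells" "w \<in> ref_corners" for e w
  proof -
    have "2 * frob (H u e w) (H u e w) + 2/3 * (trace (H u e w) * trace (H u e w)) = 0"
      using that(1) JX_quad_point(1)[OF that(2,3)] by (simp add: q_def)
    moreover have "0 \<le> trace (H u e w) * trace (H u e w)" by simp
    ultimately have "frob (H u e w) (H u e w) \<le> 0" by linarith
    then show ?thesis by (simp add: frob_self)
  qed
  ultimately have const: "u (ref_map a t) = u (ref_map a t')"
    if "e \<in> cells" "t \<in> tetrahedron e" "t' \<in> tetrahedron e" for e t t'
    using constant_on_cell[OF Vh_fe[OF assms(1)] that(1) _ that(2,3)] that(1) by blast
  have bnd: "u (ref_map a t) = 0" if "t \<in> cbox 0 1" "t $ 1 = 0" for t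
    using assms(1) that by (auto simp: Vh_def)
  have corner: "u (ref_map a (fst e)) = 0" if e: "e \<in> cells" for e
  proof -
    have "vert e 0 \<in> verts e" by (simp add: verts_def)
    then have in_cube: "fst e \<in> cbox 0 1" using vert_in_cube[OF e] by (simp add: vert_simps)
    have half: "fst e $ i \<in> {0, 1/2}" for i using e unfolding cells_def by auto
    show ?thesis
    proof (cases "fst e $ 1 = 0")
      case True
      then show ?thesis by (rule bnd[OF in_cube])
    next
      case False
      \<comment> \<open>A cell of the preceding cube whose path starts along the first axis; its
        first edge joins the corner to the plane t_1 = 0.\<close>
      define e' where "e' = (fst e - (1/2) *\<^sub>R axis 1 1, path 1 2 3)"
      have h1: "fst e $ 1 = 1/2" using half[of 1] False by auto
      have "(fst e - (1/2) *\<^sub>R axis 1 1) $ i \<in> {0, 1/2}" for i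
        using half[of i] h1 by (auto simp: axis_def)
      then have e': "e' \<in> cells" using bij_path[of 1 2 3] by (simp add: e'_def cells_def)
      have v: "vert e' 0 = fst e - (1/2) *\<^sub>R axis 1 1" "vert e' 1 = fst e"
        by (simp_all add: e'_def vert_simps vert_nat_simps path_simps)
      have vs: "vert e' 0 \<in> verts e'" "vert e' 1 \<in> verts e'" by (simp_all add: verts_def)
      have "u (ref_map a (fst e)) = u (ref_map a (vert e' 0))"
        using const[OF e' vert_in_tetrahedron[OF vs(2)] vert_in_tetrahedron[OF vs(1)]] v by simp
      also have "\<dots> = 0"
        by (rule bnd[OF vert_in_cube[OF e' vs(1)]]) (simp add: v h1)
      finally show ?thesis .
    qed
  qed
  obtain t where t: "t \<in> cbox 0 1" "x = ref_map a t"
    using closure_Omega assms(2) by auto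
  obtain e where e: "e \<in> cells" "t \<in> tetrahedron e"
    using cube_subset_tetrahedra[OF t(1)] .
  have "vert e 0 \<in> verts e" by (simp add: verts_def)
  then have "fst e \<in> tetrahedron e" using vert_in_tetrahedron[of "fst e" e] by (simp add: vert_simps)
  then have "u x = 0" using const[OF e] corner[OF e(1)] t by simp
  then show False using assms(3) by simp
qed

section \<open>Distortion of the mesh\<close>

text \<open>Testing the spectral norm at y = X v avoids inverting X, because (P - I) y = v - X v. It
  remains to compare two explicit vectors over the numbers a + b sqrt 5.\<close>

lemma delta_lower_bound: "1/2 < delta \<tau> cmap"
proof -
  define e :: cell where "e = (node 2 0 2, path 3 1 2)"
  define cd :: "nat \<times> nat \<times> nat" where "cd = (2, 0, 2)"
  define p :: "nat \<times> nat \<times> nat" where "p = (2, 3, 1)"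
  have e: "e \<in> cells"
    using bij_path[of 3 1 2] by (simp add: e_def cells_def forall_3 node_nth)
  have code: "codes_cell (cd, p) e"
    by (simp add: cd_def p_def e_def path_simps vert_simps vert_nat_simps step_def vec_eq_iff forall_3 node_nth axis_nth_3 field_simps)
  obtain M b where mc: "mesh_cell e (\<tau> e) M b a" using mesh_cell_exists[OF e] .
  interpret mesh_cell e "\<tau> e" M b a by fact
  have "vert e 0 \<in> \<tau> e ` ref_corners" unfolding chart_corners by (simp add: verts_def)
  then obtain w where w: "w \<in> ref_corners" "\<tau> e w = vert e 0" by force
  note sm = smooth_quad_point[OF w(1)]
  define Y where "Y = q5_mat (gradient_code p 0 (cell_mids (cd, p)))"
  have X: "X w = (1/9420) *\<^sub>R Y"
    unfolding Y_def by (rule X_eq_code[OF code _ w(1) _ w(2)]) (simp_all add: cd_def corner_codes_def)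
  \<comment> \<open>For this vector the norm of v - X v is about 0.62 times that of X v, well above
    the required half.\<close>
  define v :: "real^3" where "v = vector [-2, 3, 1]"
  have "gradient_code p 0 (cell_mids (cd, p)) = (((8895, -371), (1085, 231), (525, -21)), ((1120, 308), (8370, -490), (-840, -28)),
      ((-140, -28), (-245, -119), (9105, 35)))"
    unfolding p_def cd_def by code_simp
  then have Yv: "Y *v v = vector [-14010 + 1414 * sqrt 5, 22030 - 2114 * sqrt 5, 8650 - 266 * sqrt 5]"
    by (simp add: Y_def v_def vec_eq_iff forall_3 matrix_vector_mult_def sum_3)
  have five: "sqrt 5 * (sqrt 5 * x) = 5 * x" for x :: real
    by (simp flip: mult.assoc)
  have "(norm (Y *v v))\<^sup>2 < (2 * norm (9420 *\<^sub>R v - Y *v v))\<^sup>2"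
    using sqrt_5_bounds unfolding power_mult_distrib power2_norm_eq_inner Yv
    by (simp add: inner_vec_def sum_3 v_def algebra_simps five)
  then have "norm (Y *v v) < 2 * norm (9420 *\<^sub>R v - Y *v v)"
    by (rule power2_less_imp_less) simp
  moreover have "norm (X w *v v) = norm (Y *v v) / 9420"
    by (simp add: X scaleR_matrix_vector_assoc[symmetric])
  moreover have "v - X w *v v = (1/9420) *\<^sub>R (9420 *\<^sub>R v - Y *v v)"
    by (simp add: X scaleR_matrix_vector_assoc[symmetric] scaleR_diff_right)
  ultimately have "norm (X w *v v) < 2 * norm (v - X w *v v)"
    by simp
  moreover have "norm (v - X w *v v) \<le> onorm ((*v) (matrix_inv (X w) - mat 1)) * norm (X w *v v)"
  proof -
    have "(matrix_inv (X w) - mat 1) *v (X w *v v) = v - X w *v v"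
    proof -
      have "matrix_inv (X w) *v (X w *v v) = v"
        using X_stable(1)[OF w(1)] by (simp add: matrix_vector_mul_assoc matrix_inv_mult)
      then show ?thesis by (simp add: matrix_vector_mult_diff_rdistrib)
    qed
    then show ?thesis
      using onorm[OF matrix_vector_mul_bounded_linear, of "matrix_inv (X w) - mat 1" "X w *v v"] by simp
  qed
  ultimately have "norm (X w *v v) < 2 * (onorm ((*v) (matrix_inv (X w) - mat 1)) * norm (X w *v v))"
    by linarith
  then have "1/2 < onorm ((*v) (matrix_inv (X w) - mat 1))"
    by (cases "norm (X w *v v) = 0") (auto simp: field_simps)
  also have "\<dots> = spectral_norm (jac (\<tau> e) (quad_point w) ** matrix_inv (Jq e w) - mat 1)"
    unfolding spectral_norm_def cell_map_def jac_quad_point(3)[OF w(1)] ..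
  also have "\<dots> \<le> delta \<tau> cmap"
    unfolding delta_def
    by (rule Max_ge) (use e w(1) finite_cells finite_ref_corners in \<open>auto simp: quad_points_eq image_iff split: prod.splits intro!: bexI[of _ e]\<close>)
  finally show ?thesis .
qed

end

subsection \<open>Integrals over the reference triangle\<close>


definition pair_vec :: "real \<times> real \<Rightarrow> real^2" where "pair_vec p = vector [fst p, snd p]"

lemma pair_vec_nth: "pair_vec p $ 1 = fst p" "pair_vec p $ 2 = snd p"
  by (simp_all add: pair_vec_def)

lemma continuous_pair_vec: "continuous_on UNIV pair_vec"
proof -
  have eq: "pair_vec = (\<lambda>p. fst p *\<^sub>R axis 1 1 + snd p *\<^sub>R axis 2 1)"
    by (auto simp: vec_eq_iff forall_2 pair_vec_nth axis_def)
  show ?thesis unfolding eq by (auto intro!: continuous_intros)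
qed

lemma measurable_pair_vec: "pair_vec \<in> borel_measurable (lborel \<Otimes>\<^sub>M lborel)"
  using borel_measurable_continuous_onI[OF continuous_pair_vec] by (simp add: lborel_prod)

text \<open>Identifies Lebesgue measure on \<open>real^2\<close> with the product measure, so that
  Fubini's theorem for pairs becomes available on the triangle.\<close>

lemma distr_pair_vec: "distr (lborel \<Otimes>\<^sub>M lborel) borel pair_vec = lborel"
proof (rule lborel_eqI[symmetric])
  fix l u :: "real^2"
  assume "\<And>b. b \<in> Basis \<Longrightarrow> l \<bullet> b \<le> u \<bullet> b"
  from this[of "axis 1 1"] this[of "axis 2 1"] have le: "l$1 \<le> u$1" "l$2 \<le> u$2"
    by (auto simp: Basis_vec_def inner_axis)
  have "emeasure (distr (lborel \<Otimes>\<^sub>M lborel) borel pair_vec) (box l u) =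
      emeasure (lborel \<Otimes>\<^sub>M lborel) (pair_vec -` box l u \<inter> space (lborel \<Otimes>\<^sub>M lborel))"
    using measurable_pair_vec by (intro emeasure_distr) auto
  also have "pair_vec -` box l u \<inter> space (lborel \<Otimes>\<^sub>M lborel) = {l$1<..<u$1} \<times> {l$2<..<u$2}"
    by (auto simp: mem_box_cart forall_2 pair_vec_nth space_pair_measure)
  also have "emeasure (lborel \<Otimes>\<^sub>M lborel) \<dots> = ennreal (u$1 - l$1) * ennreal (u$2 - l$2)"
    using le by (subst lborel.emeasure_pair_measure_Times) auto
  also have "\<dots> = ennreal ((u$1 - l$1) * (u$2 - l$2))"
    using le by (simp add: ennreal_mult)
  also have "(u$1 - l$1) * (u$2 - l$2) = (\<Prod>b\<in>Basis. (u - l) \<bullet> b)"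
  proof -
    have B: "(Basis :: (real^2) set) = {axis 1 1, axis 2 1}"
      by (auto simp: Basis_vec_def) (metis exhaust_2)
    show ?thesis unfolding B by (simp add: inner_axis axis_eq_axis)
  qed
  finally show "emeasure (distr (lborel \<Otimes>\<^sub>M lborel) borel pair_vec) (box l u) = (\<Prod>b\<in>Basis. (u - l) \<bullet> b)" .
qed simp

lemma compact_ref_tri: "compact ref_tri"
proof -
  have "closed ref_tri"
    unfolding ref_tri_def by (intro closed_Collect_conj closed_Collect_le continuous_intros)
  moreover have "ref_tri \<subseteq> cbox 0 1"
    by (auto simp: ref_tri_def mem_box_cart forall_2)
  ultimately show ?thesis
    using bounded_cbox bounded_subset compact_eq_bounded_closed by blast
qed

text \<open>Integration over the second coordinate from 0 to 1 - x leaves a polynomial in x, of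
  which \<open>F\<close> is an antiderivative; each moment is then a matter of exhibiting
  \<open>F\<close>.\<close>

lemma monomial_integral_ref_tri:
  assumes F: "\<And>x. (F has_real_derivative x ^ i * ((1 - x) ^ Suc j / real (Suc j))) (at x)" and v: "v = F 1 - F 0"
  shows "((\<lambda>\<eta>. \<eta>$1 ^ i * \<eta>$2 ^ j) has_integral v) ref_tri"
proof -
  define f :: "real^2 \<Rightarrow> real" where "f \<eta> = indicator ref_tri \<eta> *\<^sub>R (\<eta>$1 ^ i * \<eta>$2 ^ j)" for \<eta>
  have int: "integrable lborel f"
    unfolding f_def by (rule borel_integrable_compact[OF compact_ref_tri]) (intro continuous_intros)
  have int2: "integrable (lborel \<Otimes>\<^sub>M lborel) (\<lambda>p. f (pair_vec p))"
    using int unfolding distr_pair_vec[symmetric]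
    by (subst (asm) integrable_distr_eq) (use measurable_pair_vec int in \<open>auto simp: distr_pair_vec\<close>)
  have "integral\<^sup>L lborel f = integral\<^sup>L (lborel \<Otimes>\<^sub>M lborel) (\<lambda>p. f (pair_vec p))"
    by (subst distr_pair_vec[symmetric], rule integral_distr) (use measurable_pair_vec int in auto)
  also have "\<dots> = (\<integral>x. (\<integral>y. f (pair_vec (x, y)) \<partial>lborel) \<partial>lborel)"
    by (rule lborel_pair.integral_fst'[OF int2, symmetric])
  also have "(\<lambda>x. \<integral>y. f (pair_vec (x, y)) \<partial>lborel) = (\<lambda>x. x ^ i * ((1 - x) ^ Suc j / real (Suc j)) * indicator {0..1} x)"
  proof
    fix x :: real
    show "(\<integral>y. f (pair_vec (x, y)) \<partial>lborel) = x ^ i * ((1 - x) ^ Suc j / real (Suc j)) * indicator {0..1} x"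
    proof (cases "x \<in> {0..1}")
      case True
      have "(\<integral>y. f (pair_vec (x, y)) \<partial>lborel) = (\<integral>y. (x ^ i * y ^ j) * indicator {0..1 - x} y \<partial>lborel)"
        using True by (intro Bochner_Integration.integral_cong refl)
          (auto simp: f_def ref_tri_def pair_vec_nth split: split_indicator)
      also have "\<dots> = x ^ i * (1 - x) ^ Suc j / real (Suc j) - x ^ i * 0 ^ Suc j / real (Suc j)"
        by (rule integral_FTC_Icc_real[where F = "\<lambda>y. x ^ i * y ^ Suc j / real (Suc j)"])
          (use True in \<open>auto intro!: derivative_eq_intros continuous_intros simp del: power_Suc\<close>)
      finally show ?thesis using True by simp
    next
      case False
      then have "f (pair_vec (x, y)) = 0" for y
        by (auto simp: f_def ref_tri_def pair_vec_nth split: split_indicator)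
      then show ?thesis using False by simp
    qed
  qed
  also have "(\<integral>x. x ^ i * ((1 - x) ^ Suc j / real (Suc j)) * indicator {0..1} x \<partial>lborel) = v"
    unfolding v by (rule integral_FTC_Icc_real) (use F in \<open>auto intro!: continuous_intros\<close>)
  finally have val: "integral\<^sup>L lborel f = v" .
  have si: "set_integrable lborel ref_tri (\<lambda>\<eta>. \<eta>$1 ^ i * \<eta>$2 ^ j)"
    using int unfolding set_integrable_def f_def .
  show ?thesis
    using set_borel_integral_eq_integral[OF si] val
    by (simp add: has_integral_iff set_lebesgue_integral_def f_def[abs_def])
qed

lemma moments_ref_tri:
  "((\<lambda>\<eta>. 1 :: real) has_integral (1/2)) ref_tri"
  "((\<lambda>\<eta>. \<eta>$1) has_integral (1/6)) ref_tri" "((\<lambda>\<eta>. \<eta>$2) has_integral (1/6)) ref_tri"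
  "((\<lambda>\<eta>. \<eta>$1 ^ 2) has_integral (1/12)) ref_tri" "((\<lambda>\<eta>. \<eta>$1 * \<eta>$2) has_integral (1/24)) ref_tri"
  "((\<lambda>\<eta>. \<eta>$2 ^ 2) has_integral (1/12)) ref_tri"
  "((\<lambda>\<eta>. \<eta>$1 ^ 3) has_integral (1/20)) ref_tri" "((\<lambda>\<eta>. \<eta>$1 ^ 2 * \<eta>$2) has_integral (1/60)) ref_tri"
  "((\<lambda>\<eta>. \<eta>$1 * \<eta>$2 ^ 2) has_integral (1/60)) ref_tri" "((\<lambda>\<eta>. \<eta>$2 ^ 3) has_integral (1/20)) ref_tri"
proof -
  note m = monomial_integral_ref_tri
  have "((\<lambda>\<eta>. \<eta>$1 ^ 0 * \<eta>$2 ^ 0) has_integral (1/2)) ref_tri"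
    by (rule m[of "\<lambda>x. x - x^2/2"]) (auto intro!: derivative_eq_intros simp: field_simps eval_nat_numeral)
  then show "((\<lambda>\<eta>. 1 :: real) has_integral (1/2)) ref_tri" by simp
  have "((\<lambda>\<eta>. \<eta>$1 ^ 1 * \<eta>$2 ^ 0) has_integral (1/6)) ref_tri"
    by (rule m[of "\<lambda>x. x^2/2 - x^3/3"]) (auto intro!: derivative_eq_intros simp: field_simps eval_nat_numeral)
  then show "((\<lambda>\<eta>. \<eta>$1) has_integral (1/6)) ref_tri" by simp
  have "((\<lambda>\<eta>. \<eta>$1 ^ 2 * \<eta>$2 ^ 0) has_integral (1/12)) ref_tri"
    by (rule m[of "\<lambda>x. x^3/3 - x^4/4"]) (auto intro!: derivative_eq_intros simp: field_simps eval_nat_numeral)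
  then show "((\<lambda>\<eta>. \<eta>$1 ^ 2) has_integral (1/12)) ref_tri" by simp
  have "((\<lambda>\<eta>. \<eta>$1 ^ 3 * \<eta>$2 ^ 0) has_integral (1/20)) ref_tri"
    by (rule m[of "\<lambda>x. x^4/4 - x^5/5"]) (auto intro!: derivative_eq_intros simp: field_simps eval_nat_numeral)
  then show "((\<lambda>\<eta>. \<eta>$1 ^ 3) has_integral (1/20)) ref_tri" by simp
  have "((\<lambda>\<eta>. \<eta>$1 ^ 0 * \<eta>$2 ^ 1) has_integral (1/6)) ref_tri"
    by (rule m[of "\<lambda>x. x/2 - x^2/2 + x^3/6"]) (auto intro!: derivative_eq_intros simp: field_simps eval_nat_numeral)
  then show "((\<lambda>\<eta>. \<eta>$2) has_integral (1/6)) ref_tri" by simp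
  have "((\<lambda>\<eta>. \<eta>$1 ^ 1 * \<eta>$2 ^ 1) has_integral (1/24)) ref_tri"
    by (rule m[of "\<lambda>x. x^2/4 - x^3/3 + x^4/8"]) (auto intro!: derivative_eq_intros simp: field_simps eval_nat_numeral)
  then show "((\<lambda>\<eta>. \<eta>$1 * \<eta>$2) has_integral (1/24)) ref_tri" by simp
  have "((\<lambda>\<eta>. \<eta>$1 ^ 2 * \<eta>$2 ^ 1) has_integral (1/60)) ref_tri"
    by (rule m[of "\<lambda>x. x^3/6 - x^4/4 + x^5/10"]) (auto intro!: derivative_eq_intros simp: field_simps eval_nat_numeral)
  then show "((\<lambda>\<eta>. \<eta>$1 ^ 2 * \<eta>$2) has_integral (1/60)) ref_tri" by simp
  have "((\<lambda>\<eta>. \<eta>$1 ^ 0 * \<eta>$2 ^ 2) has_integral (1/12)) ref_tri"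
    by (rule m[of "\<lambda>x. x/3 - x^2/2 + x^3/3 - x^4/12"]) (auto intro!: derivative_eq_intros simp: field_simps eval_nat_numeral)
  then show "((\<lambda>\<eta>. \<eta>$2 ^ 2) has_integral (1/12)) ref_tri" by simp
  have "((\<lambda>\<eta>. \<eta>$1 ^ 1 * \<eta>$2 ^ 2) has_integral (1/60)) ref_tri"
    by (rule m[of "\<lambda>x. x^2/6 - x^3/3 + x^4/4 - x^5/15"]) (auto intro!: derivative_eq_intros simp: field_simps eval_nat_numeral)
  then show "((\<lambda>\<eta>. \<eta>$1 * \<eta>$2 ^ 2) has_integral (1/60)) ref_tri" by simp
  have "((\<lambda>\<eta>. \<eta>$1 ^ 0 * \<eta>$2 ^ 3) has_integral (1/20)) ref_tri"
    by (rule m[of "\<lambda>x. x/4 - x^2/2 + x^3/2 - x^4/4 + x^5/20"]) (auto intro!: derivative_eq_intros simp: field_simps eval_nat_numeral)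
  then show "((\<lambda>\<eta>. \<eta>$2 ^ 3) has_integral (1/20)) ref_tri" by simp
qed

definition affine3 :: "real \<Rightarrow> real \<Rightarrow> real \<Rightarrow> real^2 \<Rightarrow> real" where
  "affine3 p0 p1 p2 \<eta> = p0 * (1 - \<eta>$1 - \<eta>$2) + p1 * \<eta>$1 + p2 * \<eta>$2"

text \<open>A cubic monomial in the barycentric coordinates of this triangle integrates to the
  product of the factorials of its exponents over 5!, which is 1/120, 2/120 or 6/120. The sums add
  the surplus for coinciding indices to the plain product.\<close>

lemma product_integral_ref_tri:
  "((\<lambda>\<eta>. affine3 p0 p1 p2 \<eta> * (affine3 q0 q1 q2 \<eta> * affine3 r0 r1 r2 \<eta>)) has_integral
     (1/120 * ((p0 + p1 + p2) * (q0 + q1 + q2) * (r0 + r1 + r2) + (p0 + p1 + p2) * (q0 * r0 + q1 * r1 + q2 * r2) +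
       (q0 + q1 + q2) * (p0 * r0 + p1 * r1 + p2 * r2) + (r0 + r1 + r2) * (p0 * q0 + p1 * q1 + p2 * q2) +
       2 * (p0 * q0 * r0 + p1 * q1 * r1 + p2 * q2 * r2)))) ref_tri"
proof -
  define a1 a2 b1 b2 c1 c2 where "a1 = p1 - p0" "a2 = p2 - p0" "b1 = q1 - q0" "b2 = q2 - q0" "c1 = r1 - r0" "c2 = r2 - r0"
  note d = this
  have "((\<lambda>\<eta>. (p0*q0*r0) * 1 + (a1*q0*r0 + p0*b1*r0 + p0*q0*c1) * \<eta>$1 + (a2*q0*r0 + p0*b2*r0 + p0*q0*c2) * \<eta>$2 +
      (a1*b1*r0 + a1*q0*c1 + p0*b1*c1) * \<eta>$1 ^ 2 +
      (a1*b2*r0 + a2*b1*r0 + a1*q0*c2 + a2*q0*c1 + p0*b1*c2 + p0*b2*c1) * (\<eta>$1 * \<eta>$2) +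
      (a2*b2*r0 + a2*q0*c2 + p0*b2*c2) * \<eta>$2 ^ 2 + (a1*b1*c1) * \<eta>$1 ^ 3 +
      (a1*b1*c2 + a1*b2*c1 + a2*b1*c1) * (\<eta>$1 ^ 2 * \<eta>$2) + (a1*b2*c2 + a2*b1*c2 + a2*b2*c1) * (\<eta>$1 * \<eta>$2 ^ 2) +
      (a2*b2*c2) * \<eta>$2 ^ 3) has_integral
      ((p0*q0*r0) * (1/2) + (a1*q0*r0 + p0*b1*r0 + p0*q0*c1) * (1/6) + (a2*q0*r0 + p0*b2*r0 + p0*q0*c2) * (1/6) +
      (a1*b1*r0 + a1*q0*c1 + p0*b1*c1) * (1/12) +
      (a1*b2*r0 + a2*b1*r0 + a1*q0*c2 + a2*q0*c1 + p0*b1*c2 + p0*b2*c1) * (1/24) +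
      (a2*b2*r0 + a2*q0*c2 + p0*b2*c2) * (1/12) + (a1*b1*c1) * (1/20) +
      (a1*b1*c2 + a1*b2*c1 + a2*b1*c1) * (1/60) + (a1*b2*c2 + a2*b1*c2 + a2*b2*c1) * (1/60) +
      (a2*b2*c2) * (1/20))) ref_tri" (is "(?f has_integral ?I) ref_tri")
    by (intro has_integral_add has_integral_mult_right moments_ref_tri)
  moreover have "?f = (\<lambda>\<eta>. affine3 p0 p1 p2 \<eta> * (affine3 q0 q1 q2 \<eta> * affine3 r0 r1 r2 \<eta>))"
    unfolding affine3_def d by (rule ext) algebra
  moreover have "?I = 1/120 * ((p0 + p1 + p2) * (q0 + q1 + q2) * (r0 + r1 + r2) + (p0 + p1 + p2) * (q0 * r0 + q1 * r1 + q2 * r2) +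
       (q0 + q1 + q2) * (p0 * r0 + p1 * r1 + p2 * r2) + (r0 + r1 + r2) * (p0 * q0 + p1 * q1 + p2 * q2) +
       2 * (p0 * q0 * r0 + p1 * q1 * r1 + p2 * q2 * r2))"
    unfolding d by (simp add: field_simps)
  ultimately show ?thesis by (simp only:)
qed

subsection \<open>The divergence theorem on a cell\<close>


text \<open>Thirty times the integral over \<open>ref_tri\<close> of L (d1 g * d2 h - d2 g * d1 h),
  where L is the barycentric coordinate of the first vertex and g, h are the quadratic interpolants
  of the listed values at three vertices and three midpoints. The coefficients are confirmed by
  \<open>product_value_face\<close>.\<close>

definition face_scalar :: "real \<Rightarrow> real \<Rightarrow> real \<Rightarrow> real \<Rightarrow> real \<Rightarrow> real \<Rightarrow>
  real \<Rightarrow> real \<Rightarrow> real \<Rightarrow> real \<Rightarrow> real \<Rightarrow> real \<Rightarrow> real" where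
  "face_scalar g0 g1 g2 g01 g12 g02 h0 h1 h2 h01 h12 h02 =
     - 2 * (g0 * h1 - g1 * h0) + 2 * (g0 * h2 - g2 * h0) + 14 * (g0 * h01 - g01 * h0) - 14 * (g0 * h02 - g02 * h0)
     - (g1 * h2 - g2 * h1) - 3 * (g1 * h01 - g01 * h1) + 3 * (g1 * h12 - g12 * h1) - (g1 * h02 - g02 * h1)
     + (g2 * h01 - g01 * h2) - 3 * (g2 * h12 - g12 * h2) + 3 * (g2 * h02 - g02 * h2)
     + 4 * (g01 * h12 - g12 * h01) + 8 * (g01 * h02 - g02 * h01) + 4 * (g12 * h02 - g02 * h12)"

text \<open>Stokes' theorem for quadratic interpolants on a tetrahedron, stated as a polynomial
  identity. The \<open>q\<close> are five times the quadrature sums of products of slopes in the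
  closed form of \<open>quad_point_product_sum\<close>; naming them and the row sums keeps the
  identity within reach of ideal membership.\<close>

lemma face_scalar_stokes:
  fixes p0 p1 p2 p3 g0 g1 g2 g3 g01 g02 g03 g12 g13 g23 h0 h1 h2 h3 h01 h02 h03 h12 h13 h23 :: real
  assumes G: "G0 = g0 + g01 + g02 + g03" "G1 = g01 + g1 + g12 + g13" "G2 = g02 + g12 + g2 + g23" "G3 = g03 + g13 + g23 + g3"
    and H: "H0 = h0 + h01 + h02 + h03" "H1 = h01 + h1 + h12 + h13" "H2 = h02 + h12 + h2 + h23" "H3 = h03 + h13 + h23 + h3"
    and q: "q01 = (16 * (G0 * H1 + (g0 * h01 + g01 * h1 + g02 * h12 + g03 * h13)) - 20 * (G0 * h1 + g0 * H1) + 20 * g0 * h1)"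
      "q02 = (16 * (G0 * H2 + (g0 * h02 + g01 * h12 + g02 * h2 + g03 * h23)) - 20 * (G0 * h2 + g0 * H2) + 20 * g0 * h2)"
      "q03 = (16 * (G0 * H3 + (g0 * h03 + g01 * h13 + g02 * h23 + g03 * h3)) - 20 * (G0 * h3 + g0 * H3) + 20 * g0 * h3)"
      "q10 = (16 * (G1 * H0 + (g01 * h0 + g1 * h01 + g12 * h02 + g13 * h03)) - 20 * (G1 * h0 + g1 * H0) + 20 * g1 * h0)"
      "q12 = (16 * (G1 * H2 + (g01 * h02 + g1 * h12 + g12 * h2 + g13 * h23)) - 20 * (G1 * h2 + g1 * H2) + 20 * g1 * h2)"
      "q13 = (16 * (G1 * H3 + (g01 * h03 + g1 * h13 + g12 * h23 + g13 * h3)) - 20 * (G1 * h3 + g1 * H3) + 20 * g1 * h3)"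
      "q20 = (16 * (G2 * H0 + (g02 * h0 + g12 * h01 + g2 * h02 + g23 * h03)) - 20 * (G2 * h0 + g2 * H0) + 20 * g2 * h0)"
      "q21 = (16 * (G2 * H1 + (g02 * h01 + g12 * h1 + g2 * h12 + g23 * h13)) - 20 * (G2 * h1 + g2 * H1) + 20 * g2 * h1)"
      "q23 = (16 * (G2 * H3 + (g02 * h03 + g12 * h13 + g2 * h23 + g23 * h3)) - 20 * (G2 * h3 + g2 * H3) + 20 * g2 * h3)"
      "q30 = (16 * (G3 * H0 + (g03 * h0 + g13 * h01 + g23 * h02 + g3 * h03)) - 20 * (G3 * h0 + g3 * H0) + 20 * g3 * h0)"
      "q31 = (16 * (G3 * H1 + (g03 * h01 + g13 * h1 + g23 * h12 + g3 * h13)) - 20 * (G3 * h1 + g3 * H1) + 20 * g3 * h1)"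
      "q32 = (16 * (G3 * H2 + (g03 * h02 + g13 * h12 + g23 * h2 + g3 * h23)) - 20 * (G3 * h2 + g3 * H2) + 20 * g3 * h2)"
  shows "(p1 - p0) * (q23 - q20 - q03 - (q32 - q30 - q02)) + (p2 - p0) * (q31 - q30 - q01 - (q13 - q10 - q03)) + (p3 - p0) * (q12 - q10 - q02 - (q21 - q20 - q01)) =
    4 * (p1 * face_scalar g1 g2 g3 g12 g23 g13 h1 h2 h3 h12 h23 h13 +
    p2 * face_scalar g2 g3 g1 g23 g13 g12 h2 h3 h1 h23 h13 h12 +
    p3 * face_scalar g3 g1 g2 g13 g12 g23 h3 h1 h2 h13 h12 h23 +
    p0 * face_scalar g0 g3 g2 g03 g23 g02 h0 h3 h2 h03 h23 h02 +
    p3 * face_scalar g3 g2 g0 g23 g02 g03 h3 h2 h0 h23 h02 h03 +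
    p2 * face_scalar g2 g0 g3 g02 g03 g23 h2 h0 h3 h02 h03 h23 +
    p0 * face_scalar g0 g1 g3 g01 g13 g03 h0 h1 h3 h01 h13 h03 +
    p1 * face_scalar g1 g3 g0 g13 g03 g01 h1 h3 h0 h13 h03 h01 +
    p3 * face_scalar g3 g0 g1 g03 g01 g13 h3 h0 h1 h03 h01 h13 +
    p0 * face_scalar g0 g2 g1 g02 g12 g01 h0 h2 h1 h02 h12 h01 +
    p2 * face_scalar g2 g1 g0 g12 g01 g02 h2 h1 h0 h12 h01 h02 +
    p1 * face_scalar g1 g0 g2 g01 g02 g12 h1 h0 h2 h01 h02 h12)"
  unfolding q G H face_scalar_def by algebra

unbundle cross3_syntax

definition face_coef :: "(real^3 \<Rightarrow> real^3) \<Rightarrow> (real^3 \<Rightarrow> real^3) \<Rightarrow> real^3 \<Rightarrow> real^3 \<Rightarrow> real^3 \<Rightarrow> real^3" where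
  "face_coef g h x y z =
     (let xy = mid x y; yz = mid y z; xz = mid x z in
      (- 2) *\<^sub>R (g x \<times> h y) + 2 *\<^sub>R (g x \<times> h z) + 14 *\<^sub>R (g x \<times> h xy) - 14 *\<^sub>R (g x \<times> h xz)
      - g y \<times> h z - 3 *\<^sub>R (g y \<times> h xy) + 3 *\<^sub>R (g y \<times> h yz) - g y \<times> h xz
      + g z \<times> h xy - 3 *\<^sub>R (g z \<times> h yz) + 3 *\<^sub>R (g z \<times> h xz)
      + 4 *\<^sub>R (g xy \<times> h yz) + 8 *\<^sub>R (g xy \<times> h xz) + 4 *\<^sub>R (g yz \<times> h xz))"

text \<open>For \<open>g\<close> quadratic on the triangle with vertices \<open>x\<close>, \<open>y\<close>, \<open>z\<close> and parametrization \<open>P\<close>, the value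
  \<open>tri_form g g x y z\<close> is the integral of \<open>P \<bullet> (\<partial>\<^sub>1 (g \<circ> P) \<times> \<partial>\<^sub>2 (g \<circ> P))\<close>, written in nodal values.\<close>
definition tri_form :: "(real^3 \<Rightarrow> real^3) \<Rightarrow> (real^3 \<Rightarrow> real^3) \<Rightarrow> real^3 \<Rightarrow> real^3 \<Rightarrow> real^3 \<Rightarrow> real" where
  "tri_form g h x y z =
     1/30 * (x \<bullet> face_coef g h x y z + y \<bullet> face_coef g h y z x + z \<bullet> face_coef g h z x y)"

lemma tri_form_rotate: "tri_form g h y z x = tri_form g h x y z"
  by (simp add: tri_form_def)

lemma triple_product: "x \<bullet> (u \<times> v) = x$1 * (u$2 * v$3 - u$3 * v$2) + x$2 * (u$3 * v$1 - u$1 * v$3) + x$3 * (u$1 * v$2 - u$2 * v$1)"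
  by (simp add: cross3_def inner_vec_def sum_3)

definition face_comp :: "(real^3 \<Rightarrow> real^3) \<Rightarrow> real^3 \<Rightarrow> real^3 \<Rightarrow> real^3 \<Rightarrow> 3 \<Rightarrow> 3 \<Rightarrow> real" where
  "face_comp g x y z i j =
     (let xy = mid x y; yz = mid y z; xz = mid x z in
      face_scalar (g x $ i) (g y $ i) (g z $ i) (g xy $ i) (g yz $ i) (g xz $ i)
        (g x $ j) (g y $ j) (g z $ j) (g xy $ j) (g yz $ j) (g xz $ j))"

lemma inner_face_coef:
  "p \<bullet> face_coef g g x y z = p$1 * face_comp g x y z 2 3 + p$2 * face_comp g x y z 3 1 + p$3 * face_comp g x y z 1 2"
  unfolding face_coef_def face_comp_def face_scalar_def Let_def
  by (simp add: inner_add_right inner_diff_right triple_product del: scaleR_right_distrib) algebra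

lemma face_comp_swap: "face_comp g x z y i j = - face_comp g x y z i j"
  unfolding face_comp_def face_scalar_def Let_def add.commute[of z y] by algebra

lemma face_coef_swap: "face_coef g g x z y = - face_coef g g x y z"
proof -
  have "p \<bullet> face_coef g g x z y = p \<bullet> (- face_coef g g x y z)" for p
    unfolding inner_minus_right inner_face_coef face_comp_swap[of g x z y] by simp
  then show ?thesis by (metis vector_eq_rdot inner_commute)
qed

text \<open>Together with \<open>tri_form_rotate\<close> this makes the form alternating in the
  vertices, so that a face seen from its two sides contributes with opposite signs.\<close>

lemma tri_form_swap: "tri_form g g x z y = - tri_form g g x y z"
  unfolding tri_form_def face_coef_swap[of g x z y] face_coef_swap[of g z y x] face_coef_swap[of g y x z]
  by (simp add: algebra_simps)

text \<open>The weights c = (5 - sqrt 5)/5 and d = 4 sqrt 5/5 enter only through 4 c^2 + 2 c d =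
  16/5, d^2 = 16/5 and 4 c + d = 4, so that sqrt 5 disappears. This reflects the exactness of the
  quadrature on products of two affine functions.\<close>

lemma quad_point_product_sum:
  fixes g h :: "real^3 \<Rightarrow> real"
  defines "G \<equiv> \<Sum>l\<in>ref_corners. g l" and "H \<equiv> \<Sum>l\<in>ref_corners. h l"
  shows "5 * (\<Sum>w\<in>ref_corners. ((5 - sqrt 5) / 5 * G + 4 * sqrt 5 / 5 * g w - p) * ((5 - sqrt 5) / 5 * H + 4 * sqrt 5 / 5 * h w - q)) =
    16 * (G * H + (\<Sum>w\<in>ref_corners. g w * h w)) - 20 * (G * q + p * H) + 20 * p * q"
proof -
  have 5: "sqrt 5 * sqrt 5 = (5::real)" by simp
  define c where "c = (5 - sqrt 5) / 5"
  define d where "d = 4 * sqrt 5 / 5"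
  have cd: "5 * (4 * c * c + 2 * c * d) = 16" "5 * d * d = 16" "4 * c + d = 4"
    unfolding c_def d_def using 5 by (simp_all add: field_simps)
  have G: "G = g 0 + g (axis 1 1) + g (axis 2 1) + g (axis 3 1)" "H = h 0 + h (axis 1 1) + h (axis 2 1) + h (axis 3 1)"
    by (simp_all add: G_def H_def sum_ref_corners)
  have "(\<Sum>w\<in>ref_corners. (c * G + d * g w - p) * (c * H + d * h w - q)) =
      (4 * c * c + 2 * c * d) * (G * H) + d * d * (\<Sum>w\<in>ref_corners. g w * h w) - (4 * c + d) * (G * q + p * H) + 4 * (p * q)"
    unfolding sum_ref_corners G by algebra
  moreover have "5 * (\<alpha> * X + d * d * Y - \<beta> * Z + 4 * U) = (5 * \<alpha>) * X + (5 * d * d) * Y - 5 * \<beta> * Z + 20 * U"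
    for \<alpha> \<beta> X Y Z U
    by (simp add: algebra_simps)
  ultimately have "5 * (\<Sum>w\<in>ref_corners. (c * G + d * g w - p) * (c * H + d * h w - q)) =
      (5 * (4 * c * c + 2 * c * d)) * (G * H) + (5 * d * d) * (\<Sum>w\<in>ref_corners. g w * h w) - 5 * (4 * c + d) * (G * q + p * H) + 20 * (p * q)"
    by (simp only:)
  then show ?thesis unfolding cd c_def[symmetric] d_def[symmetric] by simp
qed

text \<open>Both sides are trilinear in nodal values, so that the identity is one between polynomials.\<close>
lemma cell_stokes:
  assumes \<tau>: "\<And>\<xi>. \<tau> \<xi> = M *v \<xi> + b"
  defines "x0 \<equiv> \<tau> 0" and "x1 \<equiv> \<tau> (axis 1 1)" and "x2 \<equiv> \<tau> (axis 2 1)" and "x3 \<equiv> \<tau> (axis 3 1)"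
  shows "(\<Sum>w\<in>ref_corners. 1/24 * frob M (cof (nodal_jac (\<lambda>\<xi>. g (\<tau> \<xi>)) (quad_point w)))) =
    tri_form g g x1 x2 x3 + tri_form g g x0 x3 x2 + tri_form g g x0 x1 x3 + tri_form g g x0 x2 x1"
proof -
  let ?f = "\<lambda>\<xi>. g (\<tau> \<xi>)"
  have mid: "\<tau> (mid v w) = mid (\<tau> v) (\<tau> w)" for v w
    by (simp add: \<tau> matrix_vector_right_distrib matrix_vector_mult_scaleR vec_eq_iff field_simps)
  define s where "s l w = slope ?f (quad_point w) l" for l w
  define Q where "Q i j l m = 5 * (\<Sum>w\<in>ref_corners. s l w $ i * s m w $ j)" for i j l m
  have M: "M $ i $ 1 = x1 $ i - x0 $ i" "M $ i $ 2 = x2 $ i - x0 $ i" "M $ i $ 3 = x3 $ i - x0 $ i" for i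
    by (simp_all add: x0_def x1_def x2_def x3_def \<tau> matrix_vector_mult_basis column_def)
  have J: "nodal_jac ?f (quad_point w) $ i $ j = s (axis j 1) w $ i - s 0 w $ i" for w i j
    by (simp add: nodal_jac_def s_def)
  define D where "D i j l m = Q i j l m - Q i j l 0 - Q i j 0 m - (Q i j m l - Q i j m 0 - Q i j 0 l)" for i j l m
  define N where "N i j k = (x1$i - x0$i) * D j k (axis 2 1) (axis 3 1) + (x2$i - x0$i) * D j k (axis 3 1) (axis 1 1) +
     (x3$i - x0$i) * D j k (axis 1 1) (axis 2 1)" for i j k
  \<comment> \<open>The factor 120 clears the weight 1/24 and supplies the factor 5 of
    \<open>quad_point_product_sum\<close>; it also equals 4 times the denominator 30 of
    \<open>tri_form\<close>.\<close>
  have "120 * (\<Sum>w\<in>ref_corners. 1/24 * frob M (cof (nodal_jac ?f (quad_point w)))) =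
      5 * (\<Sum>w\<in>ref_corners. frob M (cof (nodal_jac ?f (quad_point w))))"
    by (simp add: sum_distrib_left)
  also have "\<dots> = N 1 2 3 + N 2 3 1 + N 3 1 2"
    unfolding N_def D_def Q_def sum_ref_corners frob_expand cof_nth J M by algebra
  finally have "120 * (\<Sum>w\<in>ref_corners. 1/24 * frob M (cof (nodal_jac ?f (quad_point w)))) = N 1 2 3 + N 2 3 1 + N 3 1 2" .
  moreover have "N i j k = 4 * (x1$i * face_comp g x1 x2 x3 j k + x2$i * face_comp g x2 x3 x1 j k + x3$i * face_comp g x3 x1 x2 j k +
      x0$i * face_comp g x0 x3 x2 j k + x3$i * face_comp g x3 x2 x0 j k + x2$i * face_comp g x2 x0 x3 j k +
      x0$i * face_comp g x0 x1 x3 j k + x1$i * face_comp g x1 x3 x0 j k + x3$i * face_comp g x3 x0 x1 j k +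
      x0$i * face_comp g x0 x2 x1 j k + x2$i * face_comp g x2 x1 x0 j k + x1$i * face_comp g x1 x0 x2 j k)" for i j k
  proof -
    have Q: "Q j k l m = 16 * ((\<Sum>y\<in>ref_corners. g (mid (\<tau> l) (\<tau> y)) $ j) * (\<Sum>y\<in>ref_corners. g (mid (\<tau> m) (\<tau> y)) $ k) +
        (\<Sum>y\<in>ref_corners. g (mid (\<tau> l) (\<tau> y)) $ j * g (mid (\<tau> m) (\<tau> y)) $ k)) -
      20 * ((\<Sum>y\<in>ref_corners. g (mid (\<tau> l) (\<tau> y)) $ j) * g (\<tau> m) $ k + g (\<tau> l) $ j * (\<Sum>y\<in>ref_corners. g (mid (\<tau> m) (\<tau> y)) $ k)) +
      20 * g (\<tau> l) $ j * g (\<tau> m) $ k" for l m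
    proof -
      have "Q j k l m = 5 * (\<Sum>w\<in>ref_corners. ((5 - sqrt 5) / 5 * (\<Sum>y\<in>ref_corners. g (mid (\<tau> l) (\<tau> y)) $ j) + 4 * sqrt 5 / 5 * g (mid (\<tau> l) (\<tau> w)) $ j - g (\<tau> l) $ j) *
        ((5 - sqrt 5) / 5 * (\<Sum>y\<in>ref_corners. g (mid (\<tau> m) (\<tau> y)) $ k) + 4 * sqrt 5 / 5 * g (mid (\<tau> m) (\<tau> w)) $ k - g (\<tau> m) $ k))"
        unfolding Q_def s_def by (intro arg_cong[of _ _ "(*) 5"] sum.cong refl) (simp only: slope_quad_point mid, simp)
      then show ?thesis by (simp only: quad_point_product_sum)
    qed
    note comm = add.commute[of x3 x0] add.commute[of x3 x1] add.commute[of x3 x2] add.commute[of x2 x0]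
      add.commute[of x2 x1] add.commute[of x1 x0]
    show ?thesis
      unfolding N_def D_def face_comp_def Let_def comm
      by (rule face_scalar_stokes[OF refl refl refl refl refl refl refl refl])
        (simp_all only: Q sum_ref_corners mid_self comm x0_def[symmetric] x1_def[symmetric] x2_def[symmetric] x3_def[symmetric])
  qed
  ultimately have "120 * (\<Sum>w\<in>ref_corners. 1/24 * frob M (cof (nodal_jac ?f (quad_point w)))) =
      120 * (tri_form g g x1 x2 x3 + tri_form g g x0 x3 x2 + tri_form g g x0 x1 x3 + tri_form g g x0 x2 x1)"
    unfolding tri_form_def inner_face_coef by (simp add: algebra_simps)
  then show ?thesis by simp
qed

unbundle cross3_syntax

definition tri_param :: "real^3 \<Rightarrow> real^3 \<Rightarrow> real^3 \<Rightarrow> real^2 \<Rightarrow> real^3" where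
  "tri_param x y z \<eta> = (1 - \<eta>$1 - \<eta>$2) *\<^sub>R x + \<eta>$1 *\<^sub>R y + \<eta>$2 *\<^sub>R z"

definition tri_slope :: "(real^3 \<Rightarrow> real^3) \<Rightarrow> real^3 \<Rightarrow> real^3 \<Rightarrow> real^3 \<Rightarrow> real^2 \<Rightarrow> real^3 \<Rightarrow> real^3" where
  "tri_slope g x y z \<eta> v = 4 *\<^sub>R ((1 - \<eta>$1 - \<eta>$2) *\<^sub>R g (mid v x) + \<eta>$1 *\<^sub>R g (mid v y) +
     \<eta>$2 *\<^sub>R g (mid v z)) - g v"

definition product_value :: "real \<Rightarrow> real \<Rightarrow> real \<Rightarrow> real \<Rightarrow> real \<Rightarrow> real \<Rightarrow> real \<Rightarrow> real \<Rightarrow> real \<Rightarrow> real" where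
  "product_value p0 p1 p2 q0 q1 q2 r0 r1 r2 = (p0 + p1 + p2) * (q0 + q1 + q2) * (r0 + r1 + r2) + (p0 + p1 + p2) * (q0 * r0 + q1 * r1 + q2 * r2) +
       (q0 + q1 + q2) * (p0 * r0 + p1 * r1 + p2 * r2) + (r0 + r1 + r2) * (p0 * q0 + p1 * q1 + p2 * q2) +
       2 * (p0 * q0 * r0 + p1 * q1 * r1 + p2 * q2 * r2)"

text \<open>The last two triples of arguments are the values of d1 g and d2 h at the three vertices,
  in the second term those of d1 h and d2 g; for instance 4 g01 - g1 - 3 g0 is d1 g at the first
  vertex.\<close>

lemma product_value_face:
  "product_value p0 p1 p2 (4 * g01 - g1 - 3 * g0) (3 * g1 - (4 * g01 - g0)) (4 * g12 - g1 - (4 * g02 - g0))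
       (4 * h02 - h2 - 3 * h0) (4 * h12 - h2 - (4 * h01 - h0)) (3 * h2 - (4 * h02 - h0)) -
     product_value p0 p1 p2 (4 * h01 - h1 - 3 * h0) (3 * h1 - (4 * h01 - h0)) (4 * h12 - h1 - (4 * h02 - h0))
       (4 * g02 - g2 - 3 * g0) (4 * g12 - g2 - (4 * g01 - g0)) (3 * g2 - (4 * g02 - g0)) =
   4 * (p0 * face_scalar g0 g1 g2 g01 g12 g02 h0 h1 h2 h01 h12 h02 + p1 * face_scalar g1 g2 g0 g12 g02 g01 h1 h2 h0 h12 h02 h01 +
     p2 * face_scalar g2 g0 g1 g02 g01 g12 h2 h0 h1 h02 h01 h12)"
  unfolding product_value_def face_scalar_def by algebra

lemma tri_form_integral:
  "((\<lambda>\<eta>. tri_param x y z \<eta> \<bullet> ((tri_slope g x y z \<eta> y - tri_slope g x y z \<eta> x) \<times> (tri_slope g x y z \<eta> z - tri_slope g x y z \<eta> x)))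
     has_integral tri_form g g x y z) ref_tri"
proof -
  define xy yz xz where "xy = mid x y" and "yz = mid y z" and "xz = mid x z"
  have mids: "mid x y = xy" "mid y x = xy" "mid y z = yz" "mid z y = yz"
    "mid x z = xz" "mid z x = xz"
    by (simp_all add: xy_def yz_def xz_def add.commute)
  define A where "A b = affine3 (4 * g xy $ b - g y $ b - 3 * g x $ b) (3 * g y $ b - (4 * g xy $ b - g x $ b))
      (4 * g yz $ b - g y $ b - (4 * g xz $ b - g x $ b))" for b
  define B where "B b = affine3 (4 * g xz $ b - g z $ b - 3 * g x $ b) (4 * g yz $ b - g z $ b - (4 * g xy $ b - g x $ b))
      (3 * g z $ b - (4 * g xz $ b - g x $ b))" for b
  define P where "P a = affine3 (x$a) (y$a) (z$a)" for a
  have eqA: "(tri_slope g x y z \<eta> y - tri_slope g x y z \<eta> x) $ b = A b \<eta>" for \<eta> b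
    unfolding tri_slope_def mids mid_self A_def affine3_def by (simp add: algebra_simps)
  have eqB: "(tri_slope g x y z \<eta> z - tri_slope g x y z \<eta> x) $ b = B b \<eta>" for \<eta> b
    unfolding tri_slope_def mids mid_self B_def affine3_def by (simp add: algebra_simps)
  have eqP: "tri_param x y z \<eta> $ a = P a \<eta>" for \<eta> a
    unfolding tri_param_def P_def affine3_def by (simp add: algebra_simps)
  have *: "((\<lambda>\<eta>. P a \<eta> * (A b \<eta> * B c \<eta>) - P a \<eta> * (A c \<eta> * B b \<eta>)) has_integral
      1/30 * (x$a * face_comp g x y z b c + y$a * face_comp g y z x b c + z$a * face_comp g z x y b c)) ref_tri" for a b c
  proof -
    have aux: "1/120 * (4 * t) = 1/30 * t" for t :: real by simp
    note i = has_integral_diff[OF product_integral_ref_tri product_integral_ref_tri, folded product_value_def]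
    note v = product_value_face[THEN arg_cong[of _ _ "(*) (1/120)"], unfolded aux right_diff_distrib]
    show ?thesis
      unfolding P_def A_def B_def face_comp_def Let_def mids v[symmetric] by (rule i)
  qed
  have "((\<lambda>\<eta>. (P 1 \<eta> * (A 2 \<eta> * B 3 \<eta>) - P 1 \<eta> * (A 3 \<eta> * B 2 \<eta>)) + (P 2 \<eta> * (A 3 \<eta> * B 1 \<eta>) - P 2 \<eta> * (A 1 \<eta> * B 3 \<eta>)) +
      (P 3 \<eta> * (A 1 \<eta> * B 2 \<eta>) - P 3 \<eta> * (A 2 \<eta> * B 1 \<eta>))) has_integral
      (1/30 * (x$1 * face_comp g x y z 2 3 + y$1 * face_comp g y z x 2 3 + z$1 * face_comp g z x y 2 3) +
       1/30 * (x$2 * face_comp g x y z 3 1 + y$2 * face_comp g y z x 3 1 + z$2 * face_comp g z x y 3 1) +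
       1/30 * (x$3 * face_comp g x y z 1 2 + y$3 * face_comp g y z x 1 2 + z$3 * face_comp g z x y 1 2))) ref_tri"
    by (intro has_integral_add *)
  moreover have "(1/30 * (x$1 * face_comp g x y z 2 3 + y$1 * face_comp g y z x 2 3 + z$1 * face_comp g z x y 2 3) +
       1/30 * (x$2 * face_comp g x y z 3 1 + y$2 * face_comp g y z x 3 1 + z$2 * face_comp g z x y 3 1) +
       1/30 * (x$3 * face_comp g x y z 1 2 + y$3 * face_comp g y z x 1 2 + z$3 * face_comp g z x y 1 2)) = tri_form g g x y z"
    unfolding tri_form_def inner_face_coef by (simp add: algebra_simps)
  ultimately show ?thesis
    unfolding triple_product eqA eqB eqP by (simp add: right_diff_distrib)
qed

definition ref_opposite :: "((real^3) \<times> (real^3) \<times> (real^3)) set" where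
  "ref_opposite = {(axis 1 1, axis 2 1, axis 3 1), (0, axis 3 1, axis 2 1), (0, axis 1 1, axis 3 1), (0, axis 2 1, axis 1 1)}"

lemma ref_faces_eq: "ref_faces = (\<lambda>(l0, l1, l2). tri_param l0 l1 l2) ` ref_opposite"
proof -
  have "(\<lambda>\<eta>. vector [1 - \<eta>$1 - \<eta>$2, \<eta>$1, \<eta>$2]) = tri_param (axis 1 1) (axis 2 1) (axis 3 1)"
    "(\<lambda>\<eta>. vector [0, \<eta>$2, \<eta>$1]) = tri_param 0 (axis 3 1) (axis 2 1)"
    "(\<lambda>\<eta>. vector [\<eta>$1, 0, \<eta>$2]) = tri_param 0 (axis 1 1) (axis 3 1)"
    "(\<lambda>\<eta>. vector [\<eta>$2, \<eta>$1, 0]) = tri_param 0 (axis 2 1) (axis 1 1)"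
    by (auto simp: fun_eq_iff tri_param_def vec_eq_iff forall_3 axis_nth_3)
  then show ?thesis by (simp add: ref_faces_def ref_opposite_def)
qed

lemma tri_param_at: "tri_param x y z 0 = x" "tri_param x y z (axis 1 1) = y" "tri_param x y z (axis 2 1) = z"
  by (simp_all add: tri_param_def axis_def)

lemma inj_on_tri_param: "inj_on (\<lambda>(l0, l1, l2). tri_param l0 l1 l2) S"
  by (auto simp: inj_on_def tri_param_at dest: fun_cong[of _ _ 0] fun_cong[of _ _ "axis 1 1"] fun_cong[of _ _ "axis 2 1"])

lemma affine_tri_param:
  assumes "\<And>\<xi>. \<tau> \<xi> = M *v \<xi> + b"
  shows "\<tau> (tri_param x y z \<eta>) = tri_param (\<tau> x) (\<tau> y) (\<tau> z) \<eta>"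
  unfolding assms tri_param_def
  by (simp add: matrix_vector_right_distrib matrix_vector_mult_scaleR vec_eq_iff algebra_simps)

lemma slope_tri_param:
  assumes "x \<in> ref_corners" "y \<in> ref_corners" "z \<in> ref_corners"
  shows "slope f (tri_param x y z \<eta>) v = tri_slope f x y z \<eta> v"
proof -
  have "slope f (tri_param x y z \<eta>) v = (1 - \<eta>$1 - \<eta>$2) *\<^sub>R slope f x v + \<eta>$1 *\<^sub>R slope f y v + \<eta>$2 *\<^sub>R slope f z v"
  proof -
    have "slope f (tri_param x y z \<eta>) v $ i = ((1 - \<eta>$1 - \<eta>$2) *\<^sub>R slope f x v + \<eta>$1 *\<^sub>R slope f y v + \<eta>$2 *\<^sub>R slope f z v) $ i" for i
      unfolding slope_def tri_param_def vector_add_component vector_minus_component vector_scaleR_component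
      by (simp only: real_scaleR_def) algebra
    then show ?thesis by (simp add: vec_eq_iff)
  qed
  then show ?thesis
    unfolding slope_corner[OF assms(1)] slope_corner[OF assms(2)] slope_corner[OF assms(3)] tri_slope_def
    by (simp add: vec_eq_iff algebra_simps del: scaleR_right_distrib)
qed

lemma smooth_tri_param:
  assumes "(x, y, z) \<in> ref_opposite" "0 < \<eta>$1" "0 < \<eta>$2" "\<eta>$1 + \<eta>$2 < 1"
  shows "smooth_point (tri_param x y z \<eta>)"
  using assms by (auto simp: ref_opposite_def smooth_point_def ref_tet_iff tri_param_def axis_nth_3)

lemma ref_opposite_corners: "(x, y, z) \<in> ref_opposite \<Longrightarrow> x \<in> ref_corners \<and> y \<in> ref_corners \<and> z \<in> ref_corners"
  by (auto simp: ref_opposite_def ref_corners_def)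

lemma cof_cross: "cof A *v (u \<times> v) = (A *v u) \<times> (A *v v)"
  by (simp add: vec_eq_iff forall_3 cross3_def matrix_vector_mult_def sum_3 cof_nth) algebra

definition open_tri :: "(real^2) set" where
  "open_tri = {\<eta>. 0 < \<eta>$1 \<and> 0 < \<eta>$2 \<and> \<eta>$1 + \<eta>$2 < 1}"

lemma open_open_tri: "open open_tri"
  unfolding open_tri_def by (intro open_Collect_conj open_Collect_less continuous_intros)

lemma negligible_ref_tri_diff: "negligible (ref_tri - open_tri)"
proof (rule negligible_subset)
  show "negligible ({\<eta>::real^2. axis 1 1 \<bullet> \<eta> = 0} \<union> {\<eta>. axis 2 1 \<bullet> \<eta> = 0} \<union> {\<eta>. (axis 1 1 + axis 2 1) \<bullet> \<eta> = 1})"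
    by (intro negligible_Un negligible_hyperplane) auto
  show "ref_tri - open_tri \<subseteq> {\<eta>::real^2. axis 1 1 \<bullet> \<eta> = 0} \<union> {\<eta>. axis 2 1 \<bullet> \<eta> = 0} \<union> {\<eta>. (axis 1 1 + axis 2 1) \<bullet> \<eta> = 1}"
    by (auto simp: ref_tri_def open_tri_def inner_axis' inner_add_left)
qed

lemma has_derivative_tri_param:
  "(tri_param x y z has_derivative (\<lambda>h. h$1 *\<^sub>R (y - x) + h$2 *\<^sub>R (z - x))) (at \<eta> within S)"
  unfolding tri_param_def[abs_def]
  by (auto intro!: derivative_eq_intros bounded_linear.has_derivative[OF bounded_linear_vec_nth] simp: algebra_simps)

text \<open>The derivative of the cell map is known only within \<open>ref_tet\<close>. The open
  triangle is mapped into \<open>ref_tet\<close> and is open in the plane, so that composing with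
  the parametrization yields a full derivative.\<close>

lemma tangent_cross_tri_param:
  assumes "(X has_derivative (\<lambda>h. J *v h)) (at (tri_param x y z \<eta>) within ref_tet)"
    "(x, y, z) \<in> ref_opposite" "\<eta> \<in> open_tri"
  shows "tangent_cross (X \<circ> tri_param x y z) \<eta> = (J *v (y - x)) \<times> (J *v (z - x))"
proof -
  have sub: "tri_param x y z ` open_tri \<subseteq> ref_tet"
    using smooth_tri_param[OF assms(2)] by (auto simp: open_tri_def smooth_point_def)
  have "(X \<circ> tri_param x y z has_derivative (\<lambda>h. J *v h) \<circ> (\<lambda>h. h$1 *\<^sub>R (y - x) + h$2 *\<^sub>R (z - x))) (at \<eta> within open_tri)"
    by (rule diff_chain_within[OF has_derivative_tri_param has_derivative_subset[OF assms(1) sub]])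
  then have "(X \<circ> tri_param x y z has_derivative (\<lambda>h. J *v (h$1 *\<^sub>R (y - x) + h$2 *\<^sub>R (z - x)))) (at \<eta>)"
    by (simp add: at_within_open[OF assms(3) open_open_tri] o_def)
  then have "frechet_derivative (X \<circ> tri_param x y z) (at \<eta>) = (\<lambda>h. J *v (h$1 *\<^sub>R (y - x) + h$2 *\<^sub>R (z - x)))"
    by (rule frechet_derivative_at[symmetric])
  then show ?thesis by (simp add: tangent_cross_def axis_def)
qed

section \<open>Boundary integrals in nodal values\<close>

context mesh
begin

definition face_value where
  "face_value w = (\<lambda>(e, \<sigma>). tri_form (w \<circ> ref_map a) (w \<circ> ref_map a) (\<tau> e (\<sigma> 0)) (\<tau> e (\<sigma> (axis 1 1))) (\<tau> e (\<sigma> (axis 2 1))))"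

text \<open>Nanson's formula: the surface element cancels the normalization of the normal, and
  \<open>cof (A ** matrix_inv J)\<close> maps the cross product of the tangents
  \<open>J *v h\<close> to that of the vectors \<open>A *v h\<close>. These are tangential
  derivatives, so that only nodal values on the face enter. The factor 4 is that of the
  potential.\<close>

lemma boundary_face_integral:
  assumes "w \<in> fe_space a \<tau>" "e \<in> cells" "\<sigma> \<in> ref_faces"
  shows "integral ref_tri (\<lambda>\<eta>. z ((cmap e \<circ> \<sigma>) \<eta>) \<bullet>
      (cof (grad cmap w e (\<sigma> \<eta>)) *v unit_normal (cmap e \<circ> \<sigma>) \<eta>) * norm (tangent_cross (cmap e \<circ> \<sigma>) \<eta>)) =
    4 * face_value w (e, \<sigma>)"
proof -
  obtain x y zz where \<sigma>: "\<sigma> = tri_param x y zz" and mem: "(x, y, zz) \<in> ref_opposite"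
    using assms(3) unfolding ref_faces_eq by auto
  obtain M b where mc: "mesh_cell e (\<tau> e) M b a" using mesh_cell_exists[OF assms(2)] .
  interpret mesh_cell e "\<tau> e" M b a by fact
  note corners = ref_opposite_corners[OF mem]
  let ?g = "w \<circ> ref_map a"
  let ?f = "w \<circ> cmap e"
  have f: "?f = (\<lambda>\<xi>. ?g (\<tau> e \<xi>))" by (auto simp: cell_map_def)
  let ?x = "\<tau> e x" and ?y = "\<tau> e y" and ?z = "\<tau> e zz"
  let ?F = "\<lambda>\<eta>. tri_param ?x ?y ?z \<eta> \<bullet> ((tri_slope ?g ?x ?y ?z \<eta> ?y - tri_slope ?g ?x ?y ?z \<eta> ?x) \<times> (tri_slope ?g ?x ?y ?z \<eta> ?z - tri_slope ?g ?x ?y ?z \<eta> ?x))"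
  have "z ((cmap e \<circ> \<sigma>) \<eta>) \<bullet> (cof (grad cmap w e (\<sigma> \<eta>)) *v unit_normal (cmap e \<circ> \<sigma>) \<eta>) * norm (tangent_cross (cmap e \<circ> \<sigma>) \<eta>) =
      4 * ?F \<eta>" if \<eta>: "\<eta> \<in> open_tri" for \<eta>
  proof -
    let ?\<xi> = "tri_param x y zz \<eta>"
    have sm: "smooth_point ?\<xi>" using smooth_tri_param[OF mem] \<eta> by (auto simp: open_tri_def)
    then have \<xi>: "?\<xi> \<in> ref_tet" by (simp add: smooth_point_def)
    define T where "T = tangent_cross (cmap e \<circ> \<sigma>) \<eta>"
    define J where "J = JX e ?\<xi>"
    have "(cmap e has_derivative (\<lambda>h. J *v h)) (at ?\<xi> within ref_tet)"
      using quadratic_has_derivative[OF quadratic_cell_map[OF assms(2)] \<xi>] jac_eq_nodal_jac[OF quadratic_cell_map[OF assms(2)] sm]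
      by (simp add: J_def)
    then have T: "T = (J *v (y - x)) \<times> (J *v (zz - x))"
      unfolding T_def \<sigma> by (rule tangent_cross_tri_param[OF _ mem \<eta>])
    have nrm: "norm T *\<^sub>R unit_normal (cmap e \<circ> \<sigma>) \<eta> = T"
      by (simp add: unit_normal_def T_def[symmetric])
    define A where "A = Jp w e ?\<xi>"
    have AJ: "(A ** matrix_inv J) *v (J *v h) = A *v h" for h
      using JX_det_nonzero[OF assms(2) sm]
      by (simp add: J_def matrix_vector_mul_assoc matrix_mul_assoc[symmetric] matrix_inv_mult)
    have A: "A = nodal_jac ?f ?\<xi>"
      unfolding A_def by (rule jac_eq_nodal_jac[OF quadratic_fe[OF assms(1,2)] sm])
    have slope: "slope ?f ?\<xi> l = tri_slope ?g ?x ?y ?z \<eta> (\<tau> e l)" for l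
      using corners by (simp add: slope_tri_param tri_slope_def f chart_midpoint del: scaleR_right_distrib)
    have d: "A *v (l - x) = tri_slope ?g ?x ?y ?z \<eta> (\<tau> e l) - tri_slope ?g ?x ?y ?z \<eta> ?x" if "l \<in> ref_corners" for l
      using corners that unfolding A by (simp add: nodal_jac_corner slope)
    have c1: "cof (A ** matrix_inv J) *v T = (A *v (y - x)) \<times> (A *v (zz - x))"
      unfolding T cof_cross AJ ..
    have c2: "z ((cmap e \<circ> \<sigma>) \<eta>) = 4 *\<^sub>R tri_param ?x ?y ?z \<eta>"
    proof -
      have "\<tau> e ?\<xi> \<in> cbox 0 1" using chart_in_tet[OF \<xi>] tetrahedron_subset_cube[OF assms(2)] by blast
      then show ?thesis
        by (simp add: \<sigma> cell_map_def potential affine_tri_param[OF chart_eq])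
    qed
    have c3: "grad cmap w e (\<sigma> \<eta>) = A ** matrix_inv J"
      by (simp add: grad_def \<sigma> A_def J_def)
    have c4: "p \<bullet> (B *v unit_normal (cmap e \<circ> \<sigma>) \<eta>) * norm T = p \<bullet> (B *v T)" for p B
      by (subst (2) nrm[symmetric]) (simp add: matrix_vector_mult_scaleR mult.commute)
    show ?thesis
      unfolding T_def[symmetric] c2 c3 c4 c1 using corners by (simp add: d)
  qed
  then have "((\<lambda>\<eta>. z ((cmap e \<circ> \<sigma>) \<eta>) \<bullet> (cof (grad cmap w e (\<sigma> \<eta>)) *v unit_normal (cmap e \<circ> \<sigma>) \<eta>) * norm (tangent_cross (cmap e \<circ> \<sigma>) \<eta>))
      has_integral 4 * tri_form ?g ?g ?x ?y ?z) ref_tri"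
    by (intro has_integral_spike[OF negligible_ref_tri_diff _ has_integral_mult_right[OF tri_form_integral]]) auto
  then show ?thesis
    by (simp add: integral_unique face_value_def \<sigma> tri_param_at)
qed

lemma boundary_functional_eq:
  assumes "w \<in> fe_space a \<tau>"
  shows "boundary_functional \<tau> cmap z w = (\<Sum>f\<in>boundary_faces \<tau>. 4 * face_value w f)"
  unfolding boundary_functional_def Let_def
proof (rule sum.cong[OF refl])
  fix f assume "f \<in> boundary_faces \<tau>"
  then obtain e \<sigma> where "f = (e, \<sigma>)" "e \<in> cells" "\<sigma> \<in> ref_faces"
    by (auto simp: boundary_faces_def)
  then show "(case f of (e, \<sigma>) \<Rightarrow> integral ref_tri (\<lambda>\<eta>. z ((cmap e \<circ> \<sigma>) \<eta>) \<bullet>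
      (cof (grad cmap w e (\<sigma> \<eta>)) *v unit_normal (cmap e \<circ> \<sigma>) \<eta>) * norm (tangent_cross (cmap e \<circ> \<sigma>) \<eta>))) =
    4 * face_value w f"
    by (simp only: prod.case boundary_face_integral[OF assms])
qed

end

unbundle no cross3_syntax

context mesh
begin

lemma coupling_eq:
  assumes "w \<in> fe_space a \<tau>"
  shows "coupling cmap z w = (\<Sum>f\<in>cells \<times> ref_faces. 4 * face_value w f)"
proof -
  have "Q4 (\<lambda>\<xi>. frob (jac (z \<circ> cmap e) \<xi>) (cof (Jp w e \<xi>))) = (\<Sum>\<sigma>\<in>ref_faces. 4 * face_value w (e, \<sigma>))" if e: "e \<in> cells" for e
  proof -
    obtain M b where mc: "mesh_cell e (\<tau> e) M b a" using mesh_cell_exists[OF e] .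
    interpret mesh_cell e "\<tau> e" M b a by fact
    have f: "w \<circ> cmap e = (\<lambda>\<xi>. (w \<circ> ref_map a) (\<tau> e \<xi>))" by (auto simp: cell_map_def)
    have "Q4 (\<lambda>\<xi>. frob (jac (z \<circ> cmap e) \<xi>) (cof (Jp w e \<xi>))) =
        (\<Sum>v\<in>ref_corners. 4 * (1/24 * frob M (cof (nodal_jac (w \<circ> cmap e) (quad_point v)))))"
      unfolding Q4_eq
    proof (intro sum.cong refl)
      fix v assume v: "v \<in> ref_corners"
      note sm = smooth_quad_point[OF v]
      have "jac (\<tau> e) (quad_point v) = M" using jac_affine[OF sm, of M b] by (simp add: chart_eq[abs_def])
      then show "1/24 * frob (jac (z \<circ> cmap e) (quad_point v)) (cof (Jp w e (quad_point v))) =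
          4 * (1/24 * frob M (cof (nodal_jac (w \<circ> cmap e) (quad_point v))))"
        using jac_potential[OF e sm] jac_eq_nodal_jac[OF quadratic_fe[OF assms e] sm] by (simp add: frob_eq_inner)
    qed
    also have "\<dots> = 4 * (\<Sum>v\<in>ref_corners. 1/24 * frob M (cof (nodal_jac (w \<circ> cmap e) (quad_point v))))"
      by (simp only: sum_distrib_left)
    also have "\<dots> = (\<Sum>(l0, l1, l2)\<in>ref_opposite. 4 * face_value w (e, tri_param l0 l1 l2))"
      unfolding f cell_stokes[OF chart_eq] ref_opposite_def face_value_def
      by (simp add: tri_param_at axis_distinct axis_distinct(1-3)[symmetric])
    also have "\<dots> = (\<Sum>\<sigma>\<in>ref_faces. 4 * face_value w (e, \<sigma>))"
      unfolding ref_faces_eq by (subst sum.reindex[OF inj_on_tri_param]) (simp add: case_prod_unfold)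
    finally show ?thesis .
  qed
  then show ?thesis
    unfolding coupling_def by (simp add: sum.cartesian_product')
qed

end

subsection \<open>Cancellation over interior faces\<close>


unbundle cross3_syntax

text \<open>Signed volume of the parallelepiped; it is positive exactly when the cross product of
  the edges of the face points away from \<open>v\<close>, which makes its sign a test for outward
  orientation.\<close>

definition vol :: "real^3 \<Rightarrow> real^3 \<Rightarrow> real^3 \<Rightarrow> real^3 \<Rightarrow> real" where
  "vol x y z v = (x - v) \<bullet> ((y - x) \<times> (z - x))"

unbundle no cross3_syntax

lemma vol_rotate: "vol y z x v = vol x y z v"
  unfolding vol_def triple_product vector_minus_component by algebra

lemma vol_swap: "vol x z y v = - vol x y z v"
  unfolding vol_def triple_product vector_minus_component by algebra

lemma vol_affine:
  assumes "\<And>\<xi>. \<tau> \<xi> = M *v \<xi> + b"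
  shows "vol (\<tau> x) (\<tau> y) (\<tau> z) (\<tau> v) = det M * vol x y z v"
  unfolding vol_def triple_product vector_minus_component assms
  by (simp add: matrix_vector_mult_def sum_3 det_3) algebra

text \<open>In the Freudenthal grid the two vertices opposite to a common face form a parallelogram
  with an edge of that face, whose diagonals are v v' and x y. Hence they lie on opposite
  sides.\<close>

lemma vol_reflect: "v + v' = x + y \<Longrightarrow> vol x y z v' = - vol x y z v"
proof -
  assume "v + v' = x + y"
  then have "v' = x + y - v" by (simp add: algebra_simps)
  then have v': "v' $ i = x $ i + y $ i - v $ i" for i by simp
  show ?thesis unfolding vol_def triple_product vector_minus_component v' by algebra
qed

text \<open>Both quantities alternate, so the order of listing the face affects them by the same
  sign, which cancels in the product of \<open>tri_form\<close> with the sign of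
  \<open>vol\<close>.\<close>

lemma tri_form_vol_permute:
  assumes "{p, q, r} = {x, y, z}" "p \<noteq> q" "p \<noteq> r" "q \<noteq> r"
  shows "\<exists>s\<in>{1, -1}. tri_form g g p q r = s * tri_form g g x y z \<and> vol p q r v = s * vol x y z v"
proof -
  have "p \<in> {x, y, z}" "q \<in> {x, y, z}" "r \<in> {x, y, z}" using assms(1) by blast+
  then consider "p = x" "q = y" "r = z" | "p = y" "q = z" "r = x" | "p = z" "q = x" "r = y"
    | "p = x" "q = z" "r = y" | "p = y" "q = x" "r = z" | "p = z" "q = y" "r = x"
    using assms(2-4) by auto
  note cases = this
  note rot = tri_form_rotate[where g = g and h = g and x = x and y = y and z = z] vol_rotate[where x = x and y = y and z = z]
    tri_form_rotate[where g = g and h = g and x = y and y = z and z = x] vol_rotate[where x = y and y = z and z = x]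
  from cases show ?thesis
  proof cases
    case 1 then show ?thesis by (intro bexI[of _ 1]) auto
  next
    case 2 then show ?thesis using rot by (intro bexI[of _ 1]) auto
  next
    case 3 then show ?thesis using rot by (intro bexI[of _ 1]) auto
  next
    case 4 then show ?thesis
      using tri_form_swap[where g = g and x = x and y = y and z = z] vol_swap[where x = x and y = y and z = z]
      by (intro bexI[of _ "-1"]) auto
  next
    case 5 then show ?thesis
      using rot tri_form_swap[where g = g and x = y and y = z and z = x] vol_swap[where x = y and y = z and z = x]
      by (intro bexI[of _ "-1"]) auto
  next
    case 6 then show ?thesis
      using rot tri_form_swap[where g = g and x = z and y = x and z = y] vol_swap[where x = z and y = x and z = y]
      by (intro bexI[of _ "-1"]) auto
  qed
qed

text \<open>Vertices are listed along the path, so that both cells at an interior face list it in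
  the same order; the orientation is restored by the sign in \<open>outward_value\<close>.\<close>

fun opposite_face :: "cell \<Rightarrow> nat \<Rightarrow> (real^3) \<times> (real^3) \<times> (real^3)" where
  "opposite_face e k =
     (if k = 0 then (vert e 1, vert e 2, vert e 3) else if k = 1 then (vert e 0, vert e 2, vert e 3)
      else if k = 2 then (vert e 0, vert e 1, vert e 3) else (vert e 0, vert e 1, vert e 2))"

declare opposite_face.simps [simp del]

definition outward_value :: "(real^3 \<Rightarrow> real^3) \<Rightarrow> cell \<Rightarrow> nat \<Rightarrow> real" where
  "outward_value g e k = (case opposite_face e k of (x, y, z) \<Rightarrow> sgn (vol x y z (vert e k)) * tri_form g g x y z)"

text \<open>Omitting the first vertex leaves the face where the first incremented coordinate is at
  its upper value, and omitting the last one leaves the face where the last coordinate is at its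
  lower value. The other two faces cut through a cube.\<close>

definition on_boundary :: "cell \<Rightarrow> nat \<Rightarrow> bool" where
  "on_boundary e k \<longleftrightarrow> k = 0 \<and> fst e $ snd e 1 = 1/2 \<or> k = 3 \<and> fst e $ snd e 3 = 0"

text \<open>Crossing an inner face of a cube exchanges two consecutive steps of the path. Crossing a
  cube face shifts the path: a first step is dropped and appended at the end in the next cube, or
  the reverse.\<close>

fun neighbour :: "cell \<times> nat \<Rightarrow> cell \<times> nat" where
  "neighbour ((c, p), k) =
     (if k = 0 then ((c + (1/2) *\<^sub>R axis (p 1) 1, path (p 2) (p 3) (p 1)), 3)
      else if k = 1 then ((c, path (p 2) (p 1) (p 3)), 1)
      else if k = 2 then ((c, path (p 1) (p 3) (p 2)), 2)
      else ((c - (1/2) *\<^sub>R axis (p 3) 1, path (p 3) (p 1) (p 2)), 0))"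

definition interior_faces :: "(cell \<times> nat) set" where
  "interior_faces = {(e, k). e \<in> cells \<and> k \<in> {0,1,2,3} \<and> \<not> on_boundary e k}"

lemma path_eta: "path (p 1) (p 2) (p 3) = p"
  by (rule ext) (metis exhaust_3 path_simps)

lemma cells_iff: "(c, p) \<in> cells \<longleftrightarrow> (\<forall>i. c $ i = 0 \<or> c $ i = 1/2) \<and> bij p"
  by (simp add: cells_def)

lemma bij_path_perm:
  fixes p :: "3 \<Rightarrow> 3"
  assumes "bij p"
  shows "bij (path (p 2) (p 3) (p 1))" "bij (path (p 2) (p 1) (p 3))" "bij (path (p 1) (p 3) (p 2))" "bij (path (p 3) (p 1) (p 2))"
proof -
  have "p 1 \<noteq> p 2" "p 1 \<noteq> p 3" "p 2 \<noteq> p 3" using assms by (auto simp: bij_def inj_eq)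
  then show "bij (path (p 2) (p 3) (p 1))" "bij (path (p 2) (p 1) (p 3))" "bij (path (p 1) (p 3) (p 2))" "bij (path (p 3) (p 1) (p 2))"
    by (auto intro!: bij_path)
qed

lemma neighbour_interior:
  assumes "x \<in> interior_faces"
  shows "neighbour x \<in> interior_faces" "neighbour (neighbour x) = x"
proof -
  obtain c p k where x: "x = ((c, p), k)" by (metis surj_pair)
  have cp: "\<And>i. c $ i = 0 \<or> c $ i = 1/2" "bij p" "k \<in> {0,1,2,3}" "\<not> on_boundary (c, p) k"
    using assms by (auto simp: interior_faces_def x cells_iff)
  have cells: "(c', path (p 2) (p 3) (p 1)) \<in> cells" "(c', path (p 2) (p 1) (p 3)) \<in> cells"
    "(c', path (p 1) (p 3) (p 2)) \<in> cells" "(c', path (p 3) (p 1) (p 2)) \<in> cells"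
    if "\<And>i. c' $ i = 0 \<or> c' $ i = 1/2" for c'
    using that bij_path_perm[OF cp(2)] unfolding cells_iff by blast+
  consider "k = 0" "c $ p 1 = 0" | "k = 1" | "k = 2" | "k = 3" "c $ p 3 = 1/2"
    using cp(1)[of "p 1"] cp(1)[of "p 3"] cp(3,4) by (auto simp: on_boundary_def)
  then have "neighbour x \<in> interior_faces \<and> neighbour (neighbour x) = x"
  proof cases
    case 1
    have "(c + (1/2) *\<^sub>R axis (p 1) 1) $ i = 0 \<or> (c + (1/2) *\<^sub>R axis (p 1) 1) $ i = 1/2" for i
      using cp(1)[of i] 1 by (auto simp: axis_def)
    from cells(1)[OF this] show ?thesis
      using 1 by (simp add: x interior_faces_def on_boundary_def path_simps path_eta)
  next
    case 2
    from cells(2)[OF cp(1)] show ?thesis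
      using 2 by (simp add: x interior_faces_def on_boundary_def path_simps path_eta)
  next
    case 3
    from cells(3)[OF cp(1)] show ?thesis
      using 3 by (simp add: x interior_faces_def on_boundary_def path_simps path_eta)
  next
    case 4
    have "(c - (1/2) *\<^sub>R axis (p 3) 1) $ i = 0 \<or> (c - (1/2) *\<^sub>R axis (p 3) 1) $ i = 1/2" for i
      using cp(1)[of i] 4 by (auto simp: axis_def)
    from cells(4)[OF this] show ?thesis
      using 4 by (simp add: x interior_faces_def on_boundary_def path_simps path_eta)
  qed
  then show "neighbour x \<in> interior_faces" "neighbour (neighbour x) = x" by blast+
qed

lemma outward_value_neighbour:
  assumes "k \<in> {0,1,2,3}" "neighbour (e, k) = (e', k')"
  shows "outward_value g e' k' = - outward_value g e k"
proof -
  obtain c p where e: "e = (c, p)" by (cases e)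
  have "opposite_face e' k' = opposite_face e k \<and>
      (case opposite_face e k of (x, y, z) \<Rightarrow> vol x y z (vert e' k') = - vol x y z (vert e k))"
    using assms(1)
  proof (elim insertE emptyE)
    assume k: "k = 0"
    have "vert e 0 + vert e' 3 = vert e 1 + vert e 3"
      using assms(2) by (auto simp: e k vert_simps vert_nat_simps path_simps algebra_simps)
    from vol_reflect[OF this, of "vert e 2"]
    have "vol (vert e 1) (vert e 2) (vert e 3) (vert e' 3) = - vol (vert e 1) (vert e 2) (vert e 3) (vert e 0)"
      by (simp add: vol_swap[of _ "vert e 3" "vert e 2"])
    then show ?thesis
      using assms(2) by (auto simp: e k opposite_face.simps vert_simps vert_nat_simps path_simps algebra_simps)
  next
    assume k: "k = 1"
    have "vert e 1 + vert e' 1 = vert e 0 + vert e 2"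
      using assms(2) by (auto simp: e k vert_simps vert_nat_simps path_simps algebra_simps)
    from vol_reflect[OF this, of "vert e 3"]
    have "vol (vert e 0) (vert e 2) (vert e 3) (vert e' 1) = - vol (vert e 0) (vert e 2) (vert e 3) (vert e 1)" .
    then show ?thesis
      using assms(2) by (auto simp: e k opposite_face.simps vert_simps vert_nat_simps path_simps algebra_simps)
  next
    assume k: "k = 2"
    have "vert e 2 + vert e' 2 = vert e 1 + vert e 3"
      using assms(2) by (auto simp: e k vert_simps vert_nat_simps path_simps algebra_simps)
    from vol_reflect[OF this, of "vert e 0"]
    have "vol (vert e 0) (vert e 1) (vert e 3) (vert e' 2) = - vol (vert e 0) (vert e 1) (vert e 3) (vert e 2)"
      by (simp add: vol_rotate)
    then show ?thesis
      using assms(2) by (auto simp: e k opposite_face.simps vert_simps vert_nat_simps path_simps algebra_simps)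
  next
    assume k: "k = 3"
    have "vert e 3 + vert e' 0 = vert e 0 + vert e 2"
      using assms(2) by (auto simp: e k vert_simps vert_nat_simps path_simps algebra_simps)
    from vol_reflect[OF this, of "vert e 1"]
    have "vol (vert e 0) (vert e 1) (vert e 2) (vert e' 0) = - vol (vert e 0) (vert e 1) (vert e 2) (vert e 3)"
      by (simp only: vol_swap[of "vert e 0" "vert e 1" "vert e 2"] minus_minus)
    then show ?thesis
      using assms(2) by (auto simp: e k opposite_face.simps vert_simps vert_nat_simps path_simps algebra_simps)
  qed
  then show ?thesis
    unfolding outward_value_def by (auto simp: sgn_minus split: prod.splits)
qed

text \<open>Reindexing by the involution \<open>neighbour\<close> changes the sign of each term, so
  that the sum equals its own negative.\<close>

lemma sum_interior_faces: "(\<Sum>(e, k)\<in>interior_faces. outward_value g e k) = 0"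
proof -
  define f where "f = (\<lambda>(e, k). outward_value g e k)"
  have neg: "f (neighbour x) = - f x" if "x \<in> interior_faces" for x
    using that outward_value_neighbour by (cases x; cases "neighbour x") (auto simp: f_def interior_faces_def)
  have "sum f interior_faces = (\<Sum>x\<in>interior_faces. - f x)"
    by (rule sum.reindex_bij_witness[of _ neighbour neighbour]) (auto simp: neighbour_interior neg)
  then show ?thesis by (simp add: sum_negf f_def)
qed

subsection \<open>The boundary matrix\<close>


lemma tri_param_image: "tri_param x y z ` ref_tri = convex hull {x, y, z}"
proof
  show "tri_param x y z ` ref_tri \<subseteq> convex hull {x, y, z}"
    unfolding convex_hull_3
    by (force simp: ref_tri_def tri_param_def)
  show "convex hull {x, y, z} \<subseteq> tri_param x y z ` ref_tri"
  proof
    fix t assume "t \<in> convex hull {x, y, z}"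
    then obtain u v w where t: "t = u *\<^sub>R x + v *\<^sub>R y + w *\<^sub>R z" "0 \<le> u" "0 \<le> v" "0 \<le> w" "u + v + w = 1"
      unfolding convex_hull_3 by auto
    then have "u = 1 - v - w" by simp
    then show "t \<in> tri_param x y z ` ref_tri"
      using t by (intro image_eqI[of _ _ "vector [v, w]"]) (auto simp: tri_param_def ref_tri_def)
  qed
qed

lemma frontier_cube: "frontier (cbox 0 (1 :: real^3)) = cbox 0 1 - box 0 1"
  by (simp add: frontier_def interior_cbox)

context chart
begin

lemma path_distinct: "snd e 1 \<noteq> snd e 2" "snd e 1 \<noteq> snd e 3" "snd e 2 \<noteq> snd e 3"
  using cell by (cases e; auto simp: cells_def bij_def inj_eq)+

lemma path_forall: "P (snd e 1) \<Longrightarrow> P (snd e 2) \<Longrightarrow> P (snd e 3) \<Longrightarrow> P i"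
proof -
  have "{snd e 1, snd e 2, snd e 3} = UNIV"
    using path_distinct by (intro card_subset_eq) auto
  then have "i \<in> {snd e 1, snd e 2, snd e 3}" by simp
  then show "P (snd e 1) \<Longrightarrow> P (snd e 2) \<Longrightarrow> P (snd e 3) \<Longrightarrow> P i" by blast
qed

lemma corner_coordinate: "fst e $ i = 0 \<or> fst e $ i = 1/2"
  using cell by (cases e) (auto simp: cells_def)

lemma vert_coordinates:
  "vert e 1 $ snd e 1 = fst e $ snd e 1 + 1/2" "vert e 2 $ snd e 1 = fst e $ snd e 1 + 1/2" "vert e 3 $ snd e 1 = fst e $ snd e 1 + 1/2"
  "vert e 1 $ snd e 2 = fst e $ snd e 2" "vert e 2 $ snd e 2 = fst e $ snd e 2 + 1/2" "vert e 3 $ snd e 2 = fst e $ snd e 2 + 1/2"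
  "vert e 1 $ snd e 3 = fst e $ snd e 3" "vert e 2 $ snd e 3 = fst e $ snd e 3" "vert e 3 $ snd e 3 = fst e $ snd e 3 + 1/2"
  "vert e 0 $ i = fst e $ i"
  using path_distinct path_distinct[symmetric] by (simp_all add: vert_simps vert_nat_simps axis_def)

lemma chart_tri_image: "\<tau> ` tri_param x y z ` ref_tri = convex hull {\<tau> x, \<tau> y, \<tau> z}"
  unfolding tri_param_image[symmetric] image_image by (simp only: affine_tri_param[OF chart_eq])

text \<open>On a face omitting the first or last vertex some coordinate is constant, which decides
  the boundary case. In the remaining cases all coordinates of the centroid lie strictly between 0
  and 1.\<close>

lemma opposite_face_boundary:
  assumes "k \<in> {0,1,2,3}" "opposite_face e k = (x, y, z)"
  shows "convex hull {x, y, z} \<subseteq> frontier (cbox 0 1) \<longleftrightarrow> on_boundary e k"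
proof
  assume "on_boundary e k"
  then consider "k = 0" "fst e $ snd e 1 = 1/2" | "k = 3" "fst e $ snd e 3 = 0"
    by (auto simp: on_boundary_def)
  then obtain i :: 3 and v :: real where iv: "v = 0 \<or> v = 1" "x $ i = v" "y $ i = v" "z $ i = v"
  proof cases
    case 1
    then show thesis
      using assms(2) that[of 1 "snd e 1"] vert_coordinates(1-3) by (simp add: opposite_face.simps)
  next
    case 2
    then show thesis
      using assms(2) that[of 0 "snd e 3"] vert_coordinates(7,8) vert_coordinates(10)[of "snd e 3"]
      by (simp add: opposite_face.simps)
  qed
  have "convex hull {x, y, z} \<subseteq> {t. t $ i = v}"
  proof (rule hull_minimal)
    have "{t. t $ i = v} = {t. axis i 1 \<bullet> t = v}" by (simp add: inner_axis')
    then show "convex {t. t $ i = v}" by (simp add: convex_hyperplane)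
  qed (use iv in auto)
  moreover have "{x, y, z} \<subseteq> verts e"
    using assms by (auto simp: opposite_face.simps verts_def)
  then have "convex hull {x, y, z} \<subseteq> cbox 0 1"
    using tetrahedron_subset_cube[OF cell] hull_mono[of "{x, y, z}" "verts e" convex] unfolding tetrahedron_eq by blast
  moreover have "t \<notin> box 0 1" if "t $ i = v" for t
    using that iv(1) by (auto simp: mem_box_cart intro!: exI[of _ i])
  ultimately show "convex hull {x, y, z} \<subseteq> frontier (cbox 0 1)"
    unfolding frontier_cube by blast
next
  assume sub: "convex hull {x, y, z} \<subseteq> frontier (cbox 0 1)"
  show "on_boundary e k"
  proof (rule ccontr)
    assume nb: "\<not> on_boundary e k"
    define t where "t = (1/3) *\<^sub>R x + (1/3) *\<^sub>R y + (1/3) *\<^sub>R z"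
    have "t \<in> convex hull {x, y, z}"
      unfolding convex_hull_3 t_def by (force intro!: exI[of _ "1/3::real"])
    have c: "0 \<le> fst e $ i" "fst e $ i \<le> 1/2" for i using corner_coordinate[of i] by auto
    have "0 < t $ i \<and> t $ i < 1" for i
    proof (rule path_forall)
      show "0 < t $ snd e 1 \<and> t $ snd e 1 < 1"
        using assms nb c[of "snd e 1"] corner_coordinate[of "snd e 1"]
        by (auto simp: t_def opposite_face.simps on_boundary_def vert_coordinates field_simps simp del: One_nat_def)
      show "0 < t $ snd e 2 \<and> t $ snd e 2 < 1"
        using assms c[of "snd e 2"]
        by (auto simp: t_def opposite_face.simps vert_coordinates field_simps simp del: One_nat_def)
      show "0 < t $ snd e 3 \<and> t $ snd e 3 < 1"
        using assms nb c[of "snd e 3"] corner_coordinate[of "snd e 3"]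
        by (auto simp: t_def opposite_face.simps on_boundary_def vert_coordinates field_simps simp del: One_nat_def)
    qed
    then have "t \<in> box 0 1" by (simp add: mem_box_cart)
    then show False using sub \<open>t \<in> convex hull {x, y, z}\<close> by (auto simp: frontier_cube)
  qed
qed

end

context mesh_cell
begin

text \<open>The reference faces have volume +1 with respect to their opposite corners, and the
  positive determinant of the chart preserves this sign. It therefore agrees with the outward sign
  assigned by the mesh, whatever order the chart gives to the vertices.\<close>

lemma opposite_face_chart:
  assumes "(l0, l1, l2, l3) \<in> {(axis 1 1, axis 2 1, axis 3 1, 0), (0, axis 3 1, axis 2 1, axis 1 1),
    (0, axis 1 1, axis 3 1, axis 2 1), (0, axis 2 1, axis 1 1, axis 3 1)}"
    and "k \<in> {0,1,2,3}" "\<tau> l3 = vert e k" "opposite_face e k = (x, y, z)"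
  shows "{\<tau> l0, \<tau> l1, \<tau> l2} = {x, y, z}" "tri_form g g (\<tau> l0) (\<tau> l1) (\<tau> l2) = outward_value g e k"
proof -
  have corners: "{l0, l1, l2, l3} = ref_corners"
    using assms(1) by (auto simp: ref_corners_def)
  have dist: "l0 \<noteq> l1" "l0 \<noteq> l2" "l1 \<noteq> l2" "l0 \<noteq> l3" "l1 \<noteq> l3" "l2 \<noteq> l3"
    using assms(1) by (auto simp: axis_distinct axis_distinct(1-3)[symmetric])
  have one: "vol l0 l1 l2 l3 = 1"
    using assms(1) by (auto simp: vol_def triple_product axis_nth_3)
  have "{\<tau> l0, \<tau> l1, \<tau> l2} = verts e - {vert e k}"
  proof -
    have "{\<tau> l0, \<tau> l1, \<tau> l2, \<tau> l3} = verts e"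
      unfolding chart_corners[symmetric] corners[symmetric] by simp
    then show ?thesis
      using dist inj_chart by (auto simp: assms(3)[symmetric] dest: injD)
  qed
  also have "\<dots> = {x, y, z}"
    using assms(2,4) distinct_verts by (auto simp: opposite_face.simps verts_def)
  finally show set: "{\<tau> l0, \<tau> l1, \<tau> l2} = {x, y, z}" .
  have "\<tau> l0 \<noteq> \<tau> l1" "\<tau> l0 \<noteq> \<tau> l2" "\<tau> l1 \<noteq> \<tau> l2" using dist inj_chart by (auto dest: injD)
  from tri_form_vol_permute[OF set this, of g "vert e k"]
  obtain s where s: "s \<in> {1, -1}" "tri_form g g (\<tau> l0) (\<tau> l1) (\<tau> l2) = s * tri_form g g x y z"
    "vol (\<tau> l0) (\<tau> l1) (\<tau> l2) (vert e k) = s * vol x y z (vert e k)" by blast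
  have "0 < vol (\<tau> l0) (\<tau> l1) (\<tau> l2) (vert e k)"
    unfolding assms(3)[symmetric] vol_affine[OF chart_eq] one using det_pos by simp
  then have "sgn (vol x y z (vert e k)) = s"
    using s(1,3) by (auto simp: sgn_if)
  then show "tri_form g g (\<tau> l0) (\<tau> l1) (\<tau> l2) = outward_value g e k"
    by (simp add: outward_value_def assms(4) s(2))
qed

text \<open>Passes from faces of the reference cell to faces indexed by the opposite mesh vertex; as
  all four corners are summed over, the unknown permutation is harmless.\<close>

lemma sum_ref_faces:
  assumes "\<And>l0 l1 l2 l3 k. (l0, l1, l2, l3) \<in> {(axis 1 1, axis 2 1, axis 3 1, 0), (0, axis 3 1, axis 2 1, axis 1 1),
    (0, axis 1 1, axis 3 1, axis 2 1), (0, axis 2 1, axis 1 1, axis 3 1)} \<Longrightarrow> k \<in> {0,1,2,3} \<Longrightarrow> \<tau> l3 = vert e k \<Longrightarrow>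
    F (tri_param l0 l1 l2) = q k"
  shows "(\<Sum>\<sigma>\<in>ref_faces. F \<sigma>) = (\<Sum>k\<in>{0,1,2,3::nat}. q k)"
proof -
  define h where "h v = (if v = vert e 0 then q 0 else if v = vert e 1 then q 1 else if v = vert e 2 then q 2 else q 3)" for v
  have h: "h (vert e k) = q k" if "k \<in> {0,1,2,3}" for k
    using that distinct_verts by (auto simp: h_def)
  have F: "F (tri_param l0 l1 l2) = h (\<tau> l3)"
    if mem: "(l0, l1, l2, l3) \<in> {(axis 1 1, axis 2 1, axis 3 1, 0), (0, axis 3 1, axis 2 1, axis 1 1),
    (0, axis 1 1, axis 3 1, axis 2 1), (0, axis 2 1, axis 1 1, axis 3 1)}" for l0 l1 l2 l3
  proof -
    have "l3 \<in> ref_corners" using mem by (auto simp: ref_corners_def)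
    then obtain k where k: "k \<in> {0,1,2,3}" "\<tau> l3 = vert e k"
      using chart_corner[of l3] by (auto simp: verts_def)
    then show ?thesis using assms[OF mem k] h[OF k(1)] by simp
  qed
  have "(\<Sum>\<sigma>\<in>ref_faces. F \<sigma>) = (\<Sum>(l0, l1, l2)\<in>ref_opposite. F (tri_param l0 l1 l2))"
    unfolding ref_faces_eq by (subst sum.reindex[OF inj_on_tri_param]) (simp add: case_prod_unfold)
  also have "\<dots> = (\<Sum>l\<in>ref_corners. h (\<tau> l))"
    unfolding ref_opposite_def sum_ref_corners
    by (simp add: F axis_distinct axis_distinct(1-3)[symmetric] add.assoc)
  also have "\<dots> = (\<Sum>v\<in>verts e. h v)" by (rule sum_verts[symmetric])
  also have "\<dots> = h (vert e 0) + (h (vert e 1) + (h (vert e 2) + h (vert e 3)))" by (rule sum_verts_nat)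
  also have "\<dots> = (\<Sum>k\<in>{0,1,2,3::nat}. q k)" by (simp add: h[of 0] h[of 1] h[of 2] h[of 3] del: One_nat_def)
  finally show ?thesis .
qed

lemma mid_node_exists:
  assumes "v \<in> verts e" "v' \<in> verts e"
  shows "\<exists>i\<le>4. \<exists>j\<le>4. \<exists>k\<le>4. mid v v' = node i j k"
proof -
  obtain c p where cp: "c \<in> set corner_codes" "codes_cell (c, p) e"
    using codes_cell_exists[OF cell] by blast
  obtain m n where mn: "m \<in> {0,1,2,3}" "n \<in> {0,1,2,3}" "v = vert e m" "v' = vert e n"
    using assms unfolding verts_def by blast
  obtain c1 c2 c3 p1 p2 p3 where eq: "c = (c1, c2, c3)" "p = (p1, p2, p3)" by (metis prod_cases3)
  have le: "c1 + (step p1 m + step p1 n) \<le> 4" "c2 + (step p2 m + step p2 n) \<le> 4" "c3 + (step p3 m + step p3 n) \<le> 4"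
    using cp(1) by (auto simp: eq corner_codes_def step_def)
  have "mid v v' = node_of (mid_node (c, p) m n)"
    using cp(2) mn unfolding eq codes_cell.simps by blast
  then have "mid v v' = node (c1 + (step p1 m + step p1 n)) (c2 + (step p2 m + step p2 n)) (c3 + (step p3 m + step p3 n))"
    by (simp only: eq mid_node.simps node_of.simps)
  then show ?thesis using le by blast
qed

end

section \<open>Polarization of the face form\<close>

lemma face_coef_add_left: "face_coef (\<lambda>t. g t + g' t) h x y z = face_coef g h x y z + face_coef g' h x y z"
  unfolding face_coef_def Let_def cross_add_left scaleR_right_distrib by (simp add: algebra_simps)

lemma face_coef_add_right: "face_coef g (\<lambda>t. h t + h' t) x y z = face_coef g h x y z + face_coef g h' x y z"
  unfolding face_coef_def Let_def cross_add_right scaleR_right_distrib by (simp add: algebra_simps)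

lemma face_coef_scale_left: "face_coef (\<lambda>t. k *\<^sub>R g t) h x y z = k *\<^sub>R face_coef g h x y z"
  unfolding face_coef_def Let_def cross_mult_left by (simp add: scaleR_right_distrib scaleR_right_diff_distrib mult.commute)

lemma face_coef_scale_right: "face_coef g (\<lambda>t. k *\<^sub>R h t) x y z = k *\<^sub>R face_coef g h x y z"
  unfolding face_coef_def Let_def cross_mult_right by (simp add: scaleR_right_distrib scaleR_right_diff_distrib mult.commute)

lemma tri_form_add_left: "tri_form (\<lambda>t. g t + g' t) h x y z = tri_form g h x y z + tri_form g' h x y z"
  unfolding tri_form_def face_coef_add_left by (simp add: inner_add_right algebra_simps)

lemma tri_form_add_right: "tri_form g (\<lambda>t. h t + h' t) x y z = tri_form g h x y z + tri_form g h' x y z"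
  unfolding tri_form_def face_coef_add_right by (simp add: inner_add_right algebra_simps)

lemma tri_form_scale_left: "tri_form (\<lambda>t. k *\<^sub>R g t) h x y z = k * tri_form g h x y z"
  unfolding tri_form_def face_coef_scale_left by (simp add: algebra_simps)

lemma tri_form_scale_right: "tri_form g (\<lambda>t. k *\<^sub>R h t) x y z = k * tri_form g h x y z"
  unfolding tri_form_def face_coef_scale_right by (simp add: algebra_simps)

definition tri_polar :: "(real^3 \<Rightarrow> real^3) \<Rightarrow> (real^3 \<Rightarrow> real^3) \<Rightarrow> real^3 \<Rightarrow> real^3 \<Rightarrow> real^3 \<Rightarrow> real" where
  "tri_polar g h x y z = tri_form g h x y z + tri_form h g x y z"

lemma tri_polar_commute: "tri_polar g h x y z = tri_polar h g x y z"
  by (simp add: tri_polar_def)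

lemma tri_polar_sum_left:
  assumes "finite S"
  shows "tri_polar (\<lambda>t. \<Sum>m\<in>S. c m *\<^sub>R d m t) h x y z = (\<Sum>m\<in>S. c m * tri_polar (d m) h x y z)"
  using assms
proof (induction S rule: finite_induct)
  case empty
  show ?case
    using tri_form_scale_left[of 0 "\<lambda>_. 0" h x y z] tri_form_scale_right[of h 0 "\<lambda>_. 0" x y z] by (simp add: tri_polar_def)
next
  case (insert m S)
  then show ?case
    by (simp add: tri_polar_def tri_form_add_left tri_form_add_right tri_form_scale_left tri_form_scale_right distrib_left)
qed

lemma tri_polar_sum:
  assumes "finite S"
  shows "tri_polar (\<lambda>t. \<Sum>m\<in>S. c m *\<^sub>R d m t) (\<lambda>t. \<Sum>n\<in>S. c' n *\<^sub>R d n t) x y z =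
    (\<Sum>m\<in>S. \<Sum>n\<in>S. c m * tri_polar (d m) (d n) x y z * c' n)"
proof -
  have "tri_polar (d m) (\<lambda>t. \<Sum>n\<in>S. c' n *\<^sub>R d n t) x y z = (\<Sum>n\<in>S. c' n * tri_polar (d m) (d n) x y z)" for m
    using tri_polar_sum_left[OF assms, of c' d "d m" x y z] by (simp add: tri_polar_commute[of "d m"])
  then show ?thesis
    unfolding tri_polar_sum_left[OF assms] by (simp add: sum_distrib_left mult_ac)
qed

lemma tri_form_cong:
  assumes "\<And>v v'. v \<in> {x, y, z} \<Longrightarrow> v' \<in> {x, y, z} \<Longrightarrow> g (mid v v') = g' (mid v v') \<and> h (mid v v') = h' (mid v v')"
  shows "tri_form g h x y z = tri_form g' h' x y z"
proof -
  have "g v = g' v \<and> h v = h' v" if "v \<in> {x, y, z}" for v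
    using assms[OF that that] by (simp add: mid_self)
  then show ?thesis
    unfolding tri_form_def face_coef_def Let_def using assms by (simp del: scaleR_right_distrib)
qed

lemma tri_form_expand:
  "tri_form (\<lambda>t. y t + p *\<^sub>R u t + q *\<^sub>R v t) (\<lambda>t. y t + p *\<^sub>R u t + q *\<^sub>R v t) x1 x2 x3 =
    (tri_form y y x1 x2 x3 + p * tri_polar y u x1 x2 x3 + p\<^sup>2 * tri_form u u x1 x2 x3) +
    q * (tri_polar y v x1 x2 x3 + p * tri_polar u v x1 x2 x3) + q\<^sup>2 * tri_form v v x1 x2 x3"
  by (simp add: tri_form_add_left tri_form_add_right tri_form_scale_left tri_form_scale_right tri_polar_def algebra_simps power2_eq_square)

lemma hessian_quadratic:
  assumes "\<And>p q. \<Phi> (\<lambda>x. y x + p *\<^sub>R u x + q *\<^sub>R v x) = (c0 + p * c1 + p\<^sup>2 * c2) + q * (c3 + p * c4) + q\<^sup>2 * c5"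
  shows "hessian \<Phi> y u v = c4"
proof -
  have "deriv (\<lambda>q. (c0 + p * c1 + p\<^sup>2 * c2) + q * (c3 + p * c4) + q\<^sup>2 * c5) 0 = c3 + p * c4" for p
    by (rule DERIV_imp_deriv) (auto intro!: derivative_eq_intros)
  moreover have "deriv (\<lambda>p. c3 + p * c4) 0 = c4"
    by (rule DERIV_imp_deriv) (auto intro!: derivative_eq_intros)
  ultimately show ?thesis
    unfolding hessian_def assms by simp
qed

lemma finite_ref_faces: "finite ref_faces"
  by (simp add: ref_faces_def)

lemma finite_trace_index: "finite trace_index"
proof -
  have "trace_index \<subseteq> ((\<lambda>(i, j, k). node i j k) ` ({..4} \<times> {..4} \<times> {..4})) \<times> UNIV"
    unfolding trace_index_def by force
  then show ?thesis by (rule finite_subset) simp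
qed

section \<open>The boundary matrix in trace coordinates\<close>

context mesh
begin

lemma coupling_eq_boundary_functional:
  assumes "w \<in> fe_space a \<tau>"
  shows "coupling cmap z w = boundary_functional \<tau> cmap z w"
proof -
  let ?g = "w \<circ> ref_map a"
  have cell: "(\<Sum>\<sigma>\<in>ref_faces. if (e, \<sigma>) \<in> boundary_faces \<tau> then 0 else face_value w (e, \<sigma>)) =
      (\<Sum>k\<in>{0,1,2,3::nat}. if on_boundary e k then 0 else outward_value ?g e k)" if e: "e \<in> cells" for e
  proof -
    obtain M b where mc: "mesh_cell e (\<tau> e) M b a" using mesh_cell_exists[OF e] .
    interpret mesh_cell e "\<tau> e" M b a by fact
    show ?thesis
    proof (rule sum_ref_faces)
      fix l0 l1 l2 l3 :: "real^3" and k :: nat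
      assume l: "(l0, l1, l2, l3) \<in> {(axis 1 1, axis 2 1, axis 3 1, 0), (0, axis 3 1, axis 2 1, axis 1 1),
        (0, axis 1 1, axis 3 1, axis 2 1), (0, axis 2 1, axis 1 1, axis 3 1)}"
        and k: "k \<in> {0,1,2,3}" "\<tau> e l3 = vert e k"
      obtain x y zz where op: "opposite_face e k = (x, y, zz)" by (metis prod_cases3)
      note of = opposite_face_chart[OF l k op]
      have "tri_param l0 l1 l2 \<in> ref_faces"
        using l by (auto simp: ref_faces_eq ref_opposite_def)
      moreover have "\<tau> e ` tri_param l0 l1 l2 ` ref_tri = convex hull {x, y, zz}"
        unfolding chart_tri_image of(1) ..
      ultimately have "(e, tri_param l0 l1 l2) \<in> boundary_faces \<tau> \<longleftrightarrow> on_boundary e k"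
        using e opposite_face_boundary[OF k(1) op] by (simp add: boundary_faces_def)
      moreover have "face_value w (e, tri_param l0 l1 l2) = outward_value ?g e k"
        unfolding face_value_def prod.case tri_param_at by (rule of(2))
      ultimately show "(if (e, tri_param l0 l1 l2) \<in> boundary_faces \<tau> then 0 else face_value w (e, tri_param l0 l1 l2)) =
          (if on_boundary e k then 0 else outward_value ?g e k)" by simp
    qed
  qed
  have sub: "boundary_faces \<tau> \<subseteq> cells \<times> ref_faces" by (auto simp: boundary_faces_def)
  have fin: "finite (cells \<times> ref_faces)" by (simp add: finite_cells finite_ref_faces)
  have "(\<Sum>f\<in>cells \<times> ref_faces. if f \<in> boundary_faces \<tau> then 0 else face_value w f) =
      (\<Sum>e\<in>cells. \<Sum>k\<in>{0,1,2,3::nat}. if on_boundary e k then 0 else outward_value ?g e k)"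
    unfolding sum.cartesian_product' by (intro sum.cong refl cell)
  also have "\<dots> = (\<Sum>(e, k)\<in>cells \<times> {0,1,2,3}. if on_boundary e k then 0 else outward_value ?g e k)"
    by (rule sum.cartesian_product)
  also have "\<dots> = (\<Sum>(e, k)\<in>interior_faces. outward_value ?g e k)"
    by (rule sum.mono_neutral_cong_right) (auto simp: finite_cells interior_faces_def)
  also have "\<dots> = 0" by (rule sum_interior_faces)
  finally have zero: "(\<Sum>f\<in>cells \<times> ref_faces. if f \<in> boundary_faces \<tau> then 0 else face_value w f) = 0" .
  have "(\<Sum>f\<in>cells \<times> ref_faces. face_value w f) =
      (\<Sum>f\<in>cells \<times> ref_faces. (if f \<in> boundary_faces \<tau> then face_value w f else 0) + (if f \<in> boundary_faces \<tau> then 0 else face_value w f))"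
    by (intro sum.cong) auto
  also have "\<dots> = (\<Sum>f\<in>cells \<times> ref_faces. if f \<in> boundary_faces \<tau> then face_value w f else 0)"
    unfolding sum.distrib zero by simp
  also have "\<dots> = (\<Sum>f\<in>boundary_faces \<tau>. face_value w f)"
    using sub fin by (simp add: sum.If_cases Int_absorb1)
  finally show ?thesis
    unfolding coupling_eq[OF assms] boundary_functional_eq[OF assms] by (simp add: sum_distrib_left[symmetric])
qed

lemma fe_space_line:
  assumes "y \<in> fe_space a \<tau>" "u \<in> fe_space a \<tau>" "v \<in> fe_space a \<tau>"
  shows "(\<lambda>x. y x + p *\<^sub>R u x + q *\<^sub>R v x) \<in> fe_space a \<tau>"
proof -
  have "quadratic_on ref_tet ((\<lambda>x. y x + p *\<^sub>R u x + q *\<^sub>R v x) \<circ> cmap e)" if "e \<in> cells" for e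
  proof -
    have "(\<lambda>x. y x + p *\<^sub>R u x + q *\<^sub>R v x) \<circ> cmap e =
      (\<lambda>\<xi>. (y \<circ> cmap e) \<xi> + p *\<^sub>R (u \<circ> cmap e) \<xi> + q *\<^sub>R (v \<circ> cmap e) \<xi>)" by auto
    then show ?thesis
      by (simp only:) (intro quadratic_on_add quadratic_on_scaleR quadratic_fe assms that)
  qed
  moreover have "continuous_on (closure (Omega a)) (\<lambda>x. y x + p *\<^sub>R u x + q *\<^sub>R v x)"
    using assms by (intro continuous_intros) (auto simp: fe_space_def)
  ultimately show ?thesis by (simp add: fe_space_def)
qed

lemma shear_fe_space: "shear s \<in> fe_space a \<tau>"
proof -
  have "quadratic_on ref_tet (shear s \<circ> cmap e)" if "e \<in> cells" for e
    using quadratic_on_matrix_mult[OF quadratic_cell_map[OF that], of "shear_matrix s"] by (simp add: o_def shear_eq)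
  moreover have "continuous_on (closure (Omega a)) (shear s)"
    unfolding shear_eq[abs_def] by (intro linear_continuous_on matrix_vector_mul_bounded_linear)
  ultimately show ?thesis by (simp add: fe_space_def)
qed

text \<open>Nodal values of a basis function rather than the function itself. This is enough for the
  matrix entries, since \<open>tri_form\<close> depends on its arguments only through values at
  vertices and edge midpoints.\<close>

definition nodal_delta :: "(real^3) \<times> 3 \<Rightarrow> real^3 \<Rightarrow> real^3" where
  "nodal_delta m t = (if t = fst m then axis (snd m) 1 else 0)"

definition face_polar :: "(real^3 \<Rightarrow> real^3) \<Rightarrow> (real^3 \<Rightarrow> real^3) \<Rightarrow> cell \<times> (real^2 \<Rightarrow> real^3) \<Rightarrow> real" where
  "face_polar g h = (\<lambda>(e, \<sigma>). 4 * tri_polar g h (\<tau> e (\<sigma> 0)) (\<tau> e (\<sigma> (axis 1 1))) (\<tau> e (\<sigma> (axis 2 1))))"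

definition trace_matrix :: "(real^3) \<times> 3 \<Rightarrow> (real^3) \<times> 3 \<Rightarrow> real" where
  "trace_matrix m n = (\<Sum>f\<in>boundary_faces \<tau>. face_polar (nodal_delta m) (nodal_delta n) f)"

lemma nodal_delta_sum:
  assumes "u \<in> Vh a \<tau>" "\<exists>i\<le>4. \<exists>j\<le>4. \<exists>k\<le>4. t = node i j k" "t \<in> frontier (cbox 0 1)"
  shows "(\<Sum>m\<in>trace_index. R_trace a u m *\<^sub>R nodal_delta m t) = u (ref_map a t)"
proof (cases "t $ 1 = 0")
  case True
  have "t \<in> cbox 0 1" using assms(3) by (simp add: frontier_cube)
  then have "u (ref_map a t) = 0" using assms(1) True by (simp add: Vh_def)
  moreover have "nodal_delta m t = 0" if "m \<in> trace_index" for m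
    using that True by (auto simp: nodal_delta_def trace_index_def)
  ultimately show ?thesis by simp
next
  case False
  have "{t} \<times> UNIV \<subseteq> trace_index"
    using assms(2,3) False by (auto simp: trace_index_def)
  then have "(\<Sum>m\<in>trace_index. R_trace a u m *\<^sub>R nodal_delta m t) = (\<Sum>m\<in>{t} \<times> UNIV. R_trace a u m *\<^sub>R nodal_delta m t)"
    by (intro sum.mono_neutral_right finite_trace_index) (auto simp: nodal_delta_def)
  also have "\<dots> = (\<Sum>i\<in>UNIV. u (ref_map a t) $ i *\<^sub>R axis i 1)"
    unfolding sum.cartesian_product' by (simp add: R_trace_def nodal_delta_def)
  also have "\<dots> = u (ref_map a t)"
    by (simp add: sum_3 vec_eq_iff forall_3 axis_nth_3)
  finally show ?thesis .
qed

lemma face_polar_trace: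
  assumes "u \<in> Vh a \<tau>" "v \<in> Vh a \<tau>" "f \<in> boundary_faces \<tau>"
  shows "face_polar (u \<circ> ref_map a) (v \<circ> ref_map a) f =
    (\<Sum>m\<in>trace_index. \<Sum>n\<in>trace_index. R_trace a u m * face_polar (nodal_delta m) (nodal_delta n) f * R_trace a v n)"
proof -
  obtain e \<sigma> where f: "f = (e, \<sigma>)" "e \<in> cells" "\<sigma> \<in> ref_faces" "\<tau> e ` \<sigma> ` ref_tri \<subseteq> frontier (cbox 0 1)"
    using assms(3) by (auto simp: boundary_faces_def)
  obtain l0 l1 l2 where l: "\<sigma> = tri_param l0 l1 l2" "(l0, l1, l2) \<in> ref_opposite"
    using f(3) by (auto simp: ref_faces_eq)
  obtain M b where mc: "mesh_cell e (\<tau> e) M b a" using mesh_cell_exists[OF f(2)] .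
  interpret mesh_cell e "\<tau> e" M b a by fact
  let ?x = "\<tau> e l0" and ?y = "\<tau> e l1" and ?z = "\<tau> e l2"
  have hull: "convex hull {?x, ?y, ?z} \<subseteq> frontier (cbox 0 1)"
    using f(4) unfolding l(1) chart_tri_image .
  have vs: "{?x, ?y, ?z} \<subseteq> verts e" using ref_opposite_corners[OF l(2)] chart_corner by auto
  have val: "(\<Sum>m\<in>trace_index. R_trace a w m *\<^sub>R nodal_delta m (mid p q)) = (w \<circ> ref_map a) (mid p q)"
    if "w \<in> Vh a \<tau>" "p \<in> {?x, ?y, ?z}" "q \<in> {?x, ?y, ?z}" for w p q
  proof -
    \<comment> \<open>All six nodes of the face lie in its convex hull and hence on the boundary, so
      that trace coordinates determine the values there; on the clamped face both sides of the
      expansion are 0.\<close>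
    have "(1/2) *\<^sub>R p + (1/2) *\<^sub>R q \<in> convex hull {?x, ?y, ?z}"
      using that(2,3) by (intro convexD[OF convex_convex_hull] hull_inc) auto
    then have "mid p q \<in> frontier (cbox 0 1)" using hull by (auto simp: scaleR_right_distrib)
    then show ?thesis
      using nodal_delta_sum[OF that(1) mid_node_exists] that(2,3) vs by auto
  qed
  have "tri_polar (u \<circ> ref_map a) (v \<circ> ref_map a) ?x ?y ?z =
      tri_polar (\<lambda>t. \<Sum>m\<in>trace_index. R_trace a u m *\<^sub>R nodal_delta m t) (\<lambda>t. \<Sum>n\<in>trace_index. R_trace a v n *\<^sub>R nodal_delta n t) ?x ?y ?z"
    unfolding tri_polar_def
    by (intro arg_cong2[where f = "(+)"] tri_form_cong conjI) (simp_all only: val assms)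
  also have "\<dots> = (\<Sum>m\<in>trace_index. \<Sum>n\<in>trace_index. R_trace a u m * tri_polar (nodal_delta m) (nodal_delta n) ?x ?y ?z * R_trace a v n)"
    by (rule tri_polar_sum[OF finite_trace_index])
  finally show ?thesis
    by (simp add: face_polar_def f(1) l(1) tri_param_at sum_distrib_left mult_ac)
qed

lemma boundary_hessian:
  assumes "y \<in> fe_space a \<tau>" "u \<in> Vh a \<tau>" "v \<in> Vh a \<tau>"
  shows "hessian (boundary_functional \<tau> cmap z) y u v = trace_form a trace_matrix u v"
proof -
  note fe = fe_space_line[OF assms(1) Vh_fe[OF assms(2)] Vh_fe[OF assms(3)]]
  let ?y = "y \<circ> ref_map a" and ?u = "u \<circ> ref_map a" and ?v = "v \<circ> ref_map a"
  let ?q = "\<lambda>g f. case f of (e, \<sigma>) \<Rightarrow> 4 * tri_form g g (\<tau> e (\<sigma> 0)) (\<tau> e (\<sigma> (axis 1 1))) (\<tau> e (\<sigma> (axis 2 1)))"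
  have val: "4 * face_value (\<lambda>x. y x + p *\<^sub>R u x + q *\<^sub>R v x) f =
      (?q ?y f + p * face_polar ?y ?u f + p\<^sup>2 * ?q ?u f) + q * (face_polar ?y ?v f + p * face_polar ?u ?v f) + q\<^sup>2 * ?q ?v f" for p q f
  proof -
    have "(\<lambda>x. y x + p *\<^sub>R u x + q *\<^sub>R v x) \<circ> ref_map a = (\<lambda>t. ?y t + p *\<^sub>R ?u t + q *\<^sub>R ?v t)" by auto
    then show ?thesis
      by (cases f) (simp only: face_value_def face_polar_def prod.case tri_form_expand, simp add: algebra_simps)
  qed
  have "boundary_functional \<tau> cmap z (\<lambda>x. y x + p *\<^sub>R u x + q *\<^sub>R v x) =
      (sum (?q ?y) (boundary_faces \<tau>) + p * sum (face_polar ?y ?u) (boundary_faces \<tau>) + p\<^sup>2 * sum (?q ?u) (boundary_faces \<tau>)) +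
      q * (sum (face_polar ?y ?v) (boundary_faces \<tau>) + p * sum (face_polar ?u ?v) (boundary_faces \<tau>)) + q\<^sup>2 * sum (?q ?v) (boundary_faces \<tau>)" for p q
    unfolding boundary_functional_eq[OF fe] val
    by (simp only: sum.distrib sum_distrib_left[symmetric] distrib_left mult.assoc)
  then have "hessian (boundary_functional \<tau> cmap z) y u v = sum (face_polar ?u ?v) (boundary_faces \<tau>)"
    by (rule hessian_quadratic)
  also have "\<dots> = (\<Sum>f\<in>boundary_faces \<tau>. \<Sum>m\<in>trace_index. \<Sum>n\<in>trace_index. R_trace a u m * face_polar (nodal_delta m) (nodal_delta n) f * R_trace a v n)"
    by (intro sum.cong refl face_polar_trace assms)
  also have "\<dots> = (\<Sum>m\<in>trace_index. \<Sum>n\<in>trace_index. \<Sum>f\<in>boundary_faces \<tau>. R_trace a u m * face_polar (nodal_delta m) (nodal_delta n) f * R_trace a v n)"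
    by (subst sum.swap, intro sum.cong refl, subst sum.swap) simp
  also have "\<dots> = trace_form a trace_matrix u v"
    by (simp add: trace_form_def trace_matrix_def sum_distrib_left sum_distrib_right)
  finally show ?thesis .
qed

lemma trace_matrix_symmetric: "trace_matrix m n = trace_matrix n m"
  unfolding trace_matrix_def by (intro sum.cong refl) (auto simp: face_polar_def tri_polar_commute[of "nodal_delta m"])

lemma boundary_matrix_trace_matrix: "boundary_matrix a \<tau> z trace_matrix"
  unfolding boundary_matrix_def using trace_matrix_symmetric boundary_hessian by blast

lemma coupling_hessian:
  assumes "u \<in> Vh a \<tau>" "v \<in> Vh a \<tau>"
  shows "hessian (coupling cmap z) (shear s) u v = trace_form a trace_matrix u v"
proof -
  \<comment> \<open>The whole two-parameter family stays in \<open>fe_space\<close>, so that the two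
    functionals agree along it and not merely at the base point.\<close>
  have "hessian (coupling cmap z) (shear s) u v = hessian (boundary_functional \<tau> cmap z) (shear s) u v"
    unfolding hessian_def
    by (simp only: coupling_eq_boundary_functional[OF fe_space_line[OF shear_fe_space Vh_fe[OF assms(1)] Vh_fe[OF assms(2)]]])
  then show ?thesis by (simp only: boundary_hessian[OF shear_fe_space assms])
qed

end

theorem proposition21:
  fixes a z :: "real^3 \<Rightarrow> real^3" and \<tau> :: "cell \<Rightarrow> real^3 \<Rightarrow> real^3"
  assumes "nodal_field a"
    and "\<forall>e\<in>cells. cell_chart e (\<tau> e)"
    and "\<forall>t\<in>cbox 0 1. z (ref_map a t) = 4 *\<^sub>R t"
  shows
    "(\<forall>s \<kappa>. \<bar>s\<bar> \<le> 1/4 \<longrightarrow> (\<forall>e\<in>cells. 0 \<le> \<kappa> e) \<longrightarrow>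
        (\<forall>u\<in>Vh a \<tau>. 1/16 * A_form (cell_map a \<tau>) u u \<le> G_form (cell_map a \<tau>) \<kappa> z (shear s) u u)) \<and>
     (\<forall>u\<in>Vh a \<tau>. (\<exists>x\<in>closure (Omega a). u x \<noteq> 0) \<longrightarrow> 0 < A_form (cell_map a \<tau>) u u) \<and>
     (\<exists>B. boundary_matrix a \<tau> z B \<and>
        (\<forall>s \<kappa>. \<bar>s\<bar> \<le> 1/4 \<longrightarrow> (\<forall>e\<in>cells. 0 \<le> \<kappa> e) \<longrightarrow>
          (\<forall>u\<in>Vh a \<tau>. \<forall>v\<in>Vh a \<tau>.
             K_form (cell_map a \<tau>) \<kappa> (shear s) u v =
               G_form (cell_map a \<tau>) \<kappa> z (shear s) u v - trace_form a B u v))) \<and>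
     delta \<tau> (cell_map a \<tau>) > 1/2"
proof -
  interpret mesh a z \<tau>
    using assms by unfold_locales auto
  show ?thesis
  proof (intro conjI)
    show "\<forall>s \<kappa>. \<bar>s\<bar> \<le> 1/4 \<longrightarrow> (\<forall>e\<in>cells. 0 \<le> \<kappa> e) \<longrightarrow>
        (\<forall>u\<in>Vh a \<tau>. 1/16 * A_form (cell_map a \<tau>) u u \<le> G_form (cell_map a \<tau>) \<kappa> z (shear s) u u)"
      using G_form_lower_bound by blast
    show "\<forall>u\<in>Vh a \<tau>. (\<exists>x\<in>closure (Omega a). u x \<noteq> 0) \<longrightarrow> 0 < A_form (cell_map a \<tau>) u u"
      using A_form_positive by blast
    show "\<exists>B. boundary_matrix a \<tau> z B \<and>
        (\<forall>s \<kappa>. \<bar>s\<bar> \<le> 1/4 \<longrightarrow> (\<forall>e\<in>cells. 0 \<le> \<kappa> e) \<longrightarrow>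
          (\<forall>u\<in>Vh a \<tau>. \<forall>v\<in>Vh a \<tau>.
             K_form (cell_map a \<tau>) \<kappa> (shear s) u v =
               G_form (cell_map a \<tau>) \<kappa> z (shear s) u v - trace_form a B u v))"
      by (intro exI[of _ trace_matrix] conjI boundary_matrix_trace_matrix) (simp add: G_form_def coupling_hessian)
    show "delta \<tau> (cell_map a \<tau>) > 1/2"
      by (rule delta_lower_bound)
  qed
qed

end
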